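(* Let $p$ be a prime, $g_1=p-1$, $g_2=p^2-1$. The group $ku_*(\mathbb{Z}_{p^2}\wedge\mathbb{Z}_{p^2})$ is given (up to extensions) by $E_0\oplus E_1$, where $$E_0=\bigoplus_{i\ge 1,\;j\ge 1} ku_*/(p^2,\;p v^{g_1},\;v^{g_1+g_2})\,\langle [i,j]\rangle$$ and $$E_1=\bigoplus_{i\ge 1,\;g_1\ge j\ge 1} ku_*/(p^2)\,\langle [i,j]\rangle\;\oplus\bigoplus_{i\ge g_1,\;j\le g_2} ku_*/(p^2)\,\langle p[i,j]\rangle\;\oplus\bigoplus_{1\le i\le g_1,\;g_1\le j} ku_*/(p^2)\,\langle p[i,j]\rangle .$$
   Context: Fix a prime $p$. $ku$ denotes the $p$-localization of the connective complex $K$-theory spectrum, with coefficient ring $ku_*=\mathbb{Z}_{(p)}[v]$, $|v|=2$. $ku_*(\mathbb{Z}_{p^2}\wedge\mathbb{Z}_{p^2})$ denotes the reduced $ku$-homology of $B\mathbb{Z}_{p^2}\wedge B\mathbb{Z}_{p^2}$, where $B\mathbb{Z}_{p^2}$ is the classifying space of the cyclic group of order $p^2$. Put $a_k=\binom{p^2}{k+1}v^k$ for $0\le k\le p^2-1$. The reduced $ku$-homology $ku_*(\mathbb{Z}_{p^2})$ is the $ku_*$-module generated by elements $e_j\in ku_{2j-1}(\mathbb{Z}_{p^2})$, $j\ge 1$, subject to the relations $\sum_{k=0}^{p^2-1}a_k e_{j-k}=0$ (with $e_h=0$ for $h\le 0$). Let $F=\bigoplus_{i\ge1}ku_*\alpha_i$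 be the free $ku_*$-module on generators $\alpha_i$, and write $c[i,j]=c\,\alpha_i\otimes e_j\in F\otimes_{ku_*}ku_*(\mathbb{Z}_{p^2})$ for $c\in ku_*$; thus the indices $i,j$ of generators $[i,j]$ are positive integers. Let $\partial$ be the endomorphism of $F\otimes_{ku_*}ku_*(\mathbb{Z}_{p^2})$ given by $\partial([i,j])=\sum_{k=0}^{p^2-1}a_k[i-k,j]$ (with $[h,j]=0$ for $h\le 0$). Regard $\partial$ as a two-term chain complex, filtered by giving a nonzero $c[i,j]$ (coefficients being written modulo $p^2$) filtration $i(p^2+1)+j(p+1)$. "Up to extensions" means that the answer is the one read off from the spectral sequence of this filtered complex. $E_0$ corresponds to the cokernel of $\partial$, that is, to the term $ku_*(\mathbb{Z}_{p^2})\otimes_{ku_*}ku_*(\mathbb{Z}_{p^2})$, and $E_1$ to the kernel of $\partial$, that is, to the (suspended) term $\mathrm{Tor}_1^{ku_*}(ku_*(\mathbb{Z}_{p^2}),ku_*(\mathbb{Z}_{p^2}))$, of the Künneth (Landweber) split short exact sequence for $ku_*(\mathbb{Z}_{p^2}\wedge\mathbb{Z}_{p^2})$. For an ideal $I\subset ku_*$, $ku_*/I\,\langle[i,j]\rangle$ is the cyclic module $ku_*/I$ on a generator named $[i,j]$, and $ku_*/(p^2)\,\langle p[i,j]\rangle$ is the summand generated by $p[i,j]$, with coefficients of $[i,j]$ taken modulo $p^2$.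
   Formalization: The three index families in E_1 overlap, so a literal direct sum is too large (p=2, lowest degree: order 16, not 4); the sum is taken inside the direct sum of all ku_*/(p^2)<[i,j]>, i,j≥1, so a p[i,j] that repeats, or for which [i,j] is already present, counts once. *)

theory Defs
  imports
    "HOL-Algebra.Module"
    "HOL-Algebra.Ideal"
    "HOL-Computational_Algebra.Polynomial"
begin

section \<open>Modules: submodules, quotients, direct sums, isomorphisms\<close>

text \<open>
  The fields \<open>mult\<close> and \<open>one\<close> of the record type \<^type>\<open>module\<close> play no role for modules.
\<close>

definition gen_submodule ::
    "('a, 'c) ring_scheme \<Rightarrow> ('a, 'b, 'd) module_scheme \<Rightarrow> 'b set \<Rightarrow> 'b set" where
  "gen_submodule R M S = \<Inter>{N. submodule N R M \<and> S \<subseteq> N}"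

definition quotient_module :: "('a, 'b, 'd) module_scheme \<Rightarrow> 'b set \<Rightarrow> ('a, 'b set) module" where
  "quotient_module M N =
     \<lparr> carrier = a_rcosets\<^bsub>M\<^esub> N, monoid.mult = undefined, one = undefined,
       zero = N, add = set_add M,
       module.smult = (\<lambda>r A. \<Union>x\<in>A. N +>\<^bsub>M\<^esub> (r \<odot>\<^bsub>M\<^esub> x)) \<rparr>"

definition direct_sum ::
    "'i set \<Rightarrow> ('i \<Rightarrow> ('a, 'b, 'd) module_scheme) \<Rightarrow> ('a, 'i \<Rightarrow> 'b) module" where
  "direct_sum I M =
     \<lparr> carrier = {x \<in> \<Pi>\<^sub>E i\<in>I. carrier (M i). finite {i \<in> I. x i \<noteq> \<zero>\<^bsub>M i\<^esub>}},
       monoid.mult = undefined, one = undefined,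
       zero = (\<lambda>i\<in>I. \<zero>\<^bsub>M i\<^esub>),
       add = (\<lambda>x y. \<lambda>i\<in>I. x i \<oplus>\<^bsub>M i\<^esub> y i),
       module.smult = (\<lambda>r x. \<lambda>i\<in>I. r \<odot>\<^bsub>M i\<^esub> x i) \<rparr>"

definition summand ::
    "'i set \<Rightarrow> ('i \<Rightarrow> ('a, 'b, 'd) module_scheme) \<Rightarrow> 'i \<Rightarrow> 'b \<Rightarrow> 'i \<Rightarrow> 'b" where
  "summand I M i x = (\<lambda>k\<in>I. if k = i then x else \<zero>\<^bsub>M k\<^esub>)"

definition module_isos ::
    "('a, 'c) ring_scheme \<Rightarrow> ('a, 'b, 'd) module_scheme \<Rightarrow> ('a, 'e, 'f) module_scheme
       \<Rightarrow> ('b \<Rightarrow> 'e) set" where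
  "module_isos R M N =
     {h. bij_betw h (carrier M) (carrier N) \<and>
         (\<forall>x\<in>carrier M. \<forall>y\<in>carrier M. h (x \<oplus>\<^bsub>M\<^esub> y) = h x \<oplus>\<^bsub>N\<^esub> h y) \<and>
         (\<forall>r\<in>carrier R. \<forall>x\<in>carrier M. h (r \<odot>\<^bsub>M\<^esub> x) = r \<odot>\<^bsub>N\<^esub> h x)}"

definition regular_module :: "('a, 'c) ring_scheme \<Rightarrow> ('a, 'a) module" where
  "regular_module R =
     \<lparr> carrier = carrier R, monoid.mult = monoid.mult R, one = one R, zero = zero R,
       add = add R, module.smult = monoid.mult R \<rparr>"

definition cyclic_module :: "('a, 'c) ring_scheme \<Rightarrow> 'a set \<Rightarrow> ('a, 'a set) module" where
  "cyclic_module R S = quotient_module (regular_module R) (Idl\<^bsub>R\<^esub> S)"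


section \<open>The spectral sequence of a filtered complex\<close>

text \<open>
  The complex has chain groups contained in one ambient module \<open>C\<close>, differentials
  \<open>d n\<close> from degree \<open>n\<close> to degree \<open>n - 1\<close>, and an increasing filtration
  \<open>F n s\<close> of the chain group of degree \<open>n\<close>.  As usual,
  \<open>Z\<^sup>r\<^sub>s\<close> and \<open>B\<^sup>r\<^sub>s\<close> are the images in \<open>F\<^sub>s / F\<^sub>s\<^sub>-\<^sub>1\<close> of the \<open>r\<close>-approximate cycles and of
  the boundaries of \<open>(r-1)\<close>-approximate cycles in filtration \<open>s + r - 1\<close>, and
  \<open>E\<^sup>\<infinity>\<^sub>s = (\<Inter>\<^sub>r Z\<^sup>r\<^sub>s) / (\<Union>\<^sub>r B\<^sup>r\<^sub>s)\<close>.  Below, submodules of \<open>F\<^sub>s / F\<^sub>s\<^sub>-\<^sub>1\<close> are represented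
  by their preimages in \<open>F\<^sub>s\<close>.
\<close>

definition approx_cycles ::
    "(int \<Rightarrow> 'm \<Rightarrow> 'm) \<Rightarrow> (int \<Rightarrow> int \<Rightarrow> 'm set) \<Rightarrow> nat \<Rightarrow> int \<Rightarrow> int \<Rightarrow> 'm set" where
  "approx_cycles d F r n s = {x \<in> F n s. d n x \<in> F (n - 1) (s - int r)}"

definition Z_infinity ::
    "('a, 'm, 'c) module_scheme \<Rightarrow> (int \<Rightarrow> 'm \<Rightarrow> 'm) \<Rightarrow> (int \<Rightarrow> int \<Rightarrow> 'm set) \<Rightarrow> int \<Rightarrow> int \<Rightarrow> 'm set"
  where
  "Z_infinity C d F n s = (\<Inter>r. approx_cycles d F r n s <+>\<^bsub>C\<^esub> F n (s - 1))"

definition B_infinity ::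
    "('a, 'm, 'c) module_scheme \<Rightarrow> (int \<Rightarrow> 'm \<Rightarrow> 'm) \<Rightarrow> (int \<Rightarrow> int \<Rightarrow> 'm set) \<Rightarrow> int \<Rightarrow> int \<Rightarrow> 'm set"
  where
  "B_infinity C d F n s =
     (\<Union>r. (d (n + 1) ` approx_cycles d F r (n + 1) (s + int r)) <+>\<^bsub>C\<^esub> F n (s - 1))"

definition E_infinity ::
    "('a, 'm) module \<Rightarrow> (int \<Rightarrow> 'm \<Rightarrow> 'm) \<Rightarrow> (int \<Rightarrow> int \<Rightarrow> 'm set) \<Rightarrow> int \<Rightarrow> int
       \<Rightarrow> ('a, 'm set) module" where
  "E_infinity C d F n s =
     quotient_module (C\<lparr>carrier := Z_infinity C d F n s\<rparr>) (B_infinity C d F n s)"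

definition total_E_infinity ::
    "('a, 'm) module \<Rightarrow> (int \<Rightarrow> 'm \<Rightarrow> 'm) \<Rightarrow> (int \<Rightarrow> int \<Rightarrow> 'm set) \<Rightarrow> int
       \<Rightarrow> ('a, int \<Rightarrow> 'm set) module" where
  "total_E_infinity C d F n = direct_sum UNIV (E_infinity C d F n)"

text \<open>The class, in the total \<open>E\<^sup>\<infinity>\<close>-term, of \<open>x\<close> regarded as an element of filtration \<open>s\<close>.\<close>

definition E_infinity_class ::
    "('a, 'm) module \<Rightarrow> (int \<Rightarrow> 'm \<Rightarrow> 'm) \<Rightarrow> (int \<Rightarrow> int \<Rightarrow> 'm set) \<Rightarrow> int \<Rightarrow> int \<Rightarrow> 'm
       \<Rightarrow> int \<Rightarrow> 'm set" where
  "E_infinity_class C d F n s x =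
     summand UNIV (E_infinity C d F n) s (B_infinity C d F n s +>\<^bsub>C\<^esub> x)"


section \<open>The filtered complex for \<open>ku\<^sub>*(\<int>\<^bsub>p\<^sup>2\<^esub> \<and> \<int>\<^bsub>p\<^sup>2\<^esub>)\<close>\<close>

text \<open>\<open>ku\<^sub>* = \<int>\<^bsub>(p)\<^esub>[v]\<close>, as the rational polynomials whose coefficients have denominator prime to \<open>p\<close>.\<close>

definition ku :: "nat \<Rightarrow> rat poly ring" where
  "ku p =
     \<lparr> carrier = {f. \<forall>n. coprime (snd (quotient_of (coeff f n))) (int p)},
       monoid.mult = (*), one = 1, zero = 0, add = (+) \<rparr>"

abbreviation ku_v :: "rat poly" where
  "ku_v \<equiv> monom 1 1"

definition a_coeff :: "nat \<Rightarrow> nat \<Rightarrow> rat poly" where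
  "a_coeff p k = of_nat ((p\<^sup>2) choose (k + 1)) * ku_v ^ k"

abbreviation ku_free :: "nat \<Rightarrow> (rat poly, nat \<Rightarrow> rat poly) module" where
  "ku_free p \<equiv> direct_sum {1..} (\<lambda>_. regular_module (ku p))"

text \<open>
  Generators with index \<open>\<le> 0\<close> are zero.  Indices are natural numbers, so that \<open>j - k\<close>
  is \<open>0\<close> exactly if the integer difference is nonpositive; index \<open>0\<close> therefore stands for all
  nonpositive indices.
\<close>

definition free_gen :: "nat \<Rightarrow> nat \<Rightarrow> nat \<Rightarrow> rat poly" where
  "free_gen p j =
     (if j \<ge> 1 then summand {1..} (\<lambda>_. regular_module (ku p)) j 1 else \<zero>\<^bsub>ku_free p\<^esub>)"

definition ku_relations :: "nat \<Rightarrow> (nat \<Rightarrow> rat poly) set" where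
  "ku_relations p =
     gen_submodule (ku p) (ku_free p)
       {\<Oplus>\<^bsub>ku_free p\<^esub>k\<in>{0..p\<^sup>2 - 1}. a_coeff p k \<odot>\<^bsub>ku_free p\<^esub> free_gen p (j - k) | j. j \<ge> 1}"

definition ku_Z :: "nat \<Rightarrow> (rat poly, (nat \<Rightarrow> rat poly) set) module" where
  "ku_Z p = quotient_module (ku_free p) (ku_relations p)"

definition e_gen :: "nat \<Rightarrow> nat \<Rightarrow> (nat \<Rightarrow> rat poly) set" where
  "e_gen p j = ku_relations p +>\<^bsub>ku_free p\<^esub> free_gen p j"

text \<open>
  As \<open>F\<close> is free on \<open>\<alpha>\<^sub>1, \<alpha>\<^sub>2, \<dots>\<close>, the tensor product \<open>F \<otimes> ku\<^sub>*(\<int>\<^bsub>p\<^sup>2\<^esub>)\<close> is the direct sum of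
  copies \<open>\<alpha>\<^sub>i \<otimes> ku\<^sub>*(\<int>\<^bsub>p\<^sup>2\<^esub>)\<close> of \<open>ku\<^sub>*(\<int>\<^bsub>p\<^sup>2\<^esub>)\<close> for \<open>i \<ge> 1\<close>.
\<close>

definition F_tensor_ku :: "nat \<Rightarrow> (rat poly, nat \<Rightarrow> (nat \<Rightarrow> rat poly) set) module" where
  "F_tensor_ku p = direct_sum {1..} (\<lambda>_. ku_Z p)"

text \<open>\<open>c[i,j] = c \<alpha>\<^sub>i \<otimes> e\<^sub>j\<close>\<close>

definition bracket :: "nat \<Rightarrow> rat poly \<Rightarrow> nat \<Rightarrow> nat \<Rightarrow> nat \<Rightarrow> (nat \<Rightarrow> rat poly) set" where
  "bracket p c i j =
     (if i \<ge> 1 then summand {1..} (\<lambda>_. ku_Z p) i (c \<odot>\<^bsub>ku_Z p\<^esub> e_gen p j) else \<zero>\<^bsub>F_tensor_ku p\<^esub>)"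

text \<open>
  The endomorphism with \<open>\<partial>[i,j] = \<Sum>\<^sub>k a\<^sub>k [i-k,j]\<close>: the component at \<open>\<alpha>\<^sub>i\<close> of \<open>\<partial> x\<close> collects the
  contributions of the components of \<open>x\<close> at \<open>\<alpha>\<^sub>i\<^sub>+\<^sub>k\<close>.
\<close>

definition boundary ::
    "nat \<Rightarrow> (nat \<Rightarrow> (nat \<Rightarrow> rat poly) set) \<Rightarrow> nat \<Rightarrow> (nat \<Rightarrow> rat poly) set" where
  "boundary p x = (\<lambda>i\<in>{1..}. \<Oplus>\<^bsub>ku_Z p\<^esub>k\<in>{0..p\<^sup>2 - 1}. a_coeff p k \<odot>\<^bsub>ku_Z p\<^esub> x (i + k))"

definition filtration :: "nat \<Rightarrow> nat \<Rightarrow> nat \<Rightarrow> int" where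
  "filtration p i j = int (i * (p\<^sup>2 + 1) + j * (p + 1))"

text \<open>
  The two-term complex \<open>\<partial>: C\<^sub>1 \<rightarrow> C\<^sub>0\<close> with \<open>C\<^sub>1 = C\<^sub>0 = F \<otimes> ku\<^sub>*(\<int>\<^bsub>p\<^sup>2\<^esub>)\<close>; its homology is
  \<open>coker \<partial> = ku\<^sub>*(\<int>\<^bsub>p\<^sup>2\<^esub>) \<otimes> ku\<^sub>*(\<int>\<^bsub>p\<^sup>2\<^esub>)\<close> in degree 0 and
  \<open>ker \<partial> = Tor\<^sub>1(ku\<^sub>*(\<int>\<^bsub>p\<^sup>2\<^esub>), ku\<^sub>*(\<int>\<^bsub>p\<^sup>2\<^esub>))\<close> in degree 1.
\<close>

definition kunneth_d ::
    "nat \<Rightarrow> int \<Rightarrow> (nat \<Rightarrow> (nat \<Rightarrow> rat poly) set) \<Rightarrow> nat \<Rightarrow> (nat \<Rightarrow> rat poly) set" where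
  "kunneth_d p n = (if n = 1 then boundary p else (\<lambda>_. \<zero>\<^bsub>F_tensor_ku p\<^esub>))"

text \<open>
  Because \<open>p\<^sup>2[i,j] = a\<^sub>0[i,j] = - \<Sum>\<^sub>k\<^sub>\<ge>\<^sub>1 a\<^sub>k[i,j-k]\<close> lies in strictly lower filtration, the submodule
  generated by the \<open>[i,j]\<close> of filtration \<open>\<le> s\<close> is also the set of sums of \<open>c[i,j]\<close> of filtration
  \<open>\<le> s\<close> in which the coefficients of all \<open>c\<close> are reduced modulo \<open>p\<^sup>2\<close>.
\<close>

definition kunneth_filtration ::
    "nat \<Rightarrow> int \<Rightarrow> int \<Rightarrow> (nat \<Rightarrow> (nat \<Rightarrow> rat poly) set) set" where
  "kunneth_filtration p n s =
     (if n = 0 \<or> n = 1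
      then gen_submodule (ku p) (F_tensor_ku p)
             {bracket p 1 i j | i j. i \<ge> 1 \<and> j \<ge> 1 \<and> filtration p i j \<le> s}
      else {\<zero>\<^bsub>F_tensor_ku p\<^esub>})"

definition kunneth_E_infinity ::
    "nat \<Rightarrow> int \<Rightarrow> (rat poly, int \<Rightarrow> (nat \<Rightarrow> (nat \<Rightarrow> rat poly) set) set) module" where
  "kunneth_E_infinity p n =
     total_E_infinity (F_tensor_ku p) (kunneth_d p) (kunneth_filtration p) n"

definition kunneth_class ::
    "nat \<Rightarrow> int \<Rightarrow> rat poly \<Rightarrow> nat \<Rightarrow> nat \<Rightarrow> int \<Rightarrow> (nat \<Rightarrow> (nat \<Rightarrow> rat poly) set) set" where
  "kunneth_class p n c i j =
     E_infinity_class (F_tensor_ku p) (kunneth_d p) (kunneth_filtration p) n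
       (filtration p i j) (bracket p c i j)"


section \<open>The modules \<open>E\<^sub>0\<close> and \<open>E\<^sub>1\<close>\<close>

definition g1 :: "nat \<Rightarrow> nat" where "g1 p = p - 1"

definition g2 :: "nat \<Rightarrow> nat" where "g2 p = p\<^sup>2 - 1"

text \<open>The direct sum of the modules \<open>ku\<^sub>*/(S) \<langle>[i,j]\<rangle>\<close> over all \<open>i, j \<ge> 1\<close>, and its elements \<open>c[i,j]\<close>.\<close>

definition cyclic_sum ::
    "nat \<Rightarrow> rat poly set \<Rightarrow> (rat poly, nat \<times> nat \<Rightarrow> rat poly set) module" where
  "cyclic_sum p S = direct_sum ({1..} \<times> {1..}) (\<lambda>_. cyclic_module (ku p) S)"

definition cyclic_gen ::
    "nat \<Rightarrow> rat poly set \<Rightarrow> rat poly \<Rightarrow> nat \<Rightarrow> nat \<Rightarrow> nat \<times> nat \<Rightarrow> rat poly set" where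
  "cyclic_gen p S c i j =
     summand ({1..} \<times> {1..}) (\<lambda>_. cyclic_module (ku p) S) (i, j) (Idl\<^bsub>ku p\<^esub> S +>\<^bsub>ku p\<^esub> c)"

definition E0_ideal_gens :: "nat \<Rightarrow> rat poly set" where
  "E0_ideal_gens p = {of_nat (p\<^sup>2), of_nat p * ku_v ^ g1 p, ku_v ^ (g1 p + g2 p)}"

definition E1_ideal_gens :: "nat \<Rightarrow> rat poly set" where
  "E1_ideal_gens p = {of_nat (p\<^sup>2)}"

definition E0 :: "nat \<Rightarrow> (rat poly, nat \<times> nat \<Rightarrow> rat poly set) module" where
  "E0 p = cyclic_sum p (E0_ideal_gens p)"

text \<open>
  All summands of \<open>E\<^sub>1\<close> are submodules of the sum of the \<open>ku\<^sub>*/(p\<^sup>2)\<langle>[i,j]\<rangle>\<close>, and \<open>p[i,j]\<close> is \<open>p\<close>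
  times the generator \<open>[i,j]\<close>.  The three index ranges overlap, for instance at \<open>i = j = g\<^sub>1\<close>:
  the sum of the three families is the internal sum, in which a repeated \<open>p[i,j]\<close>,
  or a \<open>p[i,j]\<close> for which \<open>[i,j]\<close> is also present, contributes nothing new.
\<close>

definition E1_sum :: "nat \<Rightarrow> (nat \<times> nat) set \<Rightarrow> rat poly \<Rightarrow> (nat \<times> nat \<Rightarrow> rat poly set) set" where
  "E1_sum p I c =
     gen_submodule (ku p) (cyclic_sum p (E1_ideal_gens p))
       {cyclic_gen p (E1_ideal_gens p) c i j | i j. (i, j) \<in> I}"

definition E1 :: "nat \<Rightarrow> (rat poly, nat \<times> nat \<Rightarrow> rat poly set) module" where
  "E1 p =
     (let M = cyclic_sum p (E1_ideal_gens p) in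
      M\<lparr>carrier :=
          E1_sum p {(i, j). i \<ge> 1 \<and> g1 p \<ge> j \<and> j \<ge> 1} 1
          <+>\<^bsub>M\<^esub> E1_sum p {(i, j). i \<ge> g1 p \<and> j \<ge> 1 \<and> j \<le> g2 p} (of_nat p)
          <+>\<^bsub>M\<^esub> E1_sum p {(i, j). 1 \<le> i \<and> i \<le> g1 p \<and> g1 p \<le> j} (of_nat p)\<rparr>)"

end

theory Submission
  imports Defs "HOL-Computational_Algebra.Formal_Power_Series" "HOL-Library.Function_Algebras"
begin

text \<open>
  Write \<open>R = \<int>\<^bsub>(p)\<^esub>[v]\<close>, and let \<open>x\<close> and \<open>y\<close> lower the first and the second index of \<open>[i,j]\<close> by one. With
  \<open>A(T) = ((1 + T)\<^bsup>p\<^sup>2\<^esup> - 1) / T\<close>, the module \<open>F \<otimes> ku\<^sub>*(\<int>\<^bsub>p\<^sup>2\<^esub>)\<close> is \<open>P / A(v y) P\<close>, where \<open>P\<close> is the free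
  \<open>R\<close>-module on the generators \<open>[i,j]\<close>, and \<open>\<partial>\<close> is multiplication by \<open>A(v x)\<close>. Lowering is locally
  nilpotent, so all power series in \<open>v x\<close> and \<open>v y\<close> act on \<open>P\<close>. The infinity page is known once the
  leading terms of boundaries, \<open>A(v x) P + A(v y) P\<close>, and of cycles, the \<open>g\<close> with
  \<open>A(v x) g \<in> A(v y) P\<close>, are known.

  The key is a good coordinate. Over \<open>\<int>\<^bsub>(p)\<^esub>\<close> there is a series \<open>\<theta>(T) = T + \<dots>\<close> in which the \<open>p\<close>-series
  of the multiplicative group becomes \<open>p \<theta> + \<theta>\<^sup>p\<close> (\<open>lubin_tate_coordinate\<close>). Consequently \<open>A(T)\<close> is a
  unit times \<open>f(\<theta>\<^sup>p\<^sup>-\<^sup>1)\<close>, where \<open>f(w) = p\<^sup>2 + p w + w (p + w)\<^sup>p\<close> (\<open>A_fps_factor\<close>). Let \<open>w\<close> and \<open>z\<close> be the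
  values of \<open>\<theta>\<^sup>p\<^sup>-\<^sup>1\<close> at \<open>v x\<close> and \<open>v y\<close>; to leading order they are \<open>(v x)\<^sup>p\<^sup>-\<^sup>1\<close> and \<open>(v y)\<^sup>p\<^sup>-\<^sup>1\<close>. The relation
  \<open>f(z) = 0\<close> lets one replace \<open>f(w)\<close> by \<open>f(w) - f(z)\<close>, which is divisible by \<open>w - z\<close>. Eliminating \<open>p\<^sup>2\<close> and
  then \<open>p\<close> from the quotient produces two operators (\<open>reduction_operators\<close>): a unit multiple of
  the boundary with leading term \<open>-p z\<close>, and a multiple by \<open>p + \<dots>\<close> with leading term \<open>-w z\<^sup>p\<^sup>+\<^sup>1\<close>. The
  weights \<open>p\<^sup>2 + 1\<close> and \<open>p + 1\<close> of the filtration are such that exactly these terms lead. They account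
  for the leading coefficients \<open>p v\<^sup>p\<^sup>-\<^sup>1\<close> and \<open>v\<^bsup>(p-1)(p+2)\<^esup>\<close> of boundaries.

  Cycles come from one principle (\<open>act_lift\<close>): if the leading monomial of an operator kills an
  element, then a correction of lower filtration makes the whole operator kill it. For \<open>w - z\<close> this
  gives cycles with leading term \<open>[i,j]\<close> for \<open>j \<le> p - 1\<close>, and for the second operator cycles
  with leading term \<open>p[i,j]\<close> for \<open>i \<le> p - 1\<close> or \<open>j \<le> p\<^sup>2 - 1\<close>. Every element is the sum of
  such cycles and of a combination, with \<open>p\<close>-adic digits as coefficients, of elements whose boundaries
  have independent leading terms (\<open>decomposition\<close>, \<open>boundary_form_descent\<close>). Therefore there are no
  other leading terms of cycles or boundaries.

  To pass from leading terms to modules, each module is presented as the image of an explicit set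
  of functions under a linear map, and modules presented on the same set with the same kernel are
  isomorphic (\<open>presents_same_kernel_iso\<close>).
\<close>

unbundle fps_syntax

section \<open>The local ring and its power series\<close>

locale prime_number =
  fixes p :: nat
  assumes prime_p: "prime p"
begin

lemma p_gt_1: "p > 1"
  using prime_p prime_gt_1_nat by blast

text \<open>
  The local ring \<open>\<int>\<^bsub>(p)\<^esub>\<close>, with the condition that \<^const>\<open>ku\<close> puts on each coefficient.
\<close>

definition zloc :: "rat set" where
  "zloc = {q. coprime (snd (quotient_of q)) (int p)}"

lemma zloc_iff: "q \<in> zloc \<longleftrightarrow> (\<exists>a b. coprime b (int p) \<and> q = of_int a / of_int b)"
proof
  assume "q \<in> zloc"
  then show "\<exists>a b. coprime b (int p) \<and> q = of_int a / of_int b"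
    using quotient_of_div[of q "fst (quotient_of q)" "snd (quotient_of q)"]
    unfolding zloc_def mem_Collect_eq surjective_pairing[symmetric] by blast
next
  assume "\<exists>a b. coprime b (int p) \<and> q = of_int a / of_int b"
  then obtain a b where ab: "coprime b (int p)" "q = of_int a / of_int b" by blast
  have b0: "b \<noteq> 0"
    using ab(1) p_gt_1 by auto
  obtain c d where cd: "quotient_of q = (c, d)" by fastforce
  have d: "d > 0" "coprime c d" "q = of_int c / of_int d"
    using cd quotient_of_denom_pos quotient_of_coprime quotient_of_div by auto
  have "of_int (a * d) = (of_int (c * b) :: rat)"
    using ab(2) d b0 by (simp add: field_simps)
  hence eq: "a * d = c * b" by (simp only: of_int_eq_iff)
  hence "d dvd c * b" by (metis dvd_triv_right)
  hence "d dvd b" using d(2) by (simp add: coprime_commute coprime_dvd_mult_right_iff)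
  thus "q \<in> zloc"
    using coprime_divisors[of d b "int p" "int p"] ab(1) cd by (simp add: zloc_def)
qed

lemma zloc_of_int [simp, intro]: "of_int n \<in> zloc"
  unfolding zloc_iff by (rule exI[of _ n], rule exI[of _ 1]) auto

lemma zloc_of_nat [simp, intro]: "of_nat n \<in> zloc"
  using zloc_of_int[of "int n"] by simp

lemma zloc_0 [simp, intro]: "0 \<in> zloc"
  using zloc_of_int[of 0] by simp

lemma zloc_1 [simp, intro]: "1 \<in> zloc"
  using zloc_of_int[of 1] by simp

lemma zloc_add [intro]: "a \<in> zloc \<Longrightarrow> b \<in> zloc \<Longrightarrow> a + b \<in> zloc"
proof -
  assume "a \<in> zloc" "b \<in> zloc"
  then obtain x y z w where h: "coprime y (int p)" "a = of_int x / of_int y"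
    "coprime w (int p)" "b = of_int z / of_int w"
    unfolding zloc_iff by blast
  have "y \<noteq> 0" "w \<noteq> 0" using h p_gt_1 by auto
  then have "a + b = of_int (x * w + z * y) / of_int (y * w)"
    using h by (simp add: field_simps)
  moreover have "coprime (y * w) (int p)" using h by simp
  ultimately show ?thesis unfolding zloc_iff by blast
qed

lemma zloc_mult [intro]: "a \<in> zloc \<Longrightarrow> b \<in> zloc \<Longrightarrow> a * b \<in> zloc"
proof -
  assume "a \<in> zloc" "b \<in> zloc"
  then obtain x y z w where h: "coprime y (int p)" "a = of_int x / of_int y"
    "coprime w (int p)" "b = of_int z / of_int w"
    unfolding zloc_iff by blast
  have "a * b = of_int (x * z) / of_int (y * w)"
    using h by (simp add: field_simps)
  moreover have "coprime (y * w) (int p)" using h by simp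
  ultimately show ?thesis unfolding zloc_iff by blast
qed

lemma zloc_uminus [intro]: "a \<in> zloc \<Longrightarrow> - a \<in> zloc"
  using zloc_mult[OF zloc_of_int[of "-1"]] by simp

lemma zloc_diff [intro]: "a \<in> zloc \<Longrightarrow> b \<in> zloc \<Longrightarrow> a - b \<in> zloc"
  using zloc_add[of a "- b"] by (simp add: zloc_uminus)

lemma zloc_sum [intro]: "(\<And>i. i \<in> I \<Longrightarrow> f i \<in> zloc) \<Longrightarrow> sum f I \<in> zloc"
  by (induction I rule: infinite_finite_induct) auto

lemma zloc_inverse_int:
  assumes "\<not> int p dvd n"
  shows "1 / of_int n \<in> zloc"
proof -
  have "coprime n (int p)"
    using assms prime_p prime_imp_coprime[of "int p" n] by (simp add: coprime_commute)
  thus ?thesis unfolding zloc_iff by (intro exI[of _ 1] exI[of _ n]) simp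
qed

text \<open>
  The residue field of \<open>\<int>\<^bsub>(p)\<^esub>\<close> is \<open>\<int>/p\<close>: if \<open>u\<close> inverts the denominator \<open>b\<close> modulo \<open>p\<close>, then
  \<open>a u mod p\<close> is the residue of \<open>a/b\<close>. These residues are the \<open>p\<close>-adic digits with which
  coefficients are normalized below.
\<close>

lemma zloc_residue:
  assumes "q \<in> zloc"
  shows "\<exists>d::int. 0 \<le> d \<and> d < int p \<and> (\<exists>r\<in>zloc. q = of_int d + of_nat p * r)"
proof -
  obtain a b where ab: "coprime b (int p)" "q = of_int a / of_int b"
    using assms unfolding zloc_iff by blast
  have b0: "b \<noteq> 0" using ab(1) p_gt_1 by auto
  obtain u v where uv: "u * b + v * int p = 1"
  proof -
    have "gcd b (int p) = 1" using ab(1) by simp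
    then show ?thesis using bezout_int[of b "int p"] that by auto
  qed
  define d where "d = (a * u) mod int p"
  have "a - d * b = a * (u * b + v * int p) - d * b" by (simp only: uv mult_1_right)
  also have "\<dots> = (a * u - d) * b + a * v * int p" by (simp add: algebra_simps)
  also have "a * u - d = int p * ((a * u) div int p)"
    unfolding d_def by (simp add: minus_mod_eq_mult_div)
  finally have e: "a - d * b = int p * ((a * u) div int p * b + a * v)"
    by (simp add: algebra_simps)
  define c where "c = (a * u) div int p * b + a * v"
  have "a = d * b + int p * c" using e unfolding c_def by simp
  hence "of_int a = (of_int d * of_int b + of_nat p * of_int c :: rat)"
    by (metis of_int_add of_int_mult of_int_of_nat_eq)
  hence "q = of_int d + of_nat p * (of_int c / of_int b)"
    using ab b0 by (simp add: field_simps)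
  moreover have "of_int c / of_int b \<in> zloc" unfolding zloc_iff using ab(1) by blast
  moreover have "0 \<le> d" "d < int p" unfolding d_def using p_gt_1 by auto
  ultimately show ?thesis by blast
qed

lemma zloc_digit_unique:
  assumes "0 \<le> d" "d < int p" "of_int d = of_nat p * r" "r \<in> zloc"
  shows "d = 0"
proof -
  obtain a b where ab: "coprime b (int p)" "r = of_int a / of_int b"
    using assms(4) unfolding zloc_iff by blast
  have b0: "b \<noteq> 0" using ab(1) p_gt_1 by auto
  have "of_int (d * b) = (of_int (int p * a) :: rat)"
    using assms(3) ab b0 by (simp add: field_simps)
  hence "d * b = int p * a" by (simp only: of_int_eq_iff)
  hence "int p dvd d * b" by simp
  hence "int p dvd d" using ab(1)
    by (simp add: coprime_commute coprime_dvd_mult_left_iff)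
  thus ?thesis using assms(1,2) zdvd_imp_le by fastforce
qed

lemma freshman:
  fixes a b :: "'a::comm_ring_1"
  shows "(a + b) ^ p = a ^ p + b ^ p +
           of_nat p * (\<Sum>k\<in>{1..<p}. of_nat ((p choose k) div p) * a ^ k * b ^ (p - k))"
proof -
  have "(a + b) ^ p = (\<Sum>k\<le>p. of_nat (p choose k) * a ^ k * b ^ (p - k))"
    by (rule binomial_ring)
  also have "{..p} = insert 0 (insert p {1..<p})" using p_gt_1 by auto
  also have "(\<Sum>k\<in>insert 0 (insert p {1..<p}). of_nat (p choose k) * a ^ k * b ^ (p - k))
      = b ^ p + (a ^ p + (\<Sum>k\<in>{1..<p}. of_nat (p choose k) * a ^ k * b ^ (p - k)))"
    using p_gt_1 by simp
  also have "(\<Sum>k\<in>{1..<p}. of_nat (p choose k) * a ^ k * b ^ (p - k)) =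
      (\<Sum>k\<in>{1..<p}. of_nat p * (of_nat ((p choose k) div p) * a ^ k * b ^ (p - k)))"
  proof (rule sum.cong)
    fix k assume k: "k \<in> {1..<p}"
    then have "p dvd p choose k"
      using prime_p p_gt_1 by (intro dvd_choose_prime) auto
    then have "p choose k = p * ((p choose k) div p)" by simp
    then have "of_nat (p choose k) = (of_nat p * of_nat ((p choose k) div p) :: 'a)"
      by (metis of_nat_mult)
    then show "of_nat (p choose k) * a ^ k * b ^ (p - k)
      = of_nat p * (of_nat ((p choose k) div p) * a ^ k * b ^ (p - k))"
      by (simp add: mult.assoc)
  qed simp
  finally show ?thesis by (simp add: sum_distrib_left algebra_simps)
qed

definition zfps :: "rat fps set" where
  "zfps = {s. \<forall>n. fps_nth s n \<in> zloc}"

lemma zfps_add [intro]: "s \<in> zfps \<Longrightarrow> t \<in> zfps \<Longrightarrow> s + t \<in> zfps"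
  by (auto simp: zfps_def)

lemma zfps_diff [intro]: "s \<in> zfps \<Longrightarrow> t \<in> zfps \<Longrightarrow> s - t \<in> zfps"
  by (auto simp: zfps_def)

lemma zfps_mult [intro]: "s \<in> zfps \<Longrightarrow> t \<in> zfps \<Longrightarrow> s * t \<in> zfps"
  by (auto simp: zfps_def fps_mult_nth)

lemma zfps_const [intro]: "c \<in> zloc \<Longrightarrow> fps_const c \<in> zfps"
  by (auto simp: zfps_def)

lemma zfps_0 [simp, intro]: "0 \<in> zfps"
  by (auto simp: zfps_def)

lemma zfps_1 [simp, intro]: "1 \<in> zfps"
  by (auto simp: zfps_def)

lemma zfps_of_nat [simp, intro]: "of_nat n \<in> zfps"
  by (induction n) auto

lemma zfps_X [simp, intro]: "fps_X \<in> zfps"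
  by (auto simp: zfps_def fps_X_def)

lemma zfps_power [intro]: "s \<in> zfps \<Longrightarrow> s ^ n \<in> zfps"
  by (induction n) auto

lemma zfps_sum [intro]: "(\<And>i. i \<in> I \<Longrightarrow> f i \<in> zfps) \<Longrightarrow> sum f I \<in> zfps"
  by (induction I rule: infinite_finite_induct) auto

lemma zfps_compose [intro]:
  assumes "s \<in> zfps" "t \<in> zfps"
  shows "s oo t \<in> zfps"
proof -
  have "t ^ i \<in> zfps" for i using assms by auto
  then show ?thesis using assms(1)
    by (auto simp: zfps_def fps_compose_nth intro!: zloc_sum zloc_mult)
qed

lemma zfps_inverse:
  assumes "s \<in> zfps" "fps_nth s 0 = 1"
  shows "inverse s \<in> zfps"
proof -
  have "fps_nth (inverse s) n \<in> zloc" for n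
  proof (induction n rule: less_induct)
    case (less n)
    show ?case
    proof (cases n)
      case 0
      then show ?thesis using assms by simp
    next
      case (Suc m)
      have "(s * inverse s) $ n = 0"
        using assms(2) Suc inverse_mult_eq_1'[of s] by simp
      hence "(\<Sum>i=0..n. s $ i * inverse s $ (n - i)) = 0" by (simp add: fps_mult_nth)
      hence "inverse s $ n + (\<Sum>i=1..n. s $ i * inverse s $ (n - i)) = 0"
        using assms(2) by (simp add: sum.atLeast_Suc_atMost)
      hence "inverse s $ n = - (\<Sum>i=1..n. s $ i * inverse s $ (n - i))"
        by (simp add: eq_neg_iff_add_eq_0)
      moreover have "s $ i * inverse s $ (n - i) \<in> zloc" if "i \<in> {1..n}" for i
        using less[of "n - i"] that assms(1) by (auto simp: zfps_def)
      then have "(\<Sum>i=1..n. s $ i * inverse s $ (n - i)) \<in> zloc" by (rule zloc_sum)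
      ultimately show ?thesis by (simp only: zloc_uminus)
    qed
  qed
  then show ?thesis by (auto simp: zfps_def)
qed

definition pdvd :: "rat fps \<Rightarrow> bool" where
  "pdvd s \<longleftrightarrow> (\<exists>t\<in>zfps. s = of_nat p * t)"

lemma pdvd_add: "pdvd s \<Longrightarrow> pdvd t \<Longrightarrow> pdvd (s + t)"
  unfolding pdvd_def by (auto simp flip: distrib_left)

lemma pdvd_diff: "pdvd s \<Longrightarrow> pdvd t \<Longrightarrow> pdvd (s - t)"
  unfolding pdvd_def by (auto simp flip: right_diff_distrib)

lemma pdvd_mult: "pdvd s \<Longrightarrow> t \<in> zfps \<Longrightarrow> pdvd (t * s)"
  unfolding pdvd_def by (auto simp: mult.left_commute[of t])

lemma pdvd_0 [simp]: "pdvd 0"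
  unfolding pdvd_def by (auto intro: bexI[of _ 0])

lemma pdvd_p: "t \<in> zfps \<Longrightarrow> pdvd (of_nat p * t)"
  unfolding pdvd_def by blast

lemma pdvd_nth: "pdvd s \<longleftrightarrow> (\<forall>n. \<exists>r\<in>zloc. s $ n = of_nat p * r)"
proof
  assume "pdvd s"
  then show "\<forall>n. \<exists>r\<in>zloc. s $ n = of_nat p * r"
    unfolding pdvd_def by (auto simp: zfps_def fps_mult_of_nat_nth)
next
  assume "\<forall>n. \<exists>r\<in>zloc. s $ n = of_nat p * r"
  then obtain r where r: "\<And>n. r n \<in> zloc" "\<And>n. s $ n = of_nat p * r n" by metis
  have "s = of_nat p * Abs_fps r"
    by (rule fps_ext) (simp add: r fps_mult_of_nat_nth)
  moreover have "Abs_fps r \<in> zfps" using r(1) by (simp add: zfps_def)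
  ultimately show "pdvd s" unfolding pdvd_def by blast
qed

lemma pdvd_power_diff:
  assumes "pdvd (s - t)" "s \<in> zfps" "t \<in> zfps"
  shows "pdvd (s ^ n - t ^ n)"
proof (induction n)
  case (Suc n)
  have "s ^ Suc n - t ^ Suc n = s * (s ^ n - t ^ n) + t ^ n * (s - t)"
    by (simp add: algebra_simps)
  then show ?case using Suc assms by (auto intro!: pdvd_add pdvd_mult)
qed auto

lemma pdvd_freshman:
  assumes "s \<in> zfps" "t \<in> zfps"
  shows "pdvd ((s + t) ^ p - s ^ p - t ^ p)"
  unfolding freshman[of s t] using assms by (auto intro!: pdvd_p)

text \<open>
  Fermat's little theorem for \<open>\<int>\<^bsub>(p)\<^esub>\<close>. For natural numbers it is the binomial theorem
  modulo \<open>p\<close>, and every element of \<open>\<int>\<^bsub>(p)\<^esub>\<close> is congruent to a natural number.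
\<close>

lemma fermat_zloc:
  assumes "c \<in> zloc"
  shows "pdvd (fps_const c ^ p - fps_const c)"
proof -
  have nat: "pdvd (of_nat n ^ p - of_nat n)" for n
  proof (induction n)
    case 0
    then show ?case using p_gt_1 by (simp add: power_0_left)
  next
    case (Suc n)
    have "(of_nat (Suc n) ^ p - of_nat (Suc n) :: rat fps) =
      ((of_nat n + 1) ^ p - of_nat n ^ p - 1 ^ p) + (of_nat n ^ p - of_nat n)"
      by (simp add: add.commute)
    then show ?case using Suc pdvd_freshman[of "of_nat n" 1] by (simp only: pdvd_add zfps_of_nat zfps_1)
  qed
  obtain d r where d: "0 \<le> d" "r \<in> zloc" "c = of_int d + of_nat p * r"
    using zloc_residue[OF assms] by blast
  define n where "n = nat d"
  have c: "fps_const c = of_nat n + of_nat p * fps_const r"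
    using d unfolding n_def by (simp add: fps_of_nat[symmetric])
  have 1: "pdvd (fps_const c - of_nat n)"
    unfolding c using d(2) by (auto intro!: pdvd_p)
  have "pdvd (fps_const c ^ p - of_nat n ^ p)"
    using 1 assms by (intro pdvd_power_diff) auto
  from pdvd_diff[OF pdvd_add[OF this nat[of n]] 1] show ?thesis by simp
qed

section \<open>A Lubin-Tate coordinate for the multiplicative group\<close>

text \<open>
  The \<open>p\<close>-series of the multiplicative formal group.
\<close>

definition phi :: "rat fps" where
  "phi = (1 + fps_X) ^ p - 1"

lemma phi_zfps [simp, intro]: "phi \<in> zfps"
  unfolding phi_def by auto

lemma one_plus_X_power_nth: "((1 + fps_X) ^ n :: rat fps) $ k = of_nat (n choose k)"
  by (simp add: fps_binomial_of_nat[symmetric] binomial_gbinomial)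

lemma phi_nth_0 [simp]: "phi $ 0 = 0"
  by (simp add: phi_def one_plus_X_power_nth)

lemma phi_nth_1 [simp]: "phi $ Suc 0 = of_nat p"
  by (simp add: phi_def one_plus_X_power_nth)

lemma power_nth_cong:
  fixes s t :: "'a::comm_ring_1 fps"
  assumes "\<And>k. k \<le> n \<Longrightarrow> s $ k = t $ k" "k \<le> n"
  shows "(s ^ m) $ k = (t ^ m) $ k"
  using assms(2)
proof (induction m arbitrary: k)
  case (Suc m)
  then show ?case using assms(1) by (auto simp: fps_mult_nth intro!: sum.cong)
qed auto

lemma power_nth_cong_Suc:
  fixes s t :: "'a::comm_ring_1 fps"
  assumes eq: "\<And>k. k \<le> n \<Longrightarrow> s $ k = t $ k" and 0: "s $ 0 = 0" and m: "m \<ge> 2"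
  shows "(s ^ m) $ Suc n = (t ^ m) $ Suc n"
proof -
  have t0: "t $ 0 = 0" using eq[of 0] 0 by simp
  obtain m' where m': "m = Suc m'" "m' \<ge> 1" using m by (cases m) auto
  have s'0: "(s ^ m') $ 0 = 0" "(t ^ m') $ 0 = 0" using m' 0 t0 by (simp_all add: fps_power_zeroth power_0_left)
  have "(s ^ m) $ Suc n = (\<Sum>i=0..Suc n. s $ i * (s ^ m') $ (Suc n - i))"
    by (simp add: m' fps_mult_nth)
  also have "\<dots> = (\<Sum>i=0..Suc n. t $ i * (t ^ m') $ (Suc n - i))"
  proof (rule sum.cong)
    fix i assume i: "i \<in> {0..Suc n}"
    consider "i = 0" | "i = Suc n" | "1 \<le> i" "i \<le> n" using i by fastforce
    then show "s $ i * (s ^ m') $ (Suc n - i) = t $ i * (t ^ m') $ (Suc n - i)"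
    proof cases
      case 3
      then have "(s ^ m') $ (Suc n - i) = (t ^ m') $ (Suc n - i)"
        by (intro power_nth_cong[of n]) (use eq in auto)
      then show ?thesis using 3 eq by simp
    qed (use 0 t0 s'0 in auto)
  qed simp
  also have "\<dots> = (t ^ m) $ Suc n" by (simp add: m' fps_mult_nth)
  finally show ?thesis .
qed

lemma compose_nth_cong:
  fixes s t u :: "'a::comm_ring_1 fps"
  assumes "\<And>k. k \<le> n \<Longrightarrow> s $ k = t $ k"
  shows "(s oo u) $ n = (t oo u) $ n"
  using assms by (simp add: fps_compose_nth)

lemma pdvd_compose_phi_monom:
  assumes c: "c \<in> zloc"
  shows "pdvd (((fps_const c * fps_X ^ k) oo phi) - (fps_const c * fps_X ^ k) ^ p)"
proof -
  have e1: "(fps_const c * fps_X ^ k) oo phi = fps_const c * phi ^ k"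
    by (simp add: fps_compose_mult_distrib fps_compose_power[symmetric])
  have e2: "(fps_const c * fps_X ^ k) ^ p = fps_const c ^ p * (fps_X ^ p) ^ k"
    by (simp add: power_mult_distrib mult.commute flip: power_mult)
  have "pdvd (phi - fps_X ^ p)"
    using pdvd_freshman[of 1 fps_X] by (simp add: phi_def)
  then have 1: "pdvd (phi ^ k - (fps_X ^ p) ^ k)"
    by (intro pdvd_power_diff) auto
  have "((fps_const c * fps_X ^ k) oo phi) - (fps_const c * fps_X ^ k) ^ p =
     fps_const c * (phi ^ k - (fps_X ^ p) ^ k) - (fps_X ^ p) ^ k * (fps_const c ^ p - fps_const c)"
    unfolding e1 e2 by (simp only: algebra_simps)
  then show ?thesis using 1 fermat_zloc[OF c] c
    by (auto intro!: pdvd_diff pdvd_mult)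
qed

text \<open>
  Modulo \<open>p\<close>, substituting \<open>phi\<close> is substituting \<open>T\<^sup>p\<close>, and this agrees with the \<open>p\<close>-th power
  because both are additive and agree on monomials. A coefficient of either side involves
  only finitely many coefficients of \<open>s\<close>, so it suffices to treat polynomials.
\<close>

lemma pdvd_compose_phi:
  assumes "s \<in> zfps"
  shows "pdvd ((s oo phi) - s ^ p)"
proof -
  have fin: "pdvd (((\<Sum>k<n. fps_const (s $ k) * fps_X ^ k) oo phi)
                     - (\<Sum>k<n. fps_const (s $ k) * fps_X ^ k) ^ p)" for n
  proof (induction n)
    case 0
    then show ?case using p_gt_1 by (simp add: power_0_left)
  next
    case (Suc n)
    define a where "a = (\<Sum>k<n. fps_const (s $ k) * fps_X ^ k)"
    define b where "b = fps_const (s $ n) * fps_X ^ n"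
    have sz: "s $ k \<in> zloc" for k using assms by (simp add: zfps_def)
    then have ab: "a \<in> zfps" "b \<in> zfps" unfolding a_def b_def by auto
    have b: "pdvd ((b oo phi) - b ^ p)"
      unfolding b_def using sz by (rule pdvd_compose_phi_monom)
    have "((a + b) oo phi) - (a + b) ^ p =
       ((a oo phi) - a ^ p) + ((b oo phi) - b ^ p) - ((a + b) ^ p - a ^ p - b ^ p)"
      by (simp add: fps_compose_add_distrib)
    moreover have "pdvd \<dots>"
      using Suc b pdvd_freshman[OF ab] unfolding a_def[symmetric]
      by (meson pdvd_diff pdvd_add)
    ultimately have "pdvd (((a + b) oo phi) - (a + b) ^ p)" by (simp only:)
    then show ?case unfolding a_def b_def by (simp only: sum.lessThan_Suc)
  qed
  show ?thesis
    unfolding pdvd_nth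
  proof
    fix n
    define a where "a = (\<Sum>k<Suc n. fps_const (s $ k) * fps_X ^ k)"
    have nth: "a $ k = s $ k" if "k \<le> n" for k
      unfolding a_def using that by (simp add: fps_sum_nth if_distrib[of "\<lambda>x. _ * x"] cong: if_cong)
    have "((s oo phi) - s ^ p) $ n = ((a oo phi) - a ^ p) $ n"
      using compose_nth_cong[of n a s phi] power_nth_cong[of n a s n p] nth by simp
    then show "\<exists>r\<in>zloc. ((s oo phi) - s ^ p) $ n = of_nat p * r"
      using fin[of "Suc n"] unfolding pdvd_nth a_def[symmetric] by simp
  qed
qed

lemma phi_power_nth: "phi ^ n $ n = of_nat p ^ n"
proof -
  have "phi = fps_X * fps_shift 1 phi"
    by (rule fps_ext) (simp add: fps_X_mult_nth split: nat.splits)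
  then have "phi ^ n = fps_X ^ n * (fps_shift 1 phi) ^ n"
    by (metis power_mult_distrib)
  then show ?thesis by (simp add: fps_X_power_mult_nth fps_power_zeroth)
qed

text \<open>
  Adding \<open>c T\<^sup>n\<^sup>+\<^sup>1\<close> to \<open>th\<close> changes the coefficient in degree \<open>n + 1\<close> of \<open>th \<circ> phi\<close> by \<open>c p\<^sup>n\<^sup>+\<^sup>1\<close>
  and that of \<open>p th + th\<^sup>p\<close> by \<open>c p\<close>. The discrepancy to be removed is a multiple \<open>p e\<close> by the
  Frobenius congruence, so \<open>c = e / (1 - p\<^sup>n)\<close> works, and \<open>1 - p\<^sup>n\<close> is a unit.
\<close>

lemma lubin_tate_step:
  assumes th: "th \<in> zfps" "th $ 0 = 0" "th $ Suc 0 = 1" and n: "n \<ge> 1"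
    and eq: "\<And>k. k \<le> n \<Longrightarrow> (th oo phi) $ k = (of_nat p * th + th ^ p) $ k"
  shows "\<exists>th'\<in>zfps. (\<forall>k\<le>n. th' $ k = th $ k) \<and>
            (\<forall>k\<le>Suc n. (th' oo phi) $ k = (of_nat p * th' + th' ^ p) $ k)"
proof -
  have "pdvd ((th oo phi) - th ^ p - of_nat p * th)"
    using th(1) by (intro pdvd_diff[OF pdvd_compose_phi pdvd_p])
  then obtain e where e: "e \<in> zloc"
      "((th oo phi) - th ^ p - of_nat p * th) $ Suc n = of_nat p * e"
    unfolding pdvd_nth by blast
  define q :: int where "q = 1 - int p ^ n"
  have "\<not> int p dvd q"
  proof
    assume "int p dvd q"
    moreover have "int p dvd int p ^ n" using n by (cases n) auto
    ultimately have "int p dvd q + int p ^ n" by (rule dvd_add)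
    then show False using p_gt_1 unfolding q_def by simp
  qed
  then have q: "1 / of_int q \<in> zloc" by (rule zloc_inverse_int)
  have "int p ^ n > 1" using n p_gt_1 by (simp add: one_less_power)
  then have q0: "(of_int q :: rat) \<noteq> 0" unfolding q_def of_int_eq_0_iff by simp
  define c where "c = e * (1 / of_int q)"
  have c: "c \<in> zloc" unfolding c_def using e(1) q by (rule zloc_mult)
  have ce: "c * of_int q = e" unfolding c_def using q0 by simp
  define th' where "th' = th + fps_const c * fps_X ^ Suc n"
  have th'z: "th' \<in> zfps" unfolding th'_def using th c by (auto simp del: power_Suc)
  have agree: "th' $ k = th $ k" if "k \<le> n" for k
    unfolding th'_def using that by (simp del: power_Suc)
  have low: "(th' oo phi) $ k = (of_nat p * th' + th' ^ p) $ k" if k: "k \<le> n" for k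
  proof -
    have "(th' oo phi) $ k = (th oo phi) $ k"
      by (rule compose_nth_cong) (use agree k in auto)
    also have "\<dots> = (of_nat p * th + th ^ p) $ k" using eq k by blast
    also have "\<dots> = (of_nat p * th' + th' ^ p) $ k"
      using agree[OF k] power_nth_cong[of n th' th k p] agree k by (simp add: fps_mult_of_nat_nth)
    finally show ?thesis .
  qed
  have "(th' oo phi) $ Suc n = (th oo phi) $ Suc n + c * of_nat p ^ Suc n"
    unfolding th'_def fps_compose_add_distrib
    by (simp add: fps_compose_mult_distrib fps_compose_power[symmetric] phi_power_nth del: power_Suc)
  moreover have "(th' ^ p) $ Suc n = (th ^ p) $ Suc n"
    by (rule power_nth_cong_Suc) (use agree th p_gt_1 in auto)
  moreover have "th' $ Suc n = th $ Suc n + c" unfolding th'_def by simp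
  moreover have "(th oo phi) $ Suc n = (th ^ p) $ Suc n + of_nat p * th $ Suc n + of_nat p * e"
    using e(2) by (simp add: fps_mult_of_nat_nth)
  moreover have "of_nat p * e + c * of_nat p ^ Suc n = of_nat p * c"
    unfolding ce[symmetric] q_def by (simp add: algebra_simps)
  ultimately have "(th' oo phi) $ Suc n = (of_nat p * th' + th' ^ p) $ Suc n"
    by (simp add: fps_mult_of_nat_nth algebra_simps)
  with low have "\<forall>k\<le>Suc n. (th' oo phi) $ k = (of_nat p * th' + th' ^ p) $ k"
    by (auto simp: le_Suc_eq)
  then show ?thesis using th'z agree by blast
qed

text \<open>
  In the coordinate \<open>th\<close> the \<open>p\<close>-series of the multiplicative group is \<open>p T + T\<^sup>p\<close>. The coefficients
  of \<open>th\<close> are found one at a time; \<open>f n\<close> is correct up to degree \<open>n + 1\<close>.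
\<close>

lemma lubin_tate_coordinate:
  "\<exists>th\<in>zfps. th $ 0 = 0 \<and> th $ Suc 0 = 1 \<and> th oo phi = of_nat p * th + th ^ p"
proof -
  define P where "P n th \<longleftrightarrow> th \<in> zfps \<and> th $ 0 = 0 \<and> th $ Suc 0 = 1 \<and>
     (\<forall>k\<le>Suc n. (th oo phi) $ k = (of_nat p * th + th ^ p) $ k)" for n th
  have "\<exists>f. \<forall>n. P n (f n) \<and> (\<forall>k\<le>Suc n. f (Suc n) $ k = f n $ k)"
  proof (rule dependent_nat_choice)
    have "(fps_X oo phi) $ k = (of_nat p * fps_X + fps_X ^ p) $ k" if "k \<le> Suc 0" for k
      using that p_gt_1 by (cases k) (auto simp: fps_mult_of_nat_nth)
    then show "\<exists>th. P 0 th" unfolding P_def by (intro exI[of _ fps_X]) auto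
  next
    fix th n assume "P n th"
    then have h: "th \<in> zfps" "th $ 0 = 0" "th $ Suc 0 = 1"
      "\<And>k. k \<le> Suc n \<Longrightarrow> (th oo phi) $ k = (of_nat p * th + th ^ p) $ k"
      unfolding P_def by auto
    obtain th' where "th' \<in> zfps" "\<forall>k\<le>Suc n. th' $ k = th $ k"
      "\<forall>k\<le>Suc (Suc n). (th' oo phi) $ k = (of_nat p * th' + th' ^ p) $ k"
      using lubin_tate_step[of th "Suc n", OF h(1-3) _ h(4)] by auto
    then show "\<exists>y. P (Suc n) y \<and> (\<forall>k\<le>Suc n. y $ k = th $ k)"
      unfolding P_def using h by (intro exI[of _ th']) auto
  qed
  then obtain f where f: "\<And>n. P n (f n)" "\<And>n k. k \<le> Suc n \<Longrightarrow> f (Suc n) $ k = f n $ k"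
    by blast
  have stable: "f (n + m) $ k = f n $ k" if "k \<le> n" for n m k
    by (induction m) (use f(2) that in auto)
  define th where "th = Abs_fps (\<lambda>n. f n $ n)"
  have nth: "th $ k = f n $ k" if "k \<le> n" for k n
    unfolding th_def using stable[of k k "n - k"] that by simp
  have "th \<in> zfps" unfolding zfps_def th_def using f(1) by (auto simp: P_def zfps_def)
  moreover have "th $ 0 = 0" "th $ Suc 0 = 1"
    using nth[of 0 0] nth[of "Suc 0" "Suc 0"] f(1) unfolding P_def by auto
  moreover have "th oo phi = of_nat p * th + th ^ p"
  proof (rule fps_ext)
    fix n
    have "(th oo phi) $ n = (f n oo phi) $ n"
      by (rule compose_nth_cong) (rule nth)
    also have "\<dots> = (of_nat p * f n + f n ^ p) $ n" using f(1)[of n] unfolding P_def by simp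
    also have "\<dots> = (of_nat p * th + th ^ p) $ n"
    proof -
      have "(th ^ p) $ n = (f n ^ p) $ n" by (rule power_nth_cong[of n]) (simp_all add: nth)
      moreover have "th $ n = f n $ n" by (simp add: nth)
      ultimately show ?thesis by (simp add: fps_mult_of_nat_nth)
    qed
    finally show "(th oo phi) $ n = (of_nat p * th + th ^ p) $ n" .
  qed
  ultimately show ?thesis by blast
qed

text \<open>
  The polynomial \<open>\<Sum>\<^sub>k a\<^sub>k\<close> with \<open>v\<close> replaced by the variable \<open>T\<close>, so that \<open>T A(T) = (1 + T)\<^bsup>p\<^sup>2\<^esup> - 1\<close>.
\<close>

definition A_fps :: "rat fps" where
  "A_fps = Abs_fps (\<lambda>k. of_nat (p\<^sup>2 choose (k + 1)))"

lemma X_A_fps: "fps_X * A_fps = phi oo phi"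
proof -
  have "phi oo phi = ((1 oo phi) + (fps_X oo phi)) ^ p - 1"
    unfolding phi_def fps_compose_sub_distrib
    by (simp add: fps_compose_power[symmetric] fps_compose_add_distrib flip: phi_def)
  also have "\<dots> = (1 + phi) ^ p - 1" by simp
  also have "\<dots> = (1 + fps_X) ^ (p\<^sup>2) - 1"
    by (simp add: phi_def power2_eq_square power_mult)
  finally have e: "phi oo phi = (1 + fps_X) ^ (p\<^sup>2) - 1" .
  show ?thesis unfolding e
    by (rule fps_ext) (auto simp: A_fps_def fps_X_mult_nth one_plus_X_power_nth split: nat.splits)
qed

text \<open>
  In the Lubin-Tate coordinate the \<open>p\<^sup>2\<close>-series is \<open>th\<close> times a polynomial in \<open>w = th\<^sup>p\<^sup>-\<^sup>1\<close> alone,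
  namely \<open>f(w) = (p + w)(p + w (p + w)\<^sup>p\<^sup>-\<^sup>1)\<close>, written here in expanded form. Comparing \<open>th \<circ> phi \<circ> phi\<close>
  with \<open>phi \<circ> phi = T A(T)\<close> gives \<open>A = u f(w)\<close> with a unit \<open>u\<close>. That only \<open>th\<^sup>p\<^sup>-\<^sup>1\<close> occurs is what
  makes steps of length \<open>p - 1\<close> appear in the final answer.
\<close>

lemma A_fps_factor:
  "\<exists>u\<in>zfps. \<exists>U\<in>zfps. u $ 0 = 1 \<and> U $ 0 = 1 \<and>
     A_fps = u * (of_nat p ^ 2 + of_nat p * (fps_X ^ (p - 1) * U) +
        (fps_X ^ (p - 1) * U) * (of_nat p + fps_X ^ (p - 1) * U) ^ p)"
proof -
  obtain th where th: "th \<in> zfps" "th $ 0 = 0" "th $ Suc 0 = 1"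
      "th oo phi = of_nat p * th + th ^ p"
    using lubin_tate_coordinate by blast
  define U where "U = fps_shift 1 th"
  have thU: "th = fps_X * U"
    unfolding U_def by (rule fps_ext) (simp add: fps_X_mult_nth th split: nat.splits)
  have U: "U \<in> zfps" "U $ 0 = 1" using th by (auto simp: U_def zfps_def)
  define w where "w = th ^ (p - 1)"
  have wU: "w = fps_X ^ (p - 1) * U ^ (p - 1)" unfolding w_def thU by (simp add: power_mult_distrib)
  have thp: "th ^ p = th * w" unfolding w_def using p_gt_1
    by (metis Suc_diff_1 less_trans power_Suc zero_less_one)
  define F where "F = of_nat p ^ 2 + of_nat p * w + w * (of_nat p + w) ^ p"
  define T where "T = U oo (phi oo phi)"
  have T: "T \<in> zfps" "T $ 0 = 1" unfolding T_def using U by auto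
  have "th oo (phi oo phi) = (th oo phi) oo phi"
    by (rule fps_compose_assoc) auto
  also have "\<dots> = of_nat p * (th oo phi) + (th oo phi) ^ p"
    by (subst (1) th(4), subst fps_compose_add_distrib)
      (simp add: fps_compose_mult_distrib fps_compose_power[symmetric] fps_of_nat[symmetric])
  also have "th oo phi = th * (of_nat p + w)" unfolding th(4) thp by (simp add: algebra_simps)
  also have "of_nat p * (th * (of_nat p + w)) + (th * (of_nat p + w)) ^ p = th * F"
    unfolding F_def power_mult_distrib thp by (simp add: algebra_simps power2_eq_square)
  finally have 1: "th oo (phi oo phi) = fps_X * (U * F)" unfolding thU by (simp add: mult.assoc)
  have "th oo (phi oo phi) = (phi oo phi) * T"
    unfolding thU T_def by (simp add: fps_compose_mult_distrib)
  also have "\<dots> = fps_X * (A_fps * T)" unfolding X_A_fps[symmetric] by (simp add: mult.assoc)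
  finally have "fps_X * (A_fps * T) = fps_X * (U * F)" using 1 by simp
  then have AT: "A_fps * T = U * F" by simp
  have "A_fps = A_fps * T * inverse T" using T(2) inverse_mult_eq_1'[of T] by (simp add: mult.assoc)
  also have "\<dots> = (U * inverse T) * F" unfolding AT by (simp add: algebra_simps)
  finally have "A_fps = (U * inverse T) * F" .
  moreover have "U * inverse T \<in> zfps" "(U * inverse T) $ 0 = 1"
    using U T zfps_inverse[OF T] by auto
  moreover have "U ^ (p - 1) \<in> zfps" "U ^ (p - 1) $ 0 = 1"
    using U by (auto simp: fps_power_zeroth)
  ultimately show ?thesis unfolding F_def wU by blast
qed

text \<open>
  The coefficients of \<open>((p + w)\<^sup>p - w\<^sup>p) / p\<^sup>2\<close>. They are integers, so \<open>w (p + w)\<^sup>p\<close> differs from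
  \<open>w\<^sup>p\<^sup>+\<^sup>1\<close> by a multiple of \<open>p\<^sup>2\<close>, which only changes the term \<open>p\<^sup>2\<close> of \<open>f(w)\<close> by a unit factor.
\<close>

definition ec :: "nat \<Rightarrow> nat" where
  "ec k = (p choose k) * p ^ (p - k) div p\<^sup>2"

lemma p_plus_power:
  fixes w :: "'a::comm_ring_1"
  shows "(of_nat p + w) ^ p = w ^ p + of_nat p ^ 2 * (\<Sum>k<p. of_nat (ec k) * w ^ k)"
proof -
  have "(of_nat p + w) ^ p = (\<Sum>k\<le>p. of_nat (p choose k) * w ^ k * of_nat p ^ (p - k))"
    unfolding add.commute[of "of_nat p" w] by (rule binomial_ring)
  also have "{..p} = insert p {..<p}" by auto
  also have "(\<Sum>k\<in>insert p {..<p}. of_nat (p choose k) * w ^ k * of_nat p ^ (p - k)) =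
      w ^ p + (\<Sum>k<p. of_nat (p choose k) * w ^ k * of_nat p ^ (p - k))" by simp
  also have "(\<Sum>k<p. of_nat (p choose k) * w ^ k * of_nat p ^ (p - k)) =
      (\<Sum>k<p. of_nat p ^ 2 * (of_nat (ec k) * w ^ k))"
  proof (rule sum.cong)
    fix k assume k: "k \<in> {..<p}"
    have "p\<^sup>2 dvd (p choose k) * p ^ (p - k)"
    proof (cases "k = 0")
      case True
      then show ?thesis using p_gt_1 by (simp add: le_imp_power_dvd)
    next
      case False
      then have "p dvd p choose k"
        using prime_p p_gt_1 k by (intro dvd_choose_prime) auto
      moreover have "p dvd p ^ (p - k)" using k by (intro dvd_power) auto
      ultimately show ?thesis unfolding power2_eq_square by (rule mult_dvd_mono)
    qed
    then have "(p choose k) * p ^ (p - k) = p\<^sup>2 * ec k" unfolding ec_def by simp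
    then have "(of_nat (p choose k) * of_nat p ^ (p - k) :: 'a) = of_nat p ^ 2 * of_nat (ec k)"
      by (metis of_nat_mult of_nat_power)
    then show "of_nat (p choose k) * w ^ k * of_nat p ^ (p - k) =
        of_nat p ^ 2 * (of_nat (ec k) * w ^ k)"
      by (metis mult.assoc mult.commute)
  qed simp
  finally show ?thesis by (simp add: sum_distrib_left)
qed

end

section \<open>Power series in two lowering operators\<close>

text \<open>
  The entry \<open>g i j\<close> of a grid is the coefficient of the generator \<open>[i + 1, j + 1]\<close>; indices start
  at \<open>0\<close> so that a lowering operator is a shift with nothing to be cut off. An element of
  \<open>shifts\<close> is a power series in \<open>x\<close> and \<open>y\<close>, which lower the first and the second index.
\<close>

type_synonym grid = "nat \<Rightarrow> nat \<Rightarrow> rat poly"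
type_synonym shifts = "rat poly fps fps"

text \<open>
  The sum ranges over the positions at which the shifted grid is nonzero, so it is finite for
  a grid of finite support, the only case of interest.
\<close>

definition act :: "shifts \<Rightarrow> grid \<Rightarrow> grid" where
  "act s g i j = (\<Sum>(a, b)\<in>{(a, b). g (i + a) (j + b) \<noteq> 0}. s $ a $ b * g (i + a) (j + b))"

definition scal :: "rat poly \<Rightarrow> grid \<Rightarrow> grid" where
  "scal c g i j = c * g i j"

definition bounded_grid :: "nat \<Rightarrow> grid \<Rightarrow> bool" where
  "bounded_grid N g \<longleftrightarrow> (\<forall>i j. N \<le> i \<or> N \<le> j \<longrightarrow> g i j = 0)"

lemma bounded_grid_mono: "bounded_grid N g \<Longrightarrow> N \<le> M \<Longrightarrow> bounded_grid M g"
  unfolding bounded_grid_def by (meson order_trans)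

lemma act_eq:
  assumes "bounded_grid N g"
  shows "act s g i j = (\<Sum>a<N. \<Sum>b<N. s $ a $ b * g (i + a) (j + b))"
proof -
  have "act s g i j = (\<Sum>(a, b)\<in>{..<N} \<times> {..<N}. s $ a $ b * g (i + a) (j + b))"
    unfolding act_def
  proof (rule sum.mono_neutral_left)
    have "a < N \<and> b < N" if "g (i + a) (j + b) \<noteq> 0" for a b
      using assms that unfolding bounded_grid_def
      by (metis le_add2 linorder_not_less order_trans)
    then show "{(a, b). g (i + a) (j + b) \<noteq> 0} \<subseteq> {..<N} \<times> {..<N}" by auto
  qed auto
  then show ?thesis by (simp add: sum.cartesian_product)
qed

lemma act_add_left:
  assumes "bounded_grid N g"
  shows "act (s + t) g = act s g + act t g"
  by (intro ext) (simp add: act_eq[OF assms] plus_fun_def sum.distrib distrib_right)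

lemma act_uminus_left:
  assumes "bounded_grid N g"
  shows "act (- s) g = - act s g"
  by (intro ext) (simp add: act_eq[OF assms] fun_Compl_def sum_negf)

lemma act_diff_left:
  assumes "bounded_grid N g"
  shows "act (s - t) g = act s g - act t g"
  by (intro ext) (simp add: act_eq[OF assms] fun_diff_def sum_subtractf left_diff_distrib)

lemma bounded_grid_add: "bounded_grid N g \<Longrightarrow> bounded_grid N h \<Longrightarrow> bounded_grid N (g + h)"
  by (auto simp: bounded_grid_def)

lemma act_add_right_N:
  assumes "bounded_grid N g" "bounded_grid N h"
  shows "act s (g + h) = act s g + act s h"
  by (intro ext) (simp add: act_eq[OF assms(1)] act_eq[OF assms(2)]
      act_eq[OF bounded_grid_add[OF assms]] sum.distrib distrib_left)

lemma sum_delta2: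
  fixes x :: "'a::comm_monoid_add" and a b M :: nat
  assumes "a < M" "b < M"
  shows "(\<Sum>c<M. \<Sum>d<M. if c = a then if d = b then x else 0 else 0) = x"
proof -
  have "(\<Sum>d<M. if c = a then if d = b then x else 0 else 0) = (if c = a then x else 0)" for c :: nat
    using assms by (cases "c = a") auto
  then show ?thesis using assms by simp
qed

lemma act_const:
  assumes "bounded_grid N g"
  shows "act (fps_const (fps_const c)) g = scal c g"
proof (intro ext)
  fix i j
  have b: "bounded_grid (Suc N) g" using assms by (rule bounded_grid_mono) simp
  have "act (fps_const (fps_const c)) g i j =
     (\<Sum>a<Suc N. \<Sum>b<Suc N. (if a = 0 then if b = 0 then c * g i j else 0 else 0))"
    unfolding act_eq[OF b] by (intro sum.cong) auto
  also have "\<dots> = c * g i j"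
    by (rule sum_delta2) auto
  finally show "act (fps_const (fps_const c)) g i j = scal c g i j"
    by (simp add: scal_def)
qed

lemma act_1 [simp]:
  assumes "bounded_grid N g"
  shows "act 1 g = g"
  using act_const[OF assms, of 1] by (simp add: scal_def fun_eq_iff)

lemma sum_triangle:
  fixes G :: "nat \<Rightarrow> nat \<Rightarrow> 'a::comm_monoid_add"
  assumes "\<And>a b. N \<le> a + b \<Longrightarrow> G a b = 0"
  shows "(\<Sum>a<N. \<Sum>b<N. G a b) = (\<Sum>c<N. \<Sum>a=0..c. G a (c - a))"
proof -
  have "(\<Sum>a<N. \<Sum>b<N. G a b) = (\<Sum>(a, b)\<in>{..<N} \<times> {..<N}. G a b)"
    by (simp add: sum.cartesian_product)
  also have "\<dots> = (\<Sum>(a, b)\<in>{(a, b). a + b < N}. G a b)"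
    by (rule sum.mono_neutral_right) (use assms in \<open>auto simp: not_less[symmetric]\<close>)
  also have "\<dots> = (\<Sum>c<N. \<Sum>a\<le>c. G a (c - a))" by (rule sum.triangle_reindex)
  finally show ?thesis by (simp add: atLeast0AtMost)
qed

lemma bounded_grid_act:
  assumes "bounded_grid N g"
  shows "bounded_grid N (act s g)"
  unfolding bounded_grid_def
proof (intro allI impI)
  fix i j assume ij: "N \<le> i \<or> N \<le> j"
  have "g (i + a) (j + b) = 0" for a b
    using assms ij unfolding bounded_grid_def by (meson trans_le_add1)
  then show "act s g i j = 0" by (simp add: act_eq[OF assms])
qed

lemma act_mult:
  assumes b: "bounded_grid N g"
  shows "act (s * t) g = act s (act t g)"
proof (intro ext)
  fix i j
  define H where "H a b a' b' = s $ a $ b * (t $ a' $ b' * g (i + a + a') (j + b + b'))" for a b a' b'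
  have g0: "g i' j' = 0" if "N \<le> i' \<or> N \<le> j'" for i' j'
    using b that unfolding bounded_grid_def by blast
  have "act s (act t g) i j = (\<Sum>a<N. \<Sum>b<N. \<Sum>a'<N. \<Sum>b'<N. H a b a' b')"
    unfolding act_eq[OF bounded_grid_act[OF b]] act_eq[OF b] H_def sum_distrib_left by simp
  also have "\<dots> = (\<Sum>a<N. \<Sum>a'<N. \<Sum>b<N. \<Sum>b'<N. H a b a' b')"
    by (rule sum.cong[OF refl], rule sum.swap)
  also have "\<dots> = (\<Sum>a<N. \<Sum>a'<N. \<Sum>d<N. \<Sum>b=0..d. H a b a' (d - b))"
    by (intro sum.cong refl sum_triangle) (simp add: H_def g0)
  also have "\<dots> = (\<Sum>c<N. \<Sum>a=0..c. \<Sum>d<N. \<Sum>b=0..d. H a b (c - a) (d - b))"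
    by (intro sum_triangle) (simp add: H_def g0)
  also have "\<dots> = (\<Sum>c<N. \<Sum>d<N. \<Sum>a=0..c. \<Sum>b=0..d. H a b (c - a) (d - b))"
    by (rule sum.cong[OF refl], rule sum.swap)
  also have "\<dots> = (\<Sum>c<N. \<Sum>d<N. (s * t) $ c $ d * g (i + c) (j + d))"
  proof (intro sum.cong refl)
    fix c d
    have "(s * t) $ c $ d = (\<Sum>a=0..c. \<Sum>b=0..d. s $ a $ b * t $ (c - a) $ (d - b))"
      by (simp add: fps_mult_nth fps_sum_nth)
    then show "(\<Sum>a=0..c. \<Sum>b=0..d. H a b (c - a) (d - b)) = (s * t) $ c $ d * g (i + c) (j + d)"
      by (simp add: sum_distrib_right H_def mult.assoc)
  qed
  also have "\<dots> = act (s * t) g i j" by (simp add: act_eq[OF b])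
  finally show "act (s * t) g i j = act s (act t g) i j" by simp
qed

definition mono2 :: "nat \<Rightarrow> nat \<Rightarrow> shifts" where
  "mono2 a b = fps_X ^ a * fps_const (fps_X ^ b)"

lemma mono2_nth: "mono2 a b $ c $ d = (if c = a \<and> d = b then 1 else 0)"
  by (simp add: mono2_def)

lemma mono2_mult: "mono2 a b * mono2 c d = mono2 (a + c) (b + d)"
  by (simp add: mono2_def power_add mult_ac flip: fps_const_mult)

lemma mono2_power: "mono2 a b ^ n = mono2 (n * a) (n * b)"
  by (induction n) (simp_all add: mono2_mult, simp add: mono2_def)

lemma act_mono2:
  assumes "bounded_grid N g"
  shows "act (mono2 a b) g i j = g (i + a) (j + b)"
proof -
  define M where "M = N + a + b + 1"
  have b: "bounded_grid M g" using assms by (rule bounded_grid_mono) (simp add: M_def)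
  have "act (mono2 a b) g i j =
     (\<Sum>c<M. \<Sum>d<M. (if c = a then if d = b then g (i + a) (j + b) else 0 else 0))"
    unfolding act_eq[OF b] by (intro sum.cong) (auto simp: mono2_nth)
  also have "\<dots> = g (i + a) (j + b)"
    by (rule sum_delta2) (auto simp: M_def)
  finally show ?thesis .
qed

text \<open>
  A right inverse of multiplication by \<open>x\<^sup>a y\<^sup>b\<close>.
\<close>

definition raise :: "nat \<Rightarrow> nat \<Rightarrow> grid \<Rightarrow> grid" where
  "raise a b g i j = (if a \<le> i \<and> b \<le> j then g (i - a) (j - b) else 0)"

text \<open>
  Substitution of \<open>v x\<close> and of \<open>v y\<close> for the variable of a power series: \<open>embX\<close> and \<open>embY\<close>. Both are
  ring homomorphisms, so relations between series in one variable carry over.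
\<close>

definition embV :: "rat fps \<Rightarrow> rat poly fps" where
  "embV s = Abs_fps (\<lambda>n. monom (s $ n) n)"

definition embX :: "rat fps \<Rightarrow> shifts" where
  "embX s = Abs_fps (\<lambda>a. fps_const (embV s $ a))"

definition embY :: "rat fps \<Rightarrow> shifts" where
  "embY s = fps_const (embV s)"

lemma embV_add: "embV (s + t) = embV s + embV t"
  by (rule fps_ext) (simp add: embV_def add_monom)

lemma embV_mult: "embV (s * t) = embV s * embV t"
  by (rule fps_ext) (simp add: embV_def fps_mult_nth monom_sum mult_monom)

lemma embV_1: "embV 1 = 1"
  by (rule fps_ext) (simp add: embV_def monom_eq_1)

lemma embY_add: "embY (s + t) = embY s + embY t"
  by (simp add: embY_def embV_add)

lemma embY_mult: "embY (s * t) = embY s * embY t"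
  by (simp add: embY_def embV_mult)

lemma embY_1: "embY 1 = 1"
  by (simp add: embY_def embV_1)

lemma fps_const_sum': "fps_const (sum f A) = (\<Sum>i\<in>A. fps_const (f i))"
  by (induction A rule: infinite_finite_induct) (simp_all flip: fps_const_add)

lemma embX_add: "embX (s + t) = embX s + embX t"
  by (rule fps_ext) (simp add: embX_def embV_add)

lemma embX_mult: "embX (s * t) = embX s * embX t"
  by (rule fps_ext) (simp add: embX_def embV_mult fps_mult_nth fps_const_sum')

lemma embX_1: "embX 1 = 1"
  by (rule fps_ext) (simp add: embX_def embV_1)

lemma embX_power: "embX (s ^ n) = embX s ^ n"
  by (induction n) (simp_all add: embX_1 embX_mult)

lemma embY_power: "embY (s ^ n) = embY s ^ n"
  by (induction n) (simp_all add: embY_1 embY_mult)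

lemma embX_0: "embX 0 = 0"
  by (rule fps_ext) (simp add: embX_def embV_def)

lemma embY_0: "embY 0 = 0"
  by (simp add: embY_def embV_def fps_eq_iff)

lemma embX_of_nat: "embX (of_nat n) = of_nat n"
  by (induction n) (simp_all add: embX_0 embX_1 embX_add)

lemma embY_of_nat: "embY (of_nat n) = of_nat n"
  by (induction n) (simp_all add: embY_0 embY_1 embY_add)

abbreviation cst :: "rat poly \<Rightarrow> shifts" where
  "cst c \<equiv> fps_const (fps_const c)"

lemma embX_X_power: "embX (fps_X ^ n) = cst (monom 1 n) * mono2 n 0"
  by (rule fps_ext, rule fps_ext) (simp add: embX_def embV_def mono2_def)

lemma embY_X_power: "embY (fps_X ^ n) = cst (monom 1 n) * mono2 0 n"
  by (rule fps_ext, rule fps_ext) (simp add: embY_def embV_def mono2_def)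

section \<open>The weight filtration and the two reduction operators\<close>

text \<open>
  Here \<open>Fw = f(w)\<close> and \<open>Fz = f(z)\<close> with \<open>q = p\<close>, \<open>W = w\<^sup>p\<close>, \<open>Z = z\<^sup>p\<close>. In the first identity \<open>Fw - Fz\<close> is
  divisible by \<open>w - z\<close>, and the multiple of \<open>q\<^sup>2\<close> in the quotient is removed with the help of \<open>Fz\<close>;
  what remains of the quotient is \<open>G = q mu + S\<close>. The second eliminates \<open>q\<close>: inserting
  \<open>q mu = G - S\<close> into \<open>mu\<^sup>2 Fz\<close>, a quadratic polynomial in \<open>q\<close>, shows that \<open>G\<close> divides
  \<open>mu\<^sup>2 Fz - nu (S\<^sup>2 - mu w z h)\<close>.
\<close>

lemma two_variable_identities:
  fixes q w z W Z h t e :: "'a::comm_ring_1"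
  assumes h: "W = Z + (w - z) * h"
  defines "Fw \<equiv> q ^ 2 + q * w + w * (W + q ^ 2 * (e + (w - z) * t))"
    and "Fz \<equiv> q ^ 2 + q * z + z * (Z + q ^ 2 * e)"
    and "nu \<equiv> 1 + z * e" and "mu \<equiv> 1 - w * z * t"
  defines "S \<equiv> mu * Z + w * nu * h"
  shows "nu * Fw = (w - z) * (q * mu + S) + (nu + (w - z) * (e + w * t)) * Fz"
    and "(q * nu * mu + mu * z - nu * S) * ((w - z) * (q * mu + S)) =
           (z - w) * nu * (S ^ 2 - mu * w * z * h) + (w - z) * mu ^ 2 * Fz"
proof -
  have *: "Fz = q ^ 2 * nu + q * z + z * Z" unfolding Fz_def nu_def by (simp add: algebra_simps)
  show "nu * Fw = (w - z) * (q * mu + S) + (nu + (w - z) * (e + w * t)) * Fz"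
    unfolding Fw_def Fz_def h S_def nu_def mu_def by (simp add: algebra_simps power2_eq_square)
  have zS: "S = mu * Z + w * nu * h" by (simp add: S_def)
  have "(q * nu * mu + mu * z - nu * S) * (q * mu + S) =
     nu * (mu * w * z * h - S ^ 2) + mu ^ 2 * Fz"
  proof -
    have "(q * nu * mu + mu * z - nu * S) * (q * mu + S) =
        mu ^ 2 * (q ^ 2 * nu + q * z) + mu * z * S - nu * S ^ 2"
      by (simp add: algebra_simps power2_eq_square)
    also have "mu * z * S = mu ^ 2 * (z * Z) + nu * (mu * w * z * h)"
      unfolding zS by (simp add: algebra_simps power2_eq_square)
    finally show ?thesis unfolding * by (simp add: algebra_simps)
  qed
  then have "(w - z) * ((q * nu * mu + mu * z - nu * S) * (q * mu + S)) =
     (w - z) * (nu * (mu * w * z * h - S ^ 2) + mu ^ 2 * Fz)" by simp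
  then show "(q * nu * mu + mu * z - nu * S) * ((w - z) * (q * mu + S)) =
           (z - w) * nu * (S ^ 2 - mu * w * z * h) + (w - z) * mu ^ 2 * Fz"
    by (simp add: algebra_simps)
qed

context prime_number
begin

definition zpoly :: "rat poly set" where
  "zpoly = {f. \<forall>n. coeff f n \<in> zloc}"

lemma zpoly_add [intro]: "f \<in> zpoly \<Longrightarrow> g \<in> zpoly \<Longrightarrow> f + g \<in> zpoly"
  by (auto simp: zpoly_def)
lemma zpoly_diff [intro]: "f \<in> zpoly \<Longrightarrow> g \<in> zpoly \<Longrightarrow> f - g \<in> zpoly"
  by (auto simp: zpoly_def)
lemma zpoly_uminus [intro]: "f \<in> zpoly \<Longrightarrow> - f \<in> zpoly"
  by (auto simp: zpoly_def)
lemma zpoly_mult [intro]: "f \<in> zpoly \<Longrightarrow> g \<in> zpoly \<Longrightarrow> f * g \<in> zpoly"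
  by (auto simp: zpoly_def coeff_mult)
lemma zpoly_0 [simp, intro]: "0 \<in> zpoly"
  by (auto simp: zpoly_def)
lemma zpoly_monom [intro]: "c \<in> zloc \<Longrightarrow> monom c n \<in> zpoly"
  by (auto simp: zpoly_def coeff_monom)
lemma zpoly_1 [simp, intro]: "1 \<in> zpoly"
  using zpoly_monom[OF zloc_1, of 0] by (simp add: monom_eq_1)
lemma zpoly_of_nat [simp, intro]: "of_nat n \<in> zpoly"
  by (induction n) auto
lemma zpoly_power [intro]: "f \<in> zpoly \<Longrightarrow> f ^ n \<in> zpoly"
  by (induction n) auto
lemma zpoly_sum [intro]: "(\<And>i. i \<in> I \<Longrightarrow> f i \<in> zpoly) \<Longrightarrow> sum f I \<in> zpoly"
  by (induction I rule: infinite_finite_induct) auto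

definition sint :: "shifts set" where
  "sint = {s. \<forall>a b. s $ a $ b \<in> zpoly}"

lemma sint_add [intro]: "s \<in> sint \<Longrightarrow> t \<in> sint \<Longrightarrow> s + t \<in> sint"
  by (auto simp: sint_def)
lemma sint_diff [intro]: "s \<in> sint \<Longrightarrow> t \<in> sint \<Longrightarrow> s - t \<in> sint"
  by (auto simp: sint_def)
lemma sint_uminus [intro]: "s \<in> sint \<Longrightarrow> - s \<in> sint"
  by (auto simp: sint_def)
lemma sint_mult [intro]: "s \<in> sint \<Longrightarrow> t \<in> sint \<Longrightarrow> s * t \<in> sint"
  by (auto simp: sint_def fps_mult_nth fps_sum_nth intro!: zpoly_sum zpoly_mult)
lemma sint_0 [simp, intro]: "0 \<in> sint"
  by (auto simp: sint_def)
lemma sint_cst [intro]: "c \<in> zpoly \<Longrightarrow> cst c \<in> sint"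
  by (auto simp: sint_def)
lemma sint_1 [simp, intro]: "1 \<in> sint"
  using sint_cst[OF zpoly_1] by simp
lemma sint_of_nat [simp, intro]: "of_nat n \<in> sint"
  by (induction n) auto
lemma sint_power [intro]: "s \<in> sint \<Longrightarrow> s ^ n \<in> sint"
  by (induction n) auto
lemma sint_sum [intro]: "(\<And>i. i \<in> I \<Longrightarrow> f i \<in> sint) \<Longrightarrow> sum f I \<in> sint"
  by (induction I rule: infinite_finite_induct) auto
lemma sint_mono2 [simp, intro]: "mono2 a b \<in> sint"
  by (auto simp: sint_def mono2_nth)
lemma embX_sint [intro]: "s \<in> zfps \<Longrightarrow> embX s \<in> sint"
  by (auto simp: sint_def zfps_def embX_def embV_def)
lemma embY_sint [intro]: "s \<in> zfps \<Longrightarrow> embY s \<in> sint"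
  by (auto simp: sint_def zfps_def embY_def embV_def)

text \<open>
  The filtration of \<open>[i,j]\<close> drops by \<open>wt a b\<close> under \<open>x\<^sup>a y\<^sup>b\<close>.
\<close>

definition wt :: "nat \<Rightarrow> nat \<Rightarrow> nat" where
  "wt a b = a * (p\<^sup>2 + 1) + b * (p + 1)"

lemma wt_add: "wt (a + c) (b + d) = wt a b + wt c d"
  by (simp add: wt_def algebra_simps)

definition fil :: "nat \<Rightarrow> shifts set" where
  "fil d = {s. \<forall>a b. s $ a $ b \<noteq> 0 \<longrightarrow> d \<le> wt a b}"

lemma fil_0 [simp]: "s \<in> fil 0"
  by (simp add: fil_def)
lemma fil_zero [simp]: "0 \<in> fil d"
  by (simp add: fil_def)
lemma fil_add [intro]: "s \<in> fil d \<Longrightarrow> t \<in> fil d \<Longrightarrow> s + t \<in> fil d"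
  unfolding fil_def by (auto, metis add.right_neutral)
lemma fil_uminus [intro]: "s \<in> fil d \<Longrightarrow> - s \<in> fil d"
  by (auto simp: fil_def)
lemma fil_diff [intro]: "s \<in> fil d \<Longrightarrow> t \<in> fil d \<Longrightarrow> s - t \<in> fil d"
  using fil_add[of s d "- t"] by auto
lemma fil_mono: "s \<in> fil d \<Longrightarrow> e \<le> d \<Longrightarrow> s \<in> fil e"
  unfolding fil_def by (blast intro: order_trans)
lemma fil_sum [intro]: "(\<And>i. i \<in> I \<Longrightarrow> f i \<in> fil d) \<Longrightarrow> sum f I \<in> fil d"
  by (induction I rule: infinite_finite_induct) auto

lemma fil_mult:
  assumes "s \<in> fil d" "t \<in> fil e"
  shows "s * t \<in> fil (d + e)"
  unfolding fil_def
proof (intro CollectI allI impI)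
  fix a b assume "(s * t) $ a $ b \<noteq> 0"
  then have "(\<Sum>i=0..a. \<Sum>j=0..b. s $ i $ j * t $ (a - i) $ (b - j)) \<noteq> 0"
    by (simp add: fps_mult_nth fps_sum_nth)
  then obtain i where i: "i \<in> {0..a}" "(\<Sum>j=0..b. s $ i $ j * t $ (a - i) $ (b - j)) \<noteq> 0"
    by (rule sum.not_neutral_contains_not_neutral)
  from i(2) obtain j where j: "j \<in> {0..b}" "s $ i $ j * t $ (a - i) $ (b - j) \<noteq> 0"
    by (rule sum.not_neutral_contains_not_neutral)
  have "d \<le> wt i j" "e \<le> wt (a - i) (b - j)"
    using assms j(2) by (auto simp: fil_def)
  moreover have "wt a b = wt i j + wt (a - i) (b - j)"
    using i(1) j(1) by (simp flip: wt_add)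
  ultimately show "d + e \<le> wt a b" by simp
qed

lemma fil_mult_left: "t \<in> fil e \<Longrightarrow> s * t \<in> fil e"
  using fil_mult[of s 0 t e] by simp

lemma fil_power: "s \<in> fil d \<Longrightarrow> s ^ n \<in> fil (n * d)"
  by (induction n) (simp_all add: fil_mult)

lemma fil_mono2: "mono2 a b \<in> fil (wt a b)"
  by (auto simp: fil_def mono2_nth)

text \<open>
  All terms of \<open>s\<close> lower the filtration by at least \<open>d\<close>, and the part that lowers it by exactly \<open>d\<close>
  is \<open>m\<close> up to terms that lower it further.
\<close>

definition leads :: "shifts \<Rightarrow> nat \<Rightarrow> shifts \<Rightarrow> bool" where
  "leads s d m \<longleftrightarrow> s \<in> fil d \<and> s - m \<in> fil (Suc d)"

lemma leads_mult:
  assumes "leads s d m" "leads t e n"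
  shows "leads (s * t) (d + e) (m * n)"
proof -
  have m: "m \<in> fil d" using fil_diff[of s d "s - m"] assms(1) fil_mono[of "s - m" "Suc d" d]
    by (simp add: leads_def)
  have "s * t - m * n = (s - m) * t + m * (t - n)" by (simp add: algebra_simps)
  moreover have "(s - m) * t \<in> fil (Suc d + e)" "m * (t - n) \<in> fil (d + Suc e)"
    using assms m unfolding leads_def by (blast intro: fil_mult)+
  ultimately have "s * t - m * n \<in> fil (Suc (d + e))" by (simp add: fil_add)
  then show ?thesis using assms fil_mult by (auto simp: leads_def)
qed

lemma leads_power: "leads s d m \<Longrightarrow> leads (s ^ n) (n * d) (m ^ n)"
proof (induction n)
  case (Suc n)
  then show ?case using leads_mult[of s d m "s ^ n" "n * d" "m ^ n"] by simp
qed (simp add: leads_def)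

lemma leads_add_fil: "leads s d m \<Longrightarrow> t \<in> fil (Suc d) \<Longrightarrow> leads (s + t) d m"
proof -
  assume h: "leads s d m" "t \<in> fil (Suc d)"
  have "t \<in> fil d" using h(2) fil_mono by simp
  moreover have "s + t - m = (s - m) + t" by simp
  moreover have "(s - m) + t \<in> fil (Suc d)" using h by (intro fil_add) (auto simp: leads_def)
  ultimately show ?thesis using h by (simp only: leads_def fil_add)
qed

lemma leads_uminus: "leads s d m \<Longrightarrow> leads (- s) d (- m)"
  using fil_uminus[of "s - m" "Suc d"] by (auto simp: leads_def)

lemma leads_refl_0: "leads s 0 s"
  by (simp add: leads_def)

lemma leads_mono2: "leads (mono2 a b) (wt a b) (mono2 a b)"
  by (simp add: leads_def fil_mono2)

lemma leads_embX: "s $ 0 = 1 \<Longrightarrow> leads (embX s) 0 1"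
  by (auto simp: leads_def fil_def embX_def embV_def wt_def monom_eq_1)

lemma leads_embY: "s $ 0 = 1 \<Longrightarrow> leads (embY s) 0 1"
  by (auto simp: leads_def fil_def embY_def embV_def wt_def monom_eq_1)

definition AX :: shifts where "AX = embX A_fps"
definition AY :: shifts where "AY = embY A_fps"

lemma A_fps_zfps: "A_fps \<in> zfps"
  by (auto simp: A_fps_def zfps_def)

lemma AX_sint [simp, intro]: "AX \<in> sint" and AY_sint [simp, intro]: "AY \<in> sint"
  using A_fps_zfps by (auto simp: AX_def AY_def)

lemma leads_AY: "leads AY 0 (of_nat p ^ 2)"
proof -
  have c: "(of_nat p ^ 2 :: shifts) = cst (monom (of_nat (p\<^sup>2)) 0)"
    by (simp add: fps_of_nat[symmetric] monom_0 of_nat_poly power2_eq_square)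
  show ?thesis unfolding leads_def c
    by (auto simp: AY_def fil_def embY_def embV_def A_fps_def wt_def)
qed

abbreviation vpow :: "nat \<Rightarrow> rat poly" where
  "vpow n \<equiv> monom 1 n"

lemma cst_vpow_power: "cst (vpow m) ^ n = cst (vpow (m * n))"
  by (induction n) (simp_all add: mult_monom monom_eq_1)

text \<open>
  With \<open>V = v\<^sup>p\<^sup>-\<^sup>1\<close>, the boundary operator \<open>AX\<close> becomes, modulo multiples of \<open>AY\<close>, the multiple \<open>V D\<close>
  after multiplication by the unit \<open>nu\<close>, and \<open>V\<^sup>p\<^sup>+\<^sup>2 E\<close> after multiplication by \<open>m nu\<close>, where \<open>m\<close> is
  \<open>p\<close> to leading order. These are the two identities above for \<open>w = V om\<close> and \<open>z = V ze\<close>, where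
  \<open>om\<close> and \<open>ze\<close> are \<open>x\<^sup>p\<^sup>-\<^sup>1\<close> and \<open>y\<^sup>p\<^sup>-\<^sup>1\<close> to leading order.
  
  The weights decide which terms lead. In \<open>(w - z)(p mu + S)\<close> it is \<open>-p z\<close>, because \<open>w\<close> weighs more
  than \<open>z\<close>. In \<open>(z - w)(S\<^sup>2 - mu w z h)\<close> it is \<open>-w z\<^sup>p\<^sup>+\<^sup>1\<close>: the competitor \<open>z\<^sup>2\<^sup>p\<^sup>+\<^sup>1\<close> from \<open>z S\<^sup>2\<close> weighs
  more, because \<open>p (p + 1) > p\<^sup>2 + 1\<close>.
\<close>

lemma reduction_operators:
  obtains nu m D E L G r r' where
    "nu \<in> sint" "m \<in> sint" "D \<in> sint" "E \<in> sint" "L \<in> sint" "G \<in> sint" "r \<in> sint" "r' \<in> sint"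
    "nu * AX = cst (vpow (p - 1)) * D + r * AY"
    "m * nu * AX = cst (vpow ((p - 1) * (p + 2))) * E + r' * AY"
    "D = G * L"
    "leads nu 0 1" "leads m 0 (of_nat p)"
    "leads L (wt 0 (p - 1)) (- mono2 0 (p - 1))"
    "leads D (wt 0 (p - 1)) (- (of_nat p * mono2 0 (p - 1)))"
    "leads E (wt (p - 1) (p\<^sup>2 - 1)) (- mono2 (p - 1) (p\<^sup>2 - 1))"
proof -
  obtain u U where u: "u \<in> zfps" "U \<in> zfps" "u $ 0 = 1" "U $ 0 = 1"
     "A_fps = u * (of_nat p ^ 2 + of_nat p * (fps_X ^ (p - 1) * U) +
        (fps_X ^ (p - 1) * U) * (of_nat p + fps_X ^ (p - 1) * U) ^ p)"
    using A_fps_factor by blast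
  define V where "V = cst (vpow (p - 1))"
  define om where "om = mono2 (p - 1) 0 * embX U"
  define ze where "ze = mono2 0 (p - 1) * embY U"
  define w where "w = V * om"
  define z where "z = V * ze"
  define q :: shifts where "q = of_nat p"
  have wX: "embX (fps_X ^ (p - 1) * U) = w"
    by (simp add: embX_mult embX_X_power w_def V_def om_def mult.assoc)
  have zY: "embY (fps_X ^ (p - 1) * U) = z"
    by (simp add: embY_mult embY_X_power z_def V_def ze_def mult.assoc)
  define ev where "ev x = (\<Sum>k<p. of_nat (ec k) * x ^ k)" for x :: shifts
  have AX: "AX = embX u * (q ^ 2 + q * w + w * (w ^ p + q ^ 2 * ev w))"
    unfolding AX_def u(5) embX_mult[of u] embX_add embX_mult[of "of_nat p"] embX_mult[of "_ * _" "_ ^ _"]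
      embX_power embX_of_nat wX q_def ev_def p_plus_power[symmetric] ..
  have AY: "AY = embY u * (q ^ 2 + q * z + z * (z ^ p + q ^ 2 * ev z))"
    unfolding AY_def u(5) embY_mult[of u] embY_add embY_mult[of "of_nat p"] embY_mult[of "_ * _" "_ ^ _"]
      embY_power embY_of_nat zY q_def ev_def p_plus_power[symmetric] ..
  \<comment> \<open>\<open>h\<close> and \<open>t\<close> are the divided differences of the \<open>p\<close>-th power and of \<open>ev\<close>; \<open>h'\<close> is \<open>h\<close> without its factor \<open>V\<^sup>p\<^sup>-\<^sup>1\<close>.\<close>
  define h where "h = (\<Sum>l<p. z ^ (p - Suc l) * w ^ l)"
  define h' where "h' = (\<Sum>l<p. ze ^ (p - Suc l) * om ^ l)"
  define t where "t = (\<Sum>k<p. of_nat (ec k) * (\<Sum>l<k. z ^ (k - Suc l) * w ^ l))"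
  have h: "w ^ p = z ^ p + (w - z) * h"
    using power_diff_sumr2[of w p z] by (simp add: h_def algebra_simps)
  have t: "ev w = ev z + (w - z) * t"
  proof -
    have "ev w - ev z = (\<Sum>k<p. of_nat (ec k) * (w ^ k - z ^ k))"
      by (simp add: ev_def sum_subtractf right_diff_distrib)
    also have "\<dots> = (\<Sum>k<p. of_nat (ec k) * ((w - z) * (\<Sum>l<k. z ^ (k - Suc l) * w ^ l)))"
      by (simp only: power_diff_sumr2)
    also have "\<dots> = (w - z) * t" by (simp add: t_def sum_distrib_left mult_ac)
    finally show ?thesis by (simp add: algebra_simps)
  qed
  define nu where "nu = 1 + z * ev z"
  define mu where "mu = 1 - w * z * t"
  define S where "S = mu * z ^ p + w * nu * h"
  define sg where "sg = mu * ze ^ p + om * nu * h'"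
  define Fw where "Fw = q ^ 2 + q * w + w * (w ^ p + q ^ 2 * (ev z + (w - z) * t))"
  define Fz where "Fz = q ^ 2 + q * z + z * (z ^ p + q ^ 2 * ev z)"
  define m where "m = q * nu * mu + mu * z - nu * S"
  have id1: "nu * Fw = (w - z) * (q * mu + S) + (nu + (w - z) * (ev z + w * t)) * Fz"
    unfolding Fw_def Fz_def nu_def mu_def S_def
    by (rule two_variable_identities(1)[OF h])
  have id2: "m * ((w - z) * (q * mu + S)) =
           (z - w) * nu * (S ^ 2 - mu * w * z * h) + (w - z) * mu ^ 2 * Fz"
    unfolding m_def Fz_def nu_def mu_def S_def
    by (rule two_variable_identities(2)[OF h])
  have hh': "h = V ^ (p - 1) * h'"
    unfolding h_def h'_def sum_distrib_left
  proof (rule sum.cong)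
    fix l assume "l \<in> {..<p}"
    then have "p - 1 = (p - Suc l) + l" by auto
    then have "V ^ (p - 1) = V ^ (p - Suc l) * V ^ l" by (metis power_add)
    then show "z ^ (p - Suc l) * w ^ l = V ^ (p - 1) * (ze ^ (p - Suc l) * om ^ l)"
      by (simp add: w_def z_def power_mult_distrib mult_ac)
  qed simp
  obtain k where k: "p = Suc k" "k \<ge> 1" using p_gt_1 by (cases p) auto
  define W1 where "W1 = wt (p - 1) 0"
  define W2 where "W2 = wt 0 (p - 1)"
  \<comment> \<open>\<open>W1\<close> and \<open>W2\<close> are the weights of \<open>om\<close> and \<open>ze\<close>.\<close>
  have W2_pos: "W2 \<ge> 1" unfolding W2_def wt_def using k by simp
  have W12: "W1 > W2"
    unfolding W1_def W2_def wt_def using k by (simp add: power2_eq_square)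
  have pW2: "p * W2 > W1"
  proof -
    have "p * W2 = W1 + k * k" unfolding W1_def W2_def wt_def using k by (simp add: power2_eq_square algebra_simps)
    then show ?thesis using k by simp
  qed
  have target: "wt (p - 1) (p\<^sup>2 - 1) = W1 + (p + 1) * W2" and psq: "p\<^sup>2 - 1 = (p + 1) * (p - 1)"
    unfolding W1_def W2_def wt_def using k by (simp_all add: power2_eq_square algebra_simps)
  define Vk where "Vk = V ^ k"
  have Vp: "V ^ p = V * Vk" "V ^ (p - 1) = Vk" "V ^ (p + 2) = V * V * V * Vk"
    using k by (simp_all add: Vk_def mult.assoc)
  have SV: "S = V * Vk * sg"
  proof -
    have "S = mu * (V ^ p * ze ^ p) + (V * om) * nu * (V ^ (p - 1) * h')"
      unfolding S_def hh' by (simp only: z_def w_def power_mult_distrib)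
    also have "\<dots> = V * Vk * sg" unfolding Vp sg_def by (simp only: algebra_simps)
    finally show ?thesis .
  qed
  define D0 where "D0 = (om - ze) * (q * mu + V * Vk * sg)"
  define E0 where "E0 = (ze - om) * nu * (Vk * sg ^ 2) - (ze - om) * nu * (mu * om * ze * h')"
  have D0: "(w - z) * (q * mu + S) = V * D0"
    unfolding SV D0_def by (simp only: w_def z_def algebra_simps)
  have E0: "(z - w) * nu * (S ^ 2 - mu * w * z * h) = V ^ (p + 2) * E0"
  proof -
    have "(z - w) * nu * (S ^ 2 - mu * w * z * h) =
      (V * ze - V * om) * nu * ((V * Vk * sg) ^ 2 - mu * (V * om) * (V * ze) * (Vk * h'))"
      unfolding SV hh' Vp by (simp only: w_def z_def)
    also have "\<dots> = V ^ (p + 2) * E0"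
      unfolding E0_def Vp by (simp only: algebra_simps power2_eq_square)
    finally show ?thesis .
  qed
  define uX where "uX = embX u"
  \<comment> \<open>The unit factor of \<open>AY\<close> is moved to the other side, so that multiples of \<open>Fz\<close> are multiples of \<open>AY\<close>.\<close>
  define vY where "vY = embY (inverse u)"
  have vY: "vY * embY u = 1"
    unfolding vY_def embY_mult[symmetric] using u(3) by (simp add: inverse_mult_eq_1 embY_1)
  have AX': "AX = uX * Fw" unfolding AX Fw_def uX_def t ..
  have "vY * AY = (vY * embY u) * Fz" unfolding AY Fz_def by (simp only: mult.assoc)
  then have Fz: "Fz = vY * AY" unfolding vY by simp
  define c where "c = nu + (w - z) * (ev z + w * t)"
  define r where "r = uX * c * vY"
  define r' where "r' = uX * ((w - z) * mu ^ 2 + m * c) * vY"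
  have id1': "nu * Fw = V * D0 + c * Fz" unfolding id1 D0 c_def ..
  have id2': "m * (V * D0) = V ^ (p + 2) * E0 + (w - z) * mu ^ 2 * Fz"
    using id2 unfolding D0 E0 .
  have eq1: "nu * AX = V * (uX * D0) + r * AY"
  proof -
    have "nu * AX = uX * (nu * Fw)" unfolding AX' by (simp only: mult_ac)
    also have "\<dots> = V * (uX * D0) + r * AY"
      unfolding id1' Fz r_def by (simp only: algebra_simps)
    finally show ?thesis .
  qed
  have eq2: "m * nu * AX = V ^ (p + 2) * (uX * E0) + r' * AY"
  proof -
    have "m * nu * AX = uX * (m * (nu * Fw))" unfolding AX' by (simp only: mult_ac)
    also have "m * (nu * Fw) = m * (V * D0) + m * (c * Fz)" unfolding id1' by (simp only: algebra_simps)
    also have "uX * \<dots> = V ^ (p + 2) * (uX * E0) + r' * AY"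
      unfolding id2' Fz r'_def by (simp only: algebra_simps)
    finally show ?thesis .
  qed
  have Vz: "V \<in> sint" unfolding V_def by (intro sint_cst zpoly_monom zloc_1)
  have omz: "om \<in> sint" "ze \<in> sint" unfolding om_def ze_def using u by auto
  have wz: "w \<in> sint" "z \<in> sint" "q \<in> sint" unfolding w_def z_def q_def using omz Vz by auto
  have evz: "ev z \<in> sint" "t \<in> sint" "h' \<in> sint"
    unfolding ev_def t_def h'_def using wz omz by (auto intro!: sint_sum sint_mult sint_power)
  have nuz: "nu \<in> sint" "mu \<in> sint" unfolding nu_def mu_def using wz evz by auto
  have Vkz: "Vk \<in> sint" unfolding Vk_def using Vz by auto
  have sgz: "sg \<in> sint" unfolding sg_def using omz nuz evz by auto
  have Sz: "S \<in> sint" unfolding SV using Vz Vkz sgz by auto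
  have mz: "m \<in> sint" unfolding m_def using wz nuz Sz by auto
  have uz: "uX \<in> sint" "vY \<in> sint"
    unfolding uX_def vY_def using u zfps_inverse[of u] by auto
  have cz: "c \<in> sint" unfolding c_def using nuz wz evz by auto
  have rz: "r \<in> sint" "r' \<in> sint" unfolding r_def r'_def using uz cz wz nuz mz
    by (auto intro!: sint_mult sint_add sint_diff sint_power)
  have D0z: "D0 \<in> sint" "E0 \<in> sint" unfolding D0_def E0_def
    using omz wz nuz Vz Vkz sgz evz by (auto intro!: sint_diff sint_mult sint_add sint_power)
  have lom: "leads om W1 (mono2 (p - 1) 0)"
    using leads_mult[OF leads_mono2 leads_embX[OF u(4)], of "p - 1" 0] by (simp add: om_def W1_def)
  have lze: "leads ze W2 (mono2 0 (p - 1))"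
    using leads_mult[OF leads_mono2 leads_embY[OF u(4)], of 0 "p - 1"] by (simp add: ze_def W2_def)
  have om_fil: "om \<in> fil W1" and ze_fil: "ze \<in> fil W2"
    using lom lze by (simp_all add: leads_def)
  have z_fil: "z \<in> fil 1"
    using fil_mono[OF ze_fil W2_pos] unfolding z_def by (rule fil_mult_left)
  have om_fil2: "om \<in> fil (Suc W2)" by (rule fil_mono[OF om_fil]) (use W12 in simp)
  have lL: "leads (om - ze) W2 (- mono2 0 (p - 1))"
    using leads_add_fil[OF leads_uminus[OF lze] om_fil2] by simp
  have lL': "leads (ze - om) W2 (mono2 0 (p - 1))"
    using leads_uminus[OF lL] by simp
  have fil1_mult: "x * y \<in> fil (Suc 0)" if "x \<in> fil 1" for x y
    using fil_mult_left[OF that, of y] by (simp add: mult.commute)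
  have lnu: "leads nu 0 1"
    unfolding nu_def using leads_add_fil[OF leads_refl_0 fil1_mult[OF z_fil]] .
  have lmu: "leads mu 0 1"
    using leads_add_fil[OF leads_refl_0 fil1_mult[OF z_fil], of 1 "- (w * t)"]
    by (simp add: mu_def algebra_simps)
  have term_fil: "ze ^ (p - Suc l) * om ^ l \<in> fil ((p - 1) * W2 + l)" if "l < p" for l
  proof -
    have "ze ^ (p - Suc l) * om ^ l \<in> fil ((p - Suc l) * W2 + l * W1)"
      by (intro fil_mult fil_power om_fil ze_fil)
    moreover have "(p - 1) * W2 + l \<le> (p - Suc l) * W2 + l * W1"
    proof -
      have "p - 1 = (p - Suc l) + l" using that by simp
      then have "(p - 1) * W2 + l = (p - Suc l) * W2 + l * Suc W2"
        by (simp add: algebra_simps)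
      also have "\<dots> \<le> (p - Suc l) * W2 + l * W1"
        by (intro add_left_mono mult_le_mono2) (use W12 in simp)
      finally show ?thesis .
    qed
    ultimately show ?thesis by (rule fil_mono)
  qed
  \<comment> \<open>In \<open>h\<close>, the sum of all products of \<open>p - 1\<close> factors \<open>om\<close> or \<open>ze\<close>, the lightest term is \<open>ze\<^sup>p\<^sup>-\<^sup>1\<close>.\<close>
  have lh: "leads h' ((p - 1) * W2) (mono2 0 ((p - 1) * (p - 1)))"
  proof -
    have "h' = ze ^ (p - 1) + (\<Sum>l\<in>{1..<p}. ze ^ (p - Suc l) * om ^ l)"
      unfolding h'_def lessThan_atLeast0 using p_gt_1 by (subst sum.atLeast_Suc_lessThan) auto
    moreover have "(\<Sum>l\<in>{1..<p}. ze ^ (p - Suc l) * om ^ l) \<in> fil (Suc ((p - 1) * W2))"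
      by (rule fil_sum, rule fil_mono[OF term_fil]) auto
    ultimately show ?thesis
      using leads_add_fil[OF leads_power[OF lze, of "p - 1"]] by (simp add: mono2_power)
  qed
  have sg_fil: "sg \<in> fil (p * W2)"
  proof -
    have "mu * ze ^ p \<in> fil (p * W2)" by (intro fil_mult_left fil_power ze_fil)
    moreover have "nu * (om * h') \<in> fil (W1 + (p - 1) * W2)"
      using lh om_fil by (intro fil_mult_left fil_mult) (auto simp: leads_def)
    then have "nu * (om * h') \<in> fil (p * W2)"
      by (rule fil_mono) (use W12 k in auto)
    ultimately show ?thesis unfolding sg_def by (auto simp: mult_ac)
  qed
  have sg1: "sg \<in> fil 1"
    using W2_pos p_gt_1 by (intro fil_mono[OF sg_fil]) simp
  have lq: "leads (q * mu + x * sg) 0 q" for x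
    using leads_add_fil[OF leads_mult[OF leads_refl_0[of q] lmu], of "x * sg"] fil_mult_left[OF sg1, of x]
    by simp
  have luX: "leads uX 0 1" unfolding uX_def using u(3) by (rule leads_embX)
  have lD: "leads (uX * D0) W2 (- (q * mono2 0 (p - 1)))"
    unfolding D0_def using leads_mult[OF luX leads_mult[OF lL lq[of "V * Vk"]]]
    by (simp add: mult.commute)
  have lm: "leads m 0 q"
  proof -
    have "mu * z - nu * S \<in> fil (Suc 0)"
      unfolding SV using fil_diff[OF fil_mult_left[OF z_fil, of mu] fil_mult_left[OF sg1, of "nu * (V * Vk)"]]
      by (simp add: mult.assoc)
    then have "leads (q * nu * mu + (mu * z - nu * S)) 0 q"
      using leads_add_fil[OF leads_mult[OF leads_mult[OF leads_refl_0[of q] lnu] lmu], of "mu * z - nu * S"]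
      by simp
    then show ?thesis by (simp add: m_def add_diff_eq)
  qed
  have lE: "leads (uX * E0) (wt (p - 1) (p\<^sup>2 - 1)) (- mono2 (p - 1) (p\<^sup>2 - 1))"
  proof -
    have "leads ((ze - om) * nu * (mu * om * ze * h')) (W2 + 0 + (0 + W1 + W2 + (p - 1) * W2))
        (mono2 0 (p - 1) * 1 * (1 * mono2 (p - 1) 0 * mono2 0 (p - 1) * mono2 0 ((p - 1) * (p - 1))))"
      by (intro leads_mult lL' lnu lmu lom lze lh)
    also have "W2 + 0 + (0 + W1 + W2 + (p - 1) * W2) = wt (p - 1) (p\<^sup>2 - 1)"
      unfolding target using k by simp
    also have "mono2 0 (p - 1) * 1 * (1 * mono2 (p - 1) 0 * mono2 0 (p - 1) * mono2 0 ((p - 1) * (p - 1)))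
       = mono2 (p - 1) (p\<^sup>2 - 1)"
      unfolding psq using k by (simp add: mono2_mult algebra_simps)
    finally have 1: "leads (- ((ze - om) * nu * (mu * om * ze * h'))) (wt (p - 1) (p\<^sup>2 - 1))
       (- mono2 (p - 1) (p\<^sup>2 - 1))" by (rule leads_uminus)
    have "nu * Vk * ((ze - om) * sg ^ 2) \<in> fil (W2 + 2 * (p * W2))"
      using lL' sg_fil by (intro fil_mult_left fil_mult fil_power) (auto simp: leads_def)
    then have "nu * Vk * ((ze - om) * sg ^ 2) \<in> fil (Suc (wt (p - 1) (p\<^sup>2 - 1)))"
      unfolding target by (rule fil_mono) (use pW2 in \<open>simp add: algebra_simps\<close>)
    from leads_add_fil[OF 1 this] have "leads E0 (wt (p - 1) (p\<^sup>2 - 1)) (- mono2 (p - 1) (p\<^sup>2 - 1))"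
      unfolding E0_def by (simp add: algebra_simps)
    from leads_mult[OF luX this] show ?thesis by simp
  qed
  show ?thesis
  proof (rule that[of nu m "uX * D0" "uX * E0" "om - ze" "uX * (q * mu + V * Vk * sg)" r r'])
    show "nu * AX = cst (vpow (p - 1)) * (uX * D0) + r * AY"
      using eq1 unfolding V_def .
    show "m * nu * AX = cst (vpow ((p - 1) * (p + 2))) * (uX * E0) + r' * AY"
      using eq2 unfolding V_def cst_vpow_power .
    show "uX * D0 = uX * (q * mu + V * Vk * sg) * (om - ze)"
      unfolding D0_def by (simp only: mult_ac)
  qed (use nuz mz uz D0z omz rz wz Vz Vkz sgz lnu lm lL lD lE in
        \<open>auto simp: W2_def q_def intro!: sint_mult sint_add\<close>)
qed

section \<open>Leading terms of cycles and of boundaries\<close>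

definition below :: "nat \<Rightarrow> grid set" where
  "below n = {g. (\<forall>i j. g i j \<in> zpoly) \<and> (\<forall>i j. g i j \<noteq> 0 \<longrightarrow> wt i j < n)}"

definition grids :: "grid set" where
  "grids = (\<Union>n. below n)"

lemma below_zpoly: "g \<in> below n \<Longrightarrow> g i j \<in> zpoly"
  by (simp add: below_def)

lemma below_zero: "g \<in> below n \<Longrightarrow> n \<le> wt i j \<Longrightarrow> g i j = 0"
  unfolding below_def by (metis (mono_tags, lifting) linorder_not_less mem_Collect_eq)

lemma belowI: "(\<And>i j. g i j \<in> zpoly) \<Longrightarrow> (\<And>i j. n \<le> wt i j \<Longrightarrow> g i j = 0) \<Longrightarrow> g \<in> below n"
  unfolding below_def using not_less by blast

lemma below_mono: "g \<in> below m \<Longrightarrow> m \<le> n \<Longrightarrow> g \<in> below n"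
  by (rule belowI) (auto simp: below_zpoly below_zero)

lemma below_0_iff: "g \<in> below 0 \<longleftrightarrow> g = 0"
  by (auto simp: below_def fun_eq_iff)

lemma zero_below [simp]: "0 \<in> below n"
  by (simp add: below_def)

lemma below_add [intro]: "g \<in> below n \<Longrightarrow> h \<in> below n \<Longrightarrow> g + h \<in> below n"
  by (rule belowI) (auto simp: below_zpoly below_zero)

lemma below_uminus [intro]: "g \<in> below n \<Longrightarrow> - g \<in> below n"
  by (rule belowI) (auto simp: below_zpoly below_zero)

lemma below_diff [intro]: "g \<in> below n \<Longrightarrow> h \<in> below n \<Longrightarrow> g - h \<in> below n"
  by (rule belowI) (auto simp: below_zpoly below_zero)

lemma below_scal [intro]: "c \<in> zpoly \<Longrightarrow> g \<in> below n \<Longrightarrow> scal c g \<in> below n"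
  by (rule belowI) (auto simp: below_zpoly below_zero scal_def)

lemma below_Suc_diff:
  assumes "g \<in> below (Suc n)" "h \<in> below (Suc n)" "\<And>i j. wt i j = n \<Longrightarrow> g i j = h i j"
  shows "g - h \<in> below n"
proof (rule belowI)
  fix i j assume "n \<le> wt i j"
  then consider "wt i j = n" | "Suc n \<le> wt i j" by linarith
  then show "(g - h) i j = 0"
    using assms below_zero[of g "Suc n" i j] below_zero[of h "Suc n" i j] by cases auto
qed (use assms below_zpoly in auto)

lemma gridsI [intro]: "g \<in> below n \<Longrightarrow> g \<in> grids"
  by (auto simp: grids_def)

lemma grids_below: "g \<in> grids \<Longrightarrow> \<exists>n. g \<in> below n"
  by (auto simp: grids_def)

lemma grids_below2:
  assumes "g \<in> grids" "h \<in> grids"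
  shows "\<exists>n. g \<in> below n \<and> h \<in> below n"
proof -
  obtain m n where "g \<in> below m" "h \<in> below n" using assms grids_below by blast
  then have "g \<in> below (max m n) \<and> h \<in> below (max m n)"
    using below_mono max.cobounded1 max.cobounded2 by blast
  then show ?thesis ..
qed

lemma grids_add [intro]: "g \<in> grids \<Longrightarrow> h \<in> grids \<Longrightarrow> g + h \<in> grids"
  using grids_below2[of g h] by (auto intro: gridsI below_add)
lemma grids_diff [intro]: "g \<in> grids \<Longrightarrow> h \<in> grids \<Longrightarrow> g - h \<in> grids"
  using grids_below2[of g h] by (auto intro: gridsI below_diff)
lemma grids_uminus [intro]: "g \<in> grids \<Longrightarrow> - g \<in> grids"
  using grids_below[of g] by (auto intro: gridsI below_uminus)
lemma grids_scal [intro]: "c \<in> zpoly \<Longrightarrow> g \<in> grids \<Longrightarrow> scal c g \<in> grids"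
  using grids_below[of g] by (auto intro: gridsI below_scal)
lemma grids_0 [simp, intro]: "0 \<in> grids"
  using gridsI[OF zero_below] .

lemma below_bounded:
  assumes "g \<in> below n"
  shows "bounded_grid n g"
proof -
  have le: "i \<le> wt i j" "j \<le> wt i j" for i j by (auto simp: wt_def)
  show ?thesis unfolding bounded_grid_def
    using below_zero[OF assms] le order_trans by blast
qed

lemma grids_bounded: "g \<in> grids \<Longrightarrow> \<exists>N. bounded_grid N g"
  using grids_below[of g] by (auto dest: below_bounded)

lemma act_below:
  assumes "s \<in> sint" "s \<in> fil d" "g \<in> below n"
  shows "act s g \<in> below (n - d)"
proof (rule belowI)
  fix i j
  note e = act_eq[OF below_bounded[OF assms(3)], of s i j]
  show "act s g i j \<in> zpoly"
    unfolding e using assms below_zpoly by (auto simp: sint_def intro!: zpoly_sum zpoly_mult)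
  assume ij: "n - d \<le> wt i j"
  have "s $ a $ b * g (i + a) (j + b) = 0" for a b
  proof (rule ccontr)
    assume "s $ a $ b * g (i + a) (j + b) \<noteq> 0"
    then have "d \<le> wt a b" "wt (i + a) (j + b) < n"
      using assms by (auto simp: fil_def below_def)
    then show False using ij by (simp add: wt_add)
  qed
  then show "act s g i j = 0" unfolding e by (intro sum.neutral ballI) blast
qed

lemma act_below0: "s \<in> sint \<Longrightarrow> g \<in> below n \<Longrightarrow> act s g \<in> below n"
  using act_below[of s 0 g n] by simp

lemma act_grids [intro]: "s \<in> sint \<Longrightarrow> g \<in> grids \<Longrightarrow> act s g \<in> grids"
  using grids_below[of g] by (auto intro: gridsI act_below0)

lemma act_add: "g \<in> grids \<Longrightarrow> h \<in> grids \<Longrightarrow> act s (g + h) = act s g + act s h"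
  using grids_below2[of g h] by (auto intro: act_add_right_N below_bounded)

lemma act_uminus: "g \<in> grids \<Longrightarrow> act s (- g) = - act s g"
proof -
  assume g: "g \<in> grids"
  have "act s g + act s (- g) = act s (g + - g)" using g by (simp only: act_add grids_uminus)
  also have "\<dots> = 0" by (auto simp: act_def fun_eq_iff)
  finally show ?thesis by (simp add: eq_neg_iff_add_eq_0 add.commute)
qed

lemma act_diff: "g \<in> grids \<Longrightarrow> h \<in> grids \<Longrightarrow> act s (g - h) = act s g - act s h"
  using act_add[of g "- h" s] act_uminus[of h s] by (simp add: grids_uminus)

lemma act_times: "g \<in> grids \<Longrightarrow> act (s * t) g = act s (act t g)"
  using grids_bounded act_mult by blast

lemma act_plus: "g \<in> grids \<Longrightarrow> act (s + t) g = act s g + act t g"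
  using grids_bounded act_add_left by blast

lemma act_minus: "g \<in> grids \<Longrightarrow> act (s - t) g = act s g - act t g"
  using grids_bounded act_diff_left by blast

lemma act_neg: "g \<in> grids \<Longrightarrow> act (- s) g = - act s g"
  using grids_bounded act_uminus_left by blast

lemma act_cst: "g \<in> grids \<Longrightarrow> act (cst c) g = scal c g"
  using grids_bounded act_const by blast

lemma act_one: "g \<in> grids \<Longrightarrow> act 1 g = g"
  using grids_bounded act_1 by blast

lemma act_monomial: "g \<in> grids \<Longrightarrow> act (mono2 a b) g i j = g (i + a) (j + b)"
  using grids_bounded act_mono2 by blast

lemma of_nat_cst: "(of_nat n :: shifts) = cst (of_nat n)"
  by (simp add: fps_of_nat[symmetric])

lemma act_of_nat: "g \<in> grids \<Longrightarrow> act (of_nat n) g = scal (of_nat n) g"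
  unfolding of_nat_cst by (rule act_cst)

lemma leads_below:
  assumes "leads s d m" "s \<in> sint" "m \<in> sint" "g \<in> below n"
  shows "act s g - act m g \<in> below (n - Suc d)"
proof -
  have "act (s - m) g \<in> below (n - Suc d)"
    using assms by (intro act_below) (auto simp: leads_def)
  then show ?thesis using assms(4) by (simp add: act_minus gridsI)
qed

lemma leads_one_below:
  assumes "leads s 0 1" "s \<in> sint" "g \<in> below (Suc n)"
  shows "act s g - g \<in> below n"
  using leads_below[OF assms(1,2) sint_1 assms(3)] assms(3) by (simp add: act_one gridsI)

lemma raise_below: "g \<in> below n \<Longrightarrow> raise a b g \<in> below (n + wt a b)"
proof (rule belowI)
  fix i j assume g: "g \<in> below n"
  then show "raise a b g i j \<in> zpoly" by (simp add: raise_def below_zpoly)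
  assume "n + wt a b \<le> wt i j"
  then have "n \<le> wt (i - a) (j - b)" if "a \<le> i" "b \<le> j"
    using wt_add[of "i - a" a "j - b" b] that by simp
  then show "raise a b g i j = 0" using g by (auto simp: raise_def below_zero)
qed

lemma act_raise: "g \<in> grids \<Longrightarrow> act (mono2 a b) (raise a b g) = g"
  using grids_below[of g] by (auto simp: fun_eq_iff act_monomial[OF gridsI[OF raise_below]] raise_def)

text \<open>
  Up to sign, raising by \<open>(a, b)\<close> inverts the leading term of \<open>s\<close>, and the error has strictly smaller weight.
\<close>

lemma act_surj:
  assumes s: "s \<in> sint" "leads s (wt a b) (- mono2 a b)"
  shows "h \<in> below n \<Longrightarrow> \<exists>u\<in>below (n + wt a b). act s u = h"
proof (induction n arbitrary: h rule: less_induct)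
  case (less n)
  show ?case
  proof (cases "n = 0")
    case True
    then have "h = 0" using less.prems by (simp add: below_0_iff)
    then show ?thesis by (intro bexI[of _ 0]) (auto simp: act_def)
  next
    case False
    define u0 where "u0 = raise a b h"
    have h: "h \<in> grids" using less.prems by blast
    have u0: "u0 \<in> below (n + wt a b)"
      unfolding u0_def using less.prems by (rule raise_below)
    have "act s u0 - act (- mono2 a b) u0 \<in> below (n + wt a b - Suc (wt a b))"
      by (rule leads_below[OF s(2,1) _ u0]) auto
    moreover have "act (- mono2 a b) u0 = - h"
      using u0 h by (simp add: act_neg gridsI u0_def act_raise)
    ultimately have "act s u0 + h \<in> below (n - 1)" by simp
    moreover have "n - 1 < n" using False by simp
    ultimately obtain u1 where u1: "u1 \<in> below (n - 1 + wt a b)" "act s u1 = act s u0 + h"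
      using less.IH by blast
    have u1': "u1 \<in> below (n + wt a b)" using u1(1) by (rule below_mono) simp
    have "act s (u1 - u0) = h" using u1(2) u1' u0 by (simp add: act_diff gridsI)
    then show ?thesis using below_diff[OF u1' u0] by blast
  qed
qed

text \<open>
  If the leading term \<open>-x\<^sup>a y\<^sup>b\<close> of \<open>s\<close> kills \<open>g\<close>, then \<open>s g\<close> has smaller weight than the leading term
  alone would give. A preimage of \<open>s g\<close> under \<open>s\<close> can then be chosen below the weight of \<open>g\<close>, and
  subtracting it from \<open>g\<close> gives an element killed by \<open>s\<close>. This is the source of all cycles.
\<close>

lemma act_lift:
  assumes s: "s \<in> sint" "leads s (wt a b) (- mono2 a b)"
    and g: "g \<in> below (Suc n)" "\<And>i j. g (i + a) (j + b) = 0"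
  shows "\<exists>u. u - g \<in> below n \<and> act s u = 0"
proof -
  have gg: "g \<in> grids" using g by blast
  have "act s g - act (- mono2 a b) g \<in> below (Suc n - Suc (wt a b))"
    by (rule leads_below[OF s(2,1) _ g(1)]) auto
  moreover have "act (- mono2 a b) g = 0"
    using g(2) gg by (auto simp: act_neg act_monomial fun_eq_iff)
  ultimately have h: "act s g \<in> below (n - wt a b)" by simp
  show ?thesis
  proof (cases "wt a b \<le> n")
    case True
    obtain u where u: "u \<in> below n" "act s u = act s g"
      using act_surj[OF s h] True by auto
    have "act s (g - u) = 0" using u gg by (simp add: act_diff gridsI)
    moreover have "(g - u) - g \<in> below n" using below_uminus[OF u(1)] by simp
    ultimately show ?thesis by blast
  next
    case False
    then have "act s g = 0" using h by (simp add: below_0_iff)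
    then show ?thesis by (intro exI[of _ g]) simp
  qed
qed

text \<open>
  The elements that represent cycles: \<open>AX\<close> is the boundary operator, and the multiples of \<open>AY\<close> are
  the relations of the second tensor factor.
\<close>

definition kernel :: "grid set" where
  "kernel = {g \<in> grids. \<exists>t\<in>grids. act AX g = act AY t}"

lemma kernel_add: "g \<in> kernel \<Longrightarrow> h \<in> kernel \<Longrightarrow> g + h \<in> kernel"
proof -
  assume "g \<in> kernel" "h \<in> kernel"
  then obtain t u where "g \<in> grids" "h \<in> grids" "t \<in> grids" "u \<in> grids"
      "act AX g = act AY t" "act AX h = act AY u"
    unfolding kernel_def by blast
  then show ?thesis unfolding kernel_def
    by (auto simp: act_add intro!: bexI[of _ "t + u"])
qed

lemma kernel_AY: "t \<in> grids \<Longrightarrow> act AY t \<in> kernel"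
proof -
  assume t: "t \<in> grids"
  have "act AX (act AY t) = act AY (act AX t)"
    using t by (simp add: act_times[symmetric] mult.commute)
  then show ?thesis unfolding kernel_def using t by blast
qed

lemma AY_below:
  assumes "t \<in> below (Suc n)" "wt i j = n"
  shows "act AY t i j = of_nat p ^ 2 * t i j"
proof -
  have "act AY t - act (of_nat p ^ 2) t \<in> below (Suc n - Suc 0)"
    by (rule leads_below[OF leads_AY AY_sint _ assms(1)]) auto
  then have "(act AY t - act (of_nat p ^ 2) t) i j = 0"
    by (rule below_zero) (simp add: assms(2))
  moreover have "(of_nat p ^ 2 :: shifts) = of_nat (p ^ 2)" by simp
  ultimately show ?thesis
    using assms(1) by (simp add: act_of_nat gridsI scal_def del: of_nat_power)
qed

text \<open>
  To leading order \<open>AY\<close> multiplies by \<open>p\<^sup>2\<close>, which is injective, so no leading term is lost.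
\<close>

lemma AY_reflects_below:
  assumes "t \<in> grids" "act AY t \<in> below n"
  shows "t \<in> below n"
proof -
  have "t \<in> below N \<Longrightarrow> t \<in> below n" for N
  proof (induction N)
    case 0
    then show ?case by (rule below_mono) simp
  next
    case (Suc N)
    show ?case
    proof (cases "Suc N \<le> n")
      case True
      then show ?thesis using Suc.prems below_mono by blast
    next
      case False
      have "t i j = 0" if "wt i j = N" for i j
        using AY_below[OF Suc.prems that] below_zero[OF assms(2), of i j] that False p_gt_1 by simp
      then have "t - 0 \<in> below N" using Suc.prems by (intro below_Suc_diff) auto
      then show ?thesis using Suc.IH by simp
    qed
  qed
  then show ?thesis using assms(1) grids_below by blast
qed

text \<open>
  Polynomials in \<open>v\<close> whose coefficients lie in the set \<open>{0, \<dots>, p - 1}\<close> of representatives modulo \<open>p\<close>.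
\<close>

definition digit :: "rat poly \<Rightarrow> bool" where
  "digit c \<longleftrightarrow> (\<forall>n. \<exists>d::int. 0 \<le> d \<and> d < int p \<and> coeff c n = of_int d)"

lemma digit_0 [simp]: "digit 0"
  using p_gt_1 by (auto simp: digit_def intro!: exI[of _ 0])

lemma digit_zpoly: "digit c \<Longrightarrow> c \<in> zpoly"
proof -
  assume c: "digit c"
  have "coeff c n \<in> zloc" for n
  proof -
    obtain d :: int where "coeff c n = of_int d" using c unfolding digit_def by blast
    then show ?thesis by simp
  qed
  then show ?thesis by (simp add: zpoly_def)
qed

lemma digit_eq_0:
  assumes "digit c" "monom 1 k * c = of_nat p * e" "e \<in> zpoly"
  shows "c = 0"
proof (rule poly_eqI)
  fix n
  obtain d where d: "0 \<le> d" "d < int p" "coeff c n = of_int d" using assms(1) unfolding digit_def by blast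
  have "coeff (monom 1 k * c) (n + k) = coeff c n" by (simp add: coeff_monom_mult)
  moreover have "coeff (of_nat p * e) (n + k) = of_nat p * coeff e (n + k)"
    by (simp add: of_nat_poly)
  ultimately have "of_int d = of_nat p * coeff e (n + k)" using assms(2) d(3) by simp
  then have "d = 0" using zloc_digit_unique[OF d(1,2)] assms(3) by (auto simp: zpoly_def)
  then show "coeff c n = coeff 0 n" using d(3) by simp
qed

lemma digit_decomposition:
  "\<exists>dg qt. \<forall>c\<in>zpoly. digit (dg c) \<and> qt c \<in> zpoly \<and> c = dg c + of_nat p * qt c"
proof -
  have "\<forall>q. \<exists>d r. q \<in> zloc \<longrightarrow> 0 \<le> d \<and> d < int p \<and> r \<in> zloc \<and> q = of_int d + of_nat p * r"
    by (metis zloc_residue)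
  then obtain d r where dr: "\<And>q. q \<in> zloc \<Longrightarrow> 0 \<le> d q \<and> d q < int p \<and> r q \<in> zloc \<and> q = of_int (d q) + of_nat p * r q"
    by metis
  define dd where "dd q = (if q = 0 then 0 else of_int (d q) :: rat)" for q
  define rr where "rr q = (if q = 0 then 0 else r q)" for q
  have 0: "dd 0 = 0" "rr 0 = 0" by (auto simp: dd_def rr_def)
  have e: "q = dd q + of_nat p * rr q" "rr q \<in> zloc" if "q \<in> zloc" for q
    using dr[OF that] by (auto simp: dd_def rr_def)
  have dg: "\<exists>k::int. 0 \<le> k \<and> k < int p \<and> dd q = of_int k" if "q \<in> zloc" for q
    using dr[OF that] p_gt_1 by (cases "q = 0") (auto simp: dd_def intro: exI[of _ 0])
  show ?thesis
  proof (rule exI[of _ "map_poly dd"], rule exI[of _ "map_poly rr"], intro ballI conjI)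
    fix c assume c: "c \<in> zpoly"
    show "digit (map_poly dd c)"
      using dg c unfolding digit_def by (auto simp: coeff_map_poly 0 zpoly_def)
    show "map_poly rr c \<in> zpoly"
      using e c by (auto simp: coeff_map_poly 0 zpoly_def)
    show "c = map_poly dd c + of_nat p * map_poly rr c"
    proof (rule poly_eqI)
      fix n
      have "coeff c n \<in> zloc" using c by (simp add: zpoly_def)
      from e(1)[OF this] show "coeff c n = coeff (map_poly dd c + of_nat p * map_poly rr c) n"
        by (simp add: coeff_map_poly 0 of_nat_poly)
    qed
  qed
qed

text \<open>
  The multiple of the generator at \<open>(i, j)\<close> that is the leading term of a cycle. The last value
  is \<open>p\<^sup>2\<close>, which stands for no leading term at all: \<open>p\<^sup>2\<close> times a generator is congruent to terms of
  lower filtration.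
\<close>

definition kernel_multiple :: "nat \<Rightarrow> nat \<Rightarrow> nat" where
  "kernel_multiple i j =
     (if j < p - 1 then 1 else if i < p - 1 \<or> j < p\<^sup>2 - 1 then p else p\<^sup>2)"

text \<open>
  The ideal \<open>(p\<^sup>2, p v\<^sup>p\<^sup>-\<^sup>1, v\<^bsup>(p-1)(p+2)\<^esup>)\<close>; note that \<open>g\<^sub>1 + g\<^sub>2 = (p - 1)(p + 2)\<close>.
\<close>

definition image_ideal :: "rat poly set" where
  "image_ideal = {of_nat p ^ 2 * a + of_nat p * vpow (p - 1) * b + vpow ((p - 1) * (p + 2)) * c | a b c.
     a \<in> zpoly \<and> b \<in> zpoly \<and> c \<in> zpoly}"

text \<open>
  Modulo \<open>p\<close> the equation says that \<open>b\<close> vanishes, and after division by \<open>p\<close> that \<open>a\<close> vanishes. Hence the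
  leading terms \<open>p v\<^sup>k a\<close> and \<open>v\<^sup>l b\<close> that boundaries have at one position cannot cancel modulo \<open>p\<^sup>2\<close>.
\<close>

lemma digits_independent:
  assumes "digit a" "digit b" "e \<in> zpoly"
    "of_nat p * vpow k * a + vpow l * b = of_nat p ^ 2 * e"
  shows "a = 0 \<and> b = 0"
proof -
  have az: "a \<in> zpoly" using assms(1) by (rule digit_zpoly)
  have "vpow l * b = of_nat p * (of_nat p * e - vpow k * a)"
    using assms(4) by (simp add: algebra_simps power2_eq_square)
  moreover have "of_nat p * e - vpow k * a \<in> zpoly"
    using assms az by (intro zpoly_diff zpoly_mult zpoly_of_nat zpoly_monom zloc_1)
  ultimately have b: "b = 0" using assms(2) digit_eq_0 by blast
  have "of_nat p * (vpow k * a) = of_nat p * (of_nat p * e)"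
    using assms(4) b by (simp add: algebra_simps power2_eq_square)
  then have "vpow k * a = of_nat p * e" using p_gt_1 by simp
  then show ?thesis using digit_eq_0[OF assms(1) _ assms(3)] b by blast
qed

end

text \<open>
  A choice of the reduction operators, fixed while leading terms are computed.
\<close>

locale reduction = prime_number +
  fixes nu m D E L G r r' :: shifts
  assumes sints: "nu \<in> sint" "m \<in> sint" "D \<in> sint" "E \<in> sint" "L \<in> sint" "G \<in> sint"
      "r \<in> sint" "r' \<in> sint"
    and nu_AX: "nu * AX = cst (vpow (p - 1)) * D + r * AY"
    and m_nu_AX: "m * nu * AX = cst (vpow ((p - 1) * (p + 2))) * E + r' * AY"
    and D_factor: "D = G * L"
    and leads_nu: "leads nu 0 1" and leads_m: "leads m 0 (of_nat p)"
    and leads_L: "leads L (wt 0 (p - 1)) (- mono2 0 (p - 1))"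
    and leads_D: "leads D (wt 0 (p - 1)) (- (of_nat p * mono2 0 (p - 1)))"
    and leads_E: "leads E (wt (p - 1) (p\<^sup>2 - 1)) (- mono2 (p - 1) (p\<^sup>2 - 1))"
begin

declare sints [simp, intro]

abbreviation "mn \<equiv> m * nu"

lemma mn_sint [simp, intro]: "mn \<in> sint" by auto

lemma leads_mn: "leads mn 0 (of_nat p)"
  using leads_mult[OF leads_m leads_nu] by simp

lemma mn_below: "g \<in> below (Suc n) \<Longrightarrow> act mn g - scal (of_nat p) g \<in> below n"
  using leads_below[OF leads_mn mn_sint sint_of_nat, of g "Suc n"] by (simp only: act_of_nat gridsI diff_Suc_Suc diff_zero)

lemma nu_below: "g \<in> below (Suc n) \<Longrightarrow> act nu g - g \<in> below n"
  using leads_one_below[OF leads_nu] by simp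

lemma act_AX_nu:
  assumes "g \<in> grids"
  shows "act AX (act nu g) = scal (vpow (p - 1)) (act D g) + act AY (act r g)"
proof -
  have "act AX (act nu g) = act (cst (vpow (p - 1)) * D + r * AY) g"
    unfolding nu_AX[symmetric] using assms by (simp only: act_times[symmetric] mult.commute)
  also have "\<dots> = act (cst (vpow (p - 1)) * D) g + act (AY * r) g"
    using assms by (simp only: act_plus mult.commute)
  also have "\<dots> = scal (vpow (p - 1)) (act D g) + act AY (act r g)"
    using assms sints by (simp only: act_times act_cst act_grids)
  finally show ?thesis .
qed

lemma act_AX_mn:
  assumes "g \<in> grids"
  shows "act AX (act mn g) = scal (vpow ((p - 1) * (p + 2))) (act E g) + act AY (act r' g)"
proof -
  have "act AX (act mn g) = act (cst (vpow ((p - 1) * (p + 2))) * E + r' * AY) g"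
    unfolding m_nu_AX[symmetric] using assms by (simp only: act_times[symmetric] mult.commute)
  also have "\<dots> = act (cst (vpow ((p - 1) * (p + 2))) * E) g + act (AY * r') g"
    using assms by (simp only: act_plus mult.commute)
  also have "\<dots> = scal (vpow ((p - 1) * (p + 2))) (act E g) + act AY (act r' g)"
    using assms sints by (simp only: act_times act_cst act_grids)
  finally show ?thesis .
qed

lemma scal_zero: "scal c 0 = 0"
  by (simp add: scal_def fun_eq_iff)

text \<open>
  Since \<open>D\<close> is a multiple of \<open>L\<close>, anything killed by \<open>L\<close> gives a cycle after multiplication by
  the unit \<open>nu\<close>, and the leading term of \<open>L\<close> is \<open>-y\<^sup>p\<^sup>-\<^sup>1\<close>.
\<close>

lemma kernel_lead_1:
  assumes g: "g \<in> below (Suc n)" "\<And>i j. g i (j + (p - 1)) = 0"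
  shows "\<exists>k\<in>kernel. k - g \<in> below n"
proof -
  obtain u where u: "u - g \<in> below n" "act L u = 0"
    using act_lift[OF _ leads_L g(1)] g(2) by auto
  have ub: "u \<in> below (Suc n)"
    using below_add[OF below_mono[OF u(1), of "Suc n"] g(1)] by simp
  have ug: "u \<in> grids" using ub by (rule gridsI)
  have "act D u = act G (act L u)" unfolding D_factor using ug by (rule act_times)
  also have "\<dots> = 0" unfolding u(2) by (simp add: act_def fun_eq_iff)
  finally have "act AX (act nu u) = act AY (act r u)"
    using act_AX_nu[OF ug] by (simp add: scal_zero)
  then have "act nu u \<in> kernel" unfolding kernel_def using ug by blast
  moreover have "(act nu u - u) + (u - g) \<in> below n"
    using nu_below[OF ub] u(1) by (rule below_add)
  then have "act nu u - g \<in> below n" by simp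
  ultimately show ?thesis by blast
qed

text \<open>
  Anything killed by \<open>E\<close> gives a cycle after multiplication by \<open>m nu\<close>, that is, by \<open>p\<close> to leading
  order.
\<close>

lemma kernel_lead_p:
  assumes g: "g \<in> below (Suc n)" "\<And>i j. g (i + (p - 1)) (j + (p\<^sup>2 - 1)) = 0"
  shows "\<exists>k\<in>kernel. k - scal (of_nat p) g \<in> below n"
proof -
  obtain u where u: "u - g \<in> below n" "act E u = 0"
    using act_lift[OF _ leads_E g(1)] g(2) by auto
  have ub: "u \<in> below (Suc n)"
    using below_add[OF below_mono[OF u(1), of "Suc n"] g(1)] by simp
  have ug: "u \<in> grids" using ub by (rule gridsI)
  have "act AX (act mn u) = act AY (act r' u)"
    using act_AX_mn[OF ug] u(2) by (simp add: scal_zero)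
  then have "act mn u \<in> kernel" unfolding kernel_def using ug by blast
  moreover have "(act mn u - scal (of_nat p) u) + scal (of_nat p) (u - g) \<in> below n"
    using mn_below[OF ub] u(1) by (intro below_add below_scal) auto
  then have "act mn u - scal (of_nat p) g \<in> below n"
    by (simp add: scal_def fun_eq_iff algebra_simps plus_fun_def fun_diff_def)
  ultimately show ?thesis by blast
qed

lemma kernel_realize:
  assumes g: "g \<in> below (Suc n)"
    and top: "\<And>i j. wt i j = n \<Longrightarrow> \<exists>c\<in>zpoly. g i j = of_nat (kernel_multiple i j) * c"
  shows "\<exists>k\<in>kernel. g - k \<in> below n"
proof -
  obtain c where c: "\<And>i j. wt i j = n \<Longrightarrow> c i j \<in> zpoly \<and> g i j = of_nat (kernel_multiple i j) * c i j"
    using top by metis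
  define A where "A i j \<longleftrightarrow> j < p - 1" for i j :: nat
  define B where "B i j \<longleftrightarrow> \<not> j < p - 1 \<and> (i < p - 1 \<or> j < p\<^sup>2 - 1)" for i j
  define C where "C i j \<longleftrightarrow> \<not> j < p - 1 \<and> \<not> (i < p - 1 \<or> j < p\<^sup>2 - 1)" for i j
  note defs = A_def B_def C_def
  define on where "on I i j = (if wt i j = n \<and> I i j then c i j else 0)" for I i j
  have onb: "on I \<in> below (Suc n)" for I
    using c by (auto simp: on_def intro!: belowI)
  obtain k1 where k1: "k1 \<in> kernel" "k1 - on A \<in> below n"
    using kernel_lead_1[OF onb[of A]] by (auto simp: on_def defs)
  obtain k2 where k2: "k2 \<in> kernel" "k2 - scal (of_nat p) (on B) \<in> below n"
    using kernel_lead_p[OF onb[of B]] by (auto simp: on_def defs)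
  define k3 where "k3 = act AY (on C)"
  have k3: "k3 \<in> kernel" unfolding k3_def using onb by (blast intro: kernel_AY)
  have k3b: "k3 - scal (of_nat p ^ 2) (on C) \<in> below n"
  proof (rule below_Suc_diff)
    show "k3 \<in> below (Suc n)" unfolding k3_def using onb by (intro act_below0) auto
    show "scal (of_nat p ^ 2) (on C) \<in> below (Suc n)" using onb by (intro below_scal) auto
    fix i j assume "wt i j = n"
    then show "k3 i j = scal (of_nat p ^ 2) (on C) i j"
      unfolding k3_def scal_def by (rule AY_below[OF onb])
  qed
  define h where "h = on A + scal (of_nat p) (on B) + scal (of_nat p ^ 2) (on C)"
  have "g - h \<in> below n"
  proof (rule below_Suc_diff[OF g])
    show "h \<in> below (Suc n)" unfolding h_def using onb by (intro below_add below_scal) auto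
    fix i j assume ij: "wt i j = n"
    then show "g i j = h i j"
      using c[OF ij] by (auto simp: h_def on_def defs scal_def kernel_multiple_def)
  qed
  moreover have "h - (k1 + k2 + k3) = - ((k1 - on A) + (k2 - scal (of_nat p) (on B)) + (k3 - scal (of_nat p ^ 2) (on C)))"
    unfolding h_def by (simp add: algebra_simps)
  then have "h - (k1 + k2 + k3) \<in> below n"
    using k1 k2 k3b by (simp only: below_uminus below_add)
  ultimately have "(g - h) + (h - (k1 + k2 + k3)) \<in> below n" by (rule below_add)
  moreover have "(g - h) + (h - (k1 + k2 + k3)) = g - (k1 + k2 + k3)" by (simp only: diff_add_cancel add_diff_eq)
  ultimately have "g - (k1 + k2 + k3) \<in> below n" by (simp only:)
  moreover have "k1 + k2 + k3 \<in> kernel" using k1 k2 k3 by (auto intro: kernel_add)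
  ultimately show ?thesis by blast
qed

text \<open>
  The positions at which generators have boundaries with leading term \<open>-p v\<^sup>p\<^sup>-\<^sup>1[i, j - p + 1]\<close>, and
  those at which \<open>p\<close> times the generator has a boundary with leading term
  \<open>-v\<^bsup>(p-1)(p+2)\<^esup>[i - p + 1, j - p\<^sup>2 + 1]\<close>.
\<close>

definition nu_index :: "nat \<Rightarrow> nat \<Rightarrow> bool" where
  "nu_index i j \<longleftrightarrow> p - 1 \<le> j"

definition mn_index :: "nat \<Rightarrow> nat \<Rightarrow> bool" where
  "mn_index i j \<longleftrightarrow> p - 1 \<le> i \<and> p\<^sup>2 - 1 \<le> j"

definition digits_on :: "(nat \<Rightarrow> nat \<Rightarrow> bool) \<Rightarrow> grid \<Rightarrow> bool" where
  "digits_on I g \<longleftrightarrow> (\<forall>i j. digit (g i j) \<and> (\<not> I i j \<longrightarrow> g i j = 0))"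

lemma digits_on_add:
  assumes "digits_on I g" "digits_on I h" "h \<in> below n" "\<And>i j. wt i j < n \<Longrightarrow> g i j = 0"
  shows "digits_on I (g + h)"
  unfolding digits_on_def
proof (intro allI)
  fix i j
  have "g i j = 0 \<or> h i j = 0"
    using assms(4)[of i j] below_zero[OF assms(3), of i j] by (cases "wt i j < n") auto
  then show "digit ((g + h) i j) \<and> (\<not> I i j \<longrightarrow> (g + h) i j = 0)"
    using assms(1,2) unfolding digits_on_def by auto
qed

text \<open>
  At each position the coefficient is reduced modulo the multiples that lead cycles; the
  remaining digits are put into \<open>s\<close> and \<open>s'\<close>. This works from the top weight downwards, and
  the difference between \<open>act nu s\<close>, \<open>act mn s'\<close> and \<open>s\<close>, \<open>p s'\<close> is left to lower weights.
\<close>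

lemma decomposition:
  "g \<in> below n \<Longrightarrow> \<exists>k s s'. k \<in> kernel \<and> k \<in> below n \<and> s \<in> below n \<and> s' \<in> below n \<and>
     digits_on nu_index s \<and> digits_on mn_index s' \<and> g = k + act nu s + act mn s' \<and>
     (\<forall>i j. Suc (wt i j) = n \<longrightarrow> (\<exists>c\<in>zpoly. k i j = of_nat (kernel_multiple i j) * c))"
proof (induction n arbitrary: g)
  case 0
  then have "g = 0" by (simp add: below_0_iff)
  moreover have "act s 0 = 0" for s by (simp add: act_def fun_eq_iff)
  moreover have "0 \<in> kernel" using kernel_AY[of 0] \<open>\<And>s. act s 0 = 0\<close> by simp
  moreover have "digits_on I 0" for I by (simp add: digits_on_def)
  ultimately have "(0::grid) \<in> kernel \<and> (0::grid) \<in> below 0 \<and> (0::grid) \<in> below 0 \<and> (0::grid) \<in> below 0 \<and>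
     digits_on nu_index 0 \<and> digits_on mn_index 0 \<and> g = 0 + act nu 0 + act mn 0" by simp
  then show ?case by blast
next
  case (Suc n)
  obtain dg qt where dq:
    "\<And>c. c \<in> zpoly \<Longrightarrow> digit (dg c) \<and> qt c \<in> zpoly \<and> c = dg c + of_nat p * qt c"
    using digit_decomposition by blast
  have dgz: "dg c \<in> zpoly" if "c \<in> zpoly" for c using dq[OF that] digit_zpoly by blast
  note gz = below_zpoly[OF Suc.prems]
  define s0 where "s0 i j = (if wt i j = n \<and> nu_index i j then dg (g i j) else 0)" for i j
  define s0' where "s0' i j = (if wt i j = n \<and> mn_index i j then dg (qt (g i j)) else 0)" for i j
  \<comment> \<open>Without the digits at the top weight, only multiples that lead cycles remain there.\<close>
  define x where "x = g - s0 - scal (of_nat p) s0'"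
  have sb: "s0 \<in> below (Suc n)" "s0' \<in> below (Suc n)"
    using gz dq dgz by (auto simp: s0_def s0'_def intro!: belowI)
  have xb: "x \<in> below (Suc n)"
    unfolding x_def using Suc.prems sb by (intro below_diff below_scal zpoly_of_nat)
  have x_top: "\<exists>c\<in>zpoly. x i j = of_nat (kernel_multiple i j) * c" if top: "wt i j = n" for i j
  proof -
    have e1: "g i j - dg (g i j) = of_nat p * qt (g i j)"
      and e2: "qt (g i j) - dg (qt (g i j)) = of_nat p * qt (qt (g i j))"
      and z: "qt (g i j) \<in> zpoly" "qt (qt (g i j)) \<in> zpoly"
      using dq[OF gz[of i j]] dq[of "qt (g i j)"] by (metis add_diff_cancel_left')+
    have xij: "x i j = g i j - s0 i j - of_nat p * s0' i j" by (simp add: x_def scal_def)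
    consider "j < p - 1" | "\<not> j < p - 1" "i < p - 1 \<or> j < p\<^sup>2 - 1"
      | "\<not> j < p - 1" "\<not> (i < p - 1 \<or> j < p\<^sup>2 - 1)" by blast
    then show ?thesis
    proof cases
      case 1
      then show ?thesis using below_zpoly[OF xb] by (simp add: kernel_multiple_def)
    next
      case 2
      then have "x i j = of_nat p * qt (g i j)"
        unfolding xij using e1 top by (auto simp: s0_def s0'_def nu_index_def mn_index_def)
      then show ?thesis using 2 z by (auto simp: kernel_multiple_def)
    next
      case 3
      then have "x i j = of_nat p * (qt (g i j) - dg (qt (g i j)))"
        unfolding xij right_diff_distrib e1[symmetric] using top
        by (simp add: s0_def s0'_def nu_index_def mn_index_def)
      then show ?thesis using 3 z unfolding e2 by (auto simp: kernel_multiple_def power2_eq_square mult.assoc)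
    qed
  qed
  obtain k0 where k0: "k0 \<in> kernel" "x - k0 \<in> below n" using kernel_realize[OF xb x_top] by blast
  have k0b: "k0 \<in> below (Suc n)"
    using below_diff[OF xb below_mono[OF k0(2) le_SucI[OF le_refl]]] by simp
  define rest where "rest = k0 + act nu s0 + act mn s0'"
  have "g - rest = (x - k0) - (act nu s0 - s0) - (act mn s0' - scal (of_nat p) s0')"
    unfolding rest_def x_def by (simp add: algebra_simps)
  also have "\<dots> \<in> below n"
    by (rule below_diff[OF below_diff[OF k0(2) nu_below[OF sb(1)]] mn_below[OF sb(2)]])
  finally obtain k s s' where IH: "k \<in> kernel" "k \<in> below n" "s \<in> below n" "s' \<in> below n"
     "digits_on nu_index s" "digits_on mn_index s'" "g - rest = k + act nu s + act mn s'"
    using Suc.IH by blast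
  have s0_0: "s0 i j = 0" "s0' i j = 0" if "wt i j < n" for i j
    using that by (auto simp: s0_def s0'_def)
  have dig0: "digits_on nu_index s0" "digits_on mn_index s0'"
    using dq gz by (auto simp: digits_on_def s0_def s0'_def)
  show ?case
  proof (rule exI[of _ "k0 + k"], rule exI[of _ "s0 + s"], rule exI[of _ "s0' + s'"], intro conjI allI impI)
    show "k0 + k \<in> kernel" using k0(1) IH(1) by (rule kernel_add)
    show "k0 + k \<in> below (Suc n)" using k0b below_mono[OF IH(2), of "Suc n"] by auto
    show "s0 + s \<in> below (Suc n)" using sb below_mono[OF IH(3), of "Suc n"] by auto
    show "s0' + s' \<in> below (Suc n)" using sb below_mono[OF IH(4), of "Suc n"] by auto
    show "digits_on nu_index (s0 + s)" using dig0(1) IH(5,3) s0_0(1) by (rule digits_on_add)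
    show "digits_on mn_index (s0' + s')" using dig0(2) IH(6,4) s0_0(2) by (rule digits_on_add)
    have "g = (k + act nu s + act mn s') + rest" using IH(7) by (metis diff_add_cancel)
    also have "\<dots> = k0 + k + (act nu s0 + act nu s) + (act mn s0' + act mn s')"
      unfolding rest_def by (simp add: algebra_simps)
    also have "\<dots> = k0 + k + act nu (s0 + s) + act mn (s0' + s')"
      using sb IH by (simp only: act_add gridsI)
    finally show "g = k0 + k + act nu (s0 + s) + act mn (s0' + s')" .
    fix i j assume "Suc (wt i j) = Suc n"
    then have top: "wt i j = n" by simp
    have "(k0 + k) i j = x i j"
      using below_zero[OF IH(2), of i j] below_zero[OF k0(2), of i j] top by simp
    then show "\<exists>c\<in>zpoly. (k0 + k) i j = of_nat (kernel_multiple i j) * c" using x_top[OF top] by simp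
  qed
qed

text \<open>
  Modulo relations this is the boundary of \<open>act nu s + act mn s'\<close>.
\<close>

definition boundary_form :: "grid \<Rightarrow> grid \<Rightarrow> grid \<Rightarrow> grid" where
  "boundary_form s s' t = scal (vpow (p - 1)) (act D s) + scal (vpow ((p - 1) * (p + 2))) (act E s') + act AY t"

lemma boundary_form_top:
  assumes s: "s \<in> below (Suc N + wt 0 (p - 1))" and s': "s' \<in> below (Suc N + wt (p - 1) (p\<^sup>2 - 1))"
    and t: "t \<in> below (Suc N)" and N: "wt i j = N"
  shows "boundary_form s s' t i j = of_nat p ^ 2 * t i j -
     (of_nat p * vpow (p - 1) * s i (j + (p - 1)) +
      vpow ((p - 1) * (p + 2)) * s' (i + (p - 1)) (j + (p\<^sup>2 - 1)))"
proof -
  have "act D s - act (- (of_nat p * mono2 0 (p - 1))) s \<in> below (Suc N + wt 0 (p - 1) - Suc (wt 0 (p - 1)))"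
    by (rule leads_below[OF leads_D _ _ s]) auto
  then have "act D s i j = act (- (of_nat p * mono2 0 (p - 1))) s i j"
    using below_zero[of _ N i j] N by fastforce
  also have "\<dots> = - (of_nat p * s i (j + (p - 1)))"
    using s by (simp add: act_neg act_times act_of_nat act_grids gridsI scal_def act_monomial)
  finally have 1: "act D s i j = - (of_nat p * s i (j + (p - 1)))" .
  have "act E s' - act (- mono2 (p - 1) (p\<^sup>2 - 1)) s' \<in>
      below (Suc N + wt (p - 1) (p\<^sup>2 - 1) - Suc (wt (p - 1) (p\<^sup>2 - 1)))"
    by (rule leads_below[OF leads_E _ _ s']) auto
  then have "act E s' i j = act (- mono2 (p - 1) (p\<^sup>2 - 1)) s' i j"
    using below_zero[of _ N i j] N by fastforce
  also have "\<dots> = - s' (i + (p - 1)) (j + (p\<^sup>2 - 1))"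
    using s' by (simp add: act_neg gridsI act_monomial)
  finally have 2: "act E s' i j = - s' (i + (p - 1)) (j + (p\<^sup>2 - 1))" .
  show ?thesis
    unfolding boundary_form_def by (simp add: scal_def 1 2 AY_below[OF t N])
qed

lemma boundary_form_below:
  assumes s: "s \<in> below (N + wt 0 (p - 1))" and s': "s' \<in> below (N + wt (p - 1) (p\<^sup>2 - 1))"
    and t: "t \<in> grids" and Y: "boundary_form s s' t \<in> below N"
  shows "t \<in> below N"
proof -
  have D: "act D s \<in> below N"
    using act_below[of D "wt 0 (p - 1)", OF _ _ s] leads_D by (simp add: leads_def)
  have E: "act E s' \<in> below N"
    using act_below[of E "wt (p - 1) (p\<^sup>2 - 1)", OF _ _ s'] leads_E by (simp add: leads_def)
  have "act AY t = boundary_form s s' t -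
      (scal (vpow (p - 1)) (act D s) + scal (vpow ((p - 1) * (p + 2))) (act E s'))"
    unfolding boundary_form_def by (simp add: algebra_simps)
  also have "\<dots> \<in> below N"
    using D E Y by (intro below_diff below_add below_scal zpoly_monom zloc_1)
  finally show ?thesis using t AY_reflects_below by blast
qed

text \<open>
  Different positions of \<open>s\<close> and \<open>s'\<close> have boundaries with independent leading terms. If the
  sum lies below weight \<open>M\<close>, then so do all these leading terms, because the digits at the top
  weight would otherwise satisfy the equation that forces them to vanish.
\<close>

lemma boundary_form_descent:
  assumes dig: "digits_on nu_index s" "digits_on mn_index s'" and t: "t \<in> grids"
    and Y: "boundary_form s s' t \<in> below M"
  shows "s \<in> below (N + wt 0 (p - 1)) \<Longrightarrow> s' \<in> below (N + wt (p - 1) (p\<^sup>2 - 1)) \<Longrightarrow> M \<le> N \<Longrightarrow>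
     s \<in> below (M + wt 0 (p - 1)) \<and> s' \<in> below (M + wt (p - 1) (p\<^sup>2 - 1))"
proof (induction N)
  case 0
  then show ?case by simp
next
  case (Suc N)
  show ?case
  proof (cases "M = Suc N")
    case True
    then show ?thesis using Suc.prems by simp
  next
    case False
    then have MN: "M \<le> N" using Suc.prems by simp
    have tb: "t \<in> below (Suc N)"
      using boundary_form_below[OF Suc.prems(1,2) t below_mono[OF Y]] MN by simp
    have zero: "s i (j + (p - 1)) = 0 \<and> s' (i + (p - 1)) (j + (p\<^sup>2 - 1)) = 0" if N: "wt i j = N" for i j
    proof (rule digits_independent)
      show "digit (s i (j + (p - 1)))" "digit (s' (i + (p - 1)) (j + (p\<^sup>2 - 1)))"
        using dig by (auto simp: digits_on_def)
      show "t i j \<in> zpoly" using tb by (rule below_zpoly)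
      have "boundary_form s s' t i j = 0" using below_zero[OF Y, of i j] N MN by simp
      then show "of_nat p * vpow (p - 1) * s i (j + (p - 1)) +
         vpow ((p - 1) * (p + 2)) * s' (i + (p - 1)) (j + (p\<^sup>2 - 1)) = of_nat p ^ 2 * t i j"
        using boundary_form_top[OF Suc.prems(1,2) tb N] by simp
    qed
    have "s \<in> below (N + wt 0 (p - 1))"
    proof (rule belowI)
      fix i j assume le: "N + wt 0 (p - 1) \<le> wt i j"
      show "s i j = 0"
      proof (cases "nu_index i j")
        case True
        then have w: "wt i j = wt i (j - (p - 1)) + wt 0 (p - 1)"
          using wt_add[of i 0 "j - (p - 1)" "p - 1"] by (simp add: nu_index_def)
        show ?thesis
        proof (cases "wt i (j - (p - 1)) = N")
          case True
          then show ?thesis using zero[of i "j - (p - 1)"] \<open>nu_index i j\<close> by (simp add: nu_index_def)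
        next
          case False
          then show ?thesis using below_zero[OF Suc.prems(1), of i j] le w by simp
        qed
      qed (use dig(1) in \<open>simp add: digits_on_def\<close>)
    qed (use Suc.prems(1) below_zpoly in blast)
    moreover have "s' \<in> below (N + wt (p - 1) (p\<^sup>2 - 1))"
    proof (rule belowI)
      fix i j assume le: "N + wt (p - 1) (p\<^sup>2 - 1) \<le> wt i j"
      show "s' i j = 0"
      proof (cases "mn_index i j")
        case True
        then have w: "wt i j = wt (i - (p - 1)) (j - (p\<^sup>2 - 1)) + wt (p - 1) (p\<^sup>2 - 1)"
          using wt_add[of "i - (p - 1)" "p - 1" "j - (p\<^sup>2 - 1)" "p\<^sup>2 - 1"] by (simp add: mn_index_def)
        show ?thesis
        proof (cases "wt (i - (p - 1)) (j - (p\<^sup>2 - 1)) = N")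
          case True
          then show ?thesis
            using zero[of "i - (p - 1)" "j - (p\<^sup>2 - 1)"] \<open>mn_index i j\<close> by (simp add: mn_index_def)
        next
          case False
          then show ?thesis using below_zero[OF Suc.prems(2), of i j] le w by simp
        qed
      qed (use dig(2) in \<open>simp add: digits_on_def\<close>)
    qed (use Suc.prems(2) below_zpoly in blast)
    ultimately show ?thesis using Suc.IH MN by blast
  qed
qed

lemma boundary_form_bounds:
  assumes dig: "digits_on nu_index s" "digits_on mn_index s'" and s: "s \<in> grids" "s' \<in> grids" "t \<in> grids"
    and Y: "boundary_form s s' t \<in> below M"
  shows "s \<in> below (M + wt 0 (p - 1)) \<and> s' \<in> below (M + wt (p - 1) (p\<^sup>2 - 1)) \<and> t \<in> below M"
proof -
  obtain N where N: "s \<in> below N" "s' \<in> below N" using grids_below2[OF s(1,2)] by blast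
  define N' where "N' = max M N"
  have "s \<in> below (N' + wt 0 (p - 1))" "s' \<in> below (N' + wt (p - 1) (p\<^sup>2 - 1))" "M \<le> N'"
    using N below_mono by (auto simp: N'_def elim!: below_mono)
  from boundary_form_descent[OF dig s(3) Y this] have
    "s \<in> below (M + wt 0 (p - 1))" "s' \<in> below (M + wt (p - 1) (p\<^sup>2 - 1))" by auto
  then show ?thesis using boundary_form_below[OF _ _ s(3) Y] by blast
qed

lemma act_AX_decomposed:
  assumes "k \<in> kernel" "s \<in> grids" "s' \<in> grids"
  shows "\<exists>t\<in>grids. act AX (k + act nu s + act mn s') = boundary_form s s' t"
proof -
  obtain t where t: "k \<in> grids" "t \<in> grids" "act AX k = act AY t"
    using assms(1) unfolding kernel_def by blast
  have g: "act nu s \<in> grids" "act mn s' \<in> grids" "act r s \<in> grids" "act r' s' \<in> grids"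
    using assms by auto
  have "act AX (k + act nu s + act mn s') = act AX k + act AX (act nu s) + act AX (act mn s')"
    using t g by (simp only: act_add grids_add)
  also have "\<dots> = boundary_form s s' (t + act r s + act r' s')"
    unfolding t(3) act_AX_nu[OF assms(2)] act_AX_mn[OF assms(3)] boundary_form_def
    using t g by (simp only: act_add grids_add) (simp add: algebra_simps)
  finally show ?thesis using t g by blast
qed

text \<open>
  Decompose \<open>f\<close>. Its cycle part contributes only relations, and by the descent the remaining
  parts are so small that the leading term of the boundary is the sum of their leading terms.
\<close>

lemma image_top:
  assumes f: "f \<in> grids" "t \<in> grids" and g: "act AX f + act AY t \<in> below (Suc n)" and n: "wt i j = n"
  shows "(act AX f + act AY t) i j \<in> image_ideal"
proof -
  obtain N where "f \<in> below N" using f grids_below by blast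
  from decomposition[OF this] obtain k s s' where d: "k \<in> kernel" "s \<in> below N" "s' \<in> below N"
     "digits_on nu_index s" "digits_on mn_index s'" "f = k + act nu s + act mn s'" by blast
  have sg: "s \<in> grids" "s' \<in> grids" using d by auto
  obtain t0 where t0: "t0 \<in> grids" "act AX f = boundary_form s s' t0"
    using act_AX_decomposed[OF d(1) sg] d(6) by blast
  define t1 where "t1 = t0 + t"
  have t1: "t1 \<in> grids" unfolding t1_def using t0 f by blast
  have e: "act AX f + act AY t = boundary_form s s' t1"
    unfolding t0(2) boundary_form_def t1_def using t0 f by (simp add: act_add add.assoc)
  have b: "s \<in> below (Suc n + wt 0 (p - 1))" "s' \<in> below (Suc n + wt (p - 1) (p\<^sup>2 - 1))" "t1 \<in> below (Suc n)"
    using boundary_form_bounds[OF d(4,5) sg t1 g[unfolded e]] by blast+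
  have "boundary_form s s' t1 i j = of_nat p ^ 2 * t1 i j +
     of_nat p * vpow (p - 1) * (- s i (j + (p - 1))) +
      vpow ((p - 1) * (p + 2)) * (- s' (i + (p - 1)) (j + (p\<^sup>2 - 1)))"
    unfolding boundary_form_top[OF b n] by (simp add: algebra_simps)
  moreover have "t1 i j \<in> zpoly" "- s i (j + (p - 1)) \<in> zpoly" "- s' (i + (p - 1)) (j + (p\<^sup>2 - 1)) \<in> zpoly"
    using b by (blast intro: zpoly_uminus below_zpoly)+
  ultimately show ?thesis unfolding e image_ideal_def by blast
qed

text \<open>
  For a cycle, the parts \<open>s\<close> and \<open>s'\<close> of the decomposition have vanishing boundary, so the descent
  continues until both are zero. Only the part with known leading terms is left.
\<close>

lemma kernel_top:
  assumes k: "k \<in> kernel" "k \<in> below (Suc n)" and n: "wt i j = n"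
  shows "\<exists>c\<in>zpoly. k i j = of_nat (kernel_multiple i j) * c"
proof -
  from decomposition[OF k(2)] obtain k' s s' where d: "k' \<in> kernel" "s \<in> below (Suc n)" "s' \<in> below (Suc n)"
     "digits_on nu_index s" "digits_on mn_index s'" "k = k' + act nu s + act mn s'"
     and top: "\<forall>i j. Suc (wt i j) = Suc n \<longrightarrow> (\<exists>c\<in>zpoly. k' i j = of_nat (kernel_multiple i j) * c)"
    by blast
  have sg: "s \<in> grids" "s' \<in> grids" using d by auto
  obtain t0 where t0: "t0 \<in> grids" "act AX k = boundary_form s s' t0"
    using act_AX_decomposed[OF d(1) sg] d(6) by blast
  obtain t where t: "t \<in> grids" "act AX k = act AY t" using k unfolding kernel_def by blast
  define t1 where "t1 = t0 - t"
  have t1: "t1 \<in> grids" unfolding t1_def using t0 t by blast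
  have "boundary_form s s' t1 = boundary_form s s' t0 - act AY t"
    unfolding boundary_form_def t1_def using t0 t by (simp add: act_diff)
  also have "\<dots> = 0" using t0 t by simp
  finally have Y: "boundary_form s s' t1 \<in> below 0" by (simp add: below_0_iff)
  have b: "s \<in> below (0 + wt 0 (p - 1))" "s' \<in> below (0 + wt (p - 1) (p\<^sup>2 - 1))"
    using boundary_form_bounds[OF d(4,5) sg t1 Y] by auto
  have "s = 0"
  proof (intro ext)
    fix i j
    show "s i j = 0 i j"
      using d(4) below_zero[OF b(1), of i j] wt_add[of i 0 "j - (p - 1)" "p - 1"]
      by (cases "nu_index i j") (auto simp: digits_on_def nu_index_def)
  qed
  moreover have "s' = 0"
  proof (intro ext)
    fix i j
    show "s' i j = 0 i j"
      using d(5) below_zero[OF b(2), of i j] wt_add[of "i - (p - 1)" "p - 1" "j - (p\<^sup>2 - 1)" "p\<^sup>2 - 1"]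
      by (cases "mn_index i j") (auto simp: digits_on_def mn_index_def)
  qed
  moreover have "act x 0 = 0" for x by (simp add: act_def fun_eq_iff)
  ultimately have "k = k'" using d(6) by simp
  then show ?thesis using top n by simp
qed

lemma image_realize:
  assumes g: "g \<in> below (Suc n)" and top: "\<And>i j. wt i j = n \<Longrightarrow> g i j \<in> image_ideal"
  shows "\<exists>f\<in>grids. \<exists>t\<in>grids. g - (act AX f + act AY t) \<in> below n"
proof -
  have "\<forall>i j. \<exists>a b c. wt i j = n \<longrightarrow> a \<in> zpoly \<and> b \<in> zpoly \<and> c \<in> zpoly \<and>
     g i j = of_nat p ^ 2 * a + of_nat p * vpow (p - 1) * b + vpow ((p - 1) * (p + 2)) * c"
    using top unfolding image_ideal_def by blast
  then obtain a b c where abc: "\<And>i j. wt i j = n \<Longrightarrow> a i j \<in> zpoly \<and> b i j \<in> zpoly \<and> c i j \<in> zpoly \<and>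
     g i j = of_nat p ^ 2 * a i j + of_nat p * vpow (p - 1) * b i j + vpow ((p - 1) * (p + 2)) * c i j"
    by metis
  define a' where "a' i j = (if wt i j = n then a i j else 0)" for i j
  define b' where "b' i j = (if wt i j = n then - b i j else 0)" for i j
  define c' where "c' i j = (if wt i j = n then - c i j else 0)" for i j
  have abc': "a' \<in> below (Suc n)" "b' \<in> below (Suc n)" "c' \<in> below (Suc n)"
    using abc by (auto simp: a'_def b'_def c'_def intro!: belowI zpoly_uminus)
  define s where "s = raise 0 (p - 1) b'"
  define s' where "s' = raise (p - 1) (p\<^sup>2 - 1) c'"
  have sb: "s \<in> below (Suc n + wt 0 (p - 1))" "s' \<in> below (Suc n + wt (p - 1) (p\<^sup>2 - 1))"
    unfolding s_def s'_def using abc'(2,3) by (blast intro: raise_below)+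
  have sg: "s \<in> grids" "s' \<in> grids" "a' \<in> grids" using sb abc' by auto
  have e: "boundary_form s s' a' = act AX (act nu s + act mn s') + act AY (a' - act r s - act r' s')"
  proof -
    have g: "act nu s \<in> grids" "act mn s' \<in> grids" "act r s \<in> grids" "act r' s' \<in> grids"
      using sg by auto
    have "act AX (act nu s + act mn s') = act AX (act nu s) + act AX (act mn s')"
      using g by (simp only: act_add)
    moreover have "act AY (a' - act r s - act r' s') = act AY a' - act AY (act r s) - act AY (act r' s')"
      using sg g by (simp only: act_diff grids_diff)
    ultimately show ?thesis
      unfolding act_AX_nu[OF sg(1)] act_AX_mn[OF sg(2)] boundary_form_def by (simp add: algebra_simps)
  qed
  have "g - boundary_form s s' a' \<in> below n"
  proof (rule below_Suc_diff[OF g])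
    have "act D s \<in> below (Suc n)" "act E s' \<in> below (Suc n)"
      using act_below[of D "wt 0 (p - 1)", OF _ _ sb(1)] leads_D
        act_below[of E "wt (p - 1) (p\<^sup>2 - 1)", OF _ _ sb(2)] leads_E
      by (simp_all add: leads_def)
    moreover have "act AY a' \<in> below (Suc n)" using abc'(1) by (intro act_below0 AY_sint)
    ultimately show "boundary_form s s' a' \<in> below (Suc n)"
      unfolding boundary_form_def
      by (intro below_add below_scal zpoly_monom zloc_1)
    fix i j assume ij: "wt i j = n"
    show "g i j = boundary_form s s' a' i j"
      unfolding boundary_form_top[OF sb abc'(1) ij] using abc[OF ij] ij
      by (simp add: s_def s'_def raise_def a'_def b'_def c'_def algebra_simps)
  qed
  then show ?thesis unfolding e using sg
    by (intro bexI[of _ "act nu s + act mn s'"] bexI[of _ "a' - act r s - act r' s'"]) auto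
qed

end

context prime_number
begin

lemma reduction_exists: "\<exists>nu m D E L G r r'. reduction p nu m D E L G r r'"
proof -
  obtain nu m D E L G r r' where
    "nu \<in> sint" "m \<in> sint" "D \<in> sint" "E \<in> sint" "L \<in> sint" "G \<in> sint" "r \<in> sint" "r' \<in> sint"
    "nu * AX = cst (vpow (p - 1)) * D + r * AY"
    "m * nu * AX = cst (vpow ((p - 1) * (p + 2))) * E + r' * AY"
    "D = G * L"
    "leads nu 0 1" "leads m 0 (of_nat p)"
    "leads L (wt 0 (p - 1)) (- mono2 0 (p - 1))"
    "leads D (wt 0 (p - 1)) (- (of_nat p * mono2 0 (p - 1)))"
    "leads E (wt (p - 1) (p\<^sup>2 - 1)) (- mono2 (p - 1) (p\<^sup>2 - 1))"
    by (rule reduction_operators)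
  then have "reduction p nu m D E L G r r'" by unfold_locales
  then show ?thesis by blast
qed

lemma image_leading_terms:
  assumes "f \<in> grids" "t \<in> grids" "act AX f + act AY t \<in> below (Suc n)" "wt i j = n"
  shows "(act AX f + act AY t) i j \<in> image_ideal"
proof -
  obtain nu m D E L G r r' where "reduction p nu m D E L G r r'" using reduction_exists by blast
  then show ?thesis using assms by (rule reduction.image_top)
qed

lemma image_leading_terms_realized:
  assumes "g \<in> below (Suc n)" "\<And>i j. wt i j = n \<Longrightarrow> g i j \<in> image_ideal"
  shows "\<exists>f\<in>grids. \<exists>t\<in>grids. g - (act AX f + act AY t) \<in> below n"
proof -
  obtain nu m D E L G r r' where "reduction p nu m D E L G r r'" using reduction_exists by blast
  then show ?thesis using assms by (rule reduction.image_realize)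
qed

lemma kernel_leading_terms:
  assumes "k \<in> kernel" "k \<in> below (Suc n)" "wt i j = n"
  shows "\<exists>c\<in>zpoly. k i j = of_nat (kernel_multiple i j) * c"
proof -
  obtain nu m D E L G r r' where "reduction p nu m D E L G r r'" using reduction_exists by blast
  then show ?thesis using assms by (rule reduction.kernel_top)
qed

lemma kernel_leading_terms_realized:
  assumes "g \<in> below (Suc n)"
    and "\<And>i j. wt i j = n \<Longrightarrow> \<exists>c\<in>zpoly. g i j = of_nat (kernel_multiple i j) * c"
  shows "\<exists>k\<in>kernel. g - k \<in> below n"
proof -
  obtain nu m D E L G r r' where "reduction p nu m D E L G r r'" using reduction_exists by blast
  then show ?thesis using assms by (rule reduction.kernel_realize)
qed

end

section \<open>Modules presented by sets of functions\<close>

definition stable :: "('a, 'c) ring_scheme \<Rightarrow> ('a \<Rightarrow> 'x \<Rightarrow> 'x) \<Rightarrow> 'x::ab_group_add set \<Rightarrow> bool" where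
  "stable R sc P \<longleftrightarrow> 0 \<in> P \<and> (\<forall>x\<in>P. \<forall>y\<in>P. x + y \<in> P) \<and> (\<forall>x\<in>P. - x \<in> P) \<and>
     (\<forall>r\<in>carrier R. \<forall>x\<in>P. sc r x \<in> P)"

lemma stableD:
  assumes "stable R sc P"
  shows "0 \<in> P" "x \<in> P \<Longrightarrow> y \<in> P \<Longrightarrow> x + y \<in> P" "x \<in> P \<Longrightarrow> - x \<in> P"
    "r \<in> carrier R \<Longrightarrow> x \<in> P \<Longrightarrow> sc r x \<in> P" "x \<in> P \<Longrightarrow> y \<in> P \<Longrightarrow> x - y \<in> P"
  using assms unfolding stable_def by (auto simp: diff_conv_add_uminus simp del: add_uminus_conv_diff)

text \<open>
  The module \<open>M\<close> is the image of the additive group \<open>P\<close> under the linear map \<open>h\<close>. Computing with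
  representatives in \<open>P\<close> avoids the carriers of iterated quotients and direct sums.
\<close>

definition presents :: "('a, 'c) ring_scheme \<Rightarrow> ('a \<Rightarrow> 'x \<Rightarrow> 'x) \<Rightarrow> 'x::ab_group_add set \<Rightarrow> ('x \<Rightarrow> 'b)
      \<Rightarrow> ('a, 'b, 'd) module_scheme \<Rightarrow> bool" where
  "presents R sc P h M \<longleftrightarrow> stable R sc P \<and>
     (\<forall>r\<in>carrier R. \<forall>x\<in>P. \<forall>y\<in>P. sc r (x + y) = sc r x + sc r y) \<and>
     carrier M = h ` P \<and> \<zero>\<^bsub>M\<^esub> = h 0 \<and>
     (\<forall>x\<in>P. \<forall>y\<in>P. h x \<oplus>\<^bsub>M\<^esub> h y = h (x + y)) \<and>
     (\<forall>r\<in>carrier R. \<forall>x\<in>P. r \<odot>\<^bsub>M\<^esub> h x = h (sc r x))"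

lemma presentsD:
  assumes "presents R sc P h M"
  shows "stable R sc P" "carrier M = h ` P" "\<zero>\<^bsub>M\<^esub> = h 0"
    "x \<in> P \<Longrightarrow> y \<in> P \<Longrightarrow> h x \<oplus>\<^bsub>M\<^esub> h y = h (x + y)"
    "r \<in> carrier R \<Longrightarrow> x \<in> P \<Longrightarrow> r \<odot>\<^bsub>M\<^esub> h x = h (sc r x)"
    "r \<in> carrier R \<Longrightarrow> x \<in> P \<Longrightarrow> y \<in> P \<Longrightarrow> sc r (x + y) = sc r x + sc r y"
  using assms unfolding presents_def by blast+

lemma presents_abelian_group:
  assumes "presents R sc P h M"
  shows "abelian_group M"
proof (rule abelian_groupI)
  note D = presentsD[OF assms] and S = stableD[OF presentsD(1)[OF assms]]
  fix x y assume "x \<in> carrier M" "y \<in> carrier M"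
  then obtain a b where ab: "a \<in> P" "b \<in> P" "x = h a" "y = h b" unfolding D(2) by blast
  show "x \<oplus>\<^bsub>M\<^esub> y \<in> carrier M" using ab S by (simp add: D)
  show "x \<oplus>\<^bsub>M\<^esub> y = y \<oplus>\<^bsub>M\<^esub> x" using ab S by (simp add: D add.commute)
next
  note D = presentsD[OF assms] and S = stableD[OF presentsD(1)[OF assms]]
  show "\<zero>\<^bsub>M\<^esub> \<in> carrier M" using S by (simp add: D)
  fix x assume "x \<in> carrier M"
  then obtain a where a: "a \<in> P" "x = h a" unfolding D(2) by blast
  show "\<zero>\<^bsub>M\<^esub> \<oplus>\<^bsub>M\<^esub> x = x" using a S by (simp add: D)
  have "h (- a) \<in> carrier M" "h (- a) \<oplus>\<^bsub>M\<^esub> x = \<zero>\<^bsub>M\<^esub>" using a S by (simp_all add: D)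
  then show "\<exists>y\<in>carrier M. y \<oplus>\<^bsub>M\<^esub> x = \<zero>\<^bsub>M\<^esub>" by blast
next
  note D = presentsD[OF assms] and S = stableD[OF presentsD(1)[OF assms]]
  fix x y z assume "x \<in> carrier M" "y \<in> carrier M" "z \<in> carrier M"
  then obtain a b c where ab: "a \<in> P" "b \<in> P" "c \<in> P" "x = h a" "y = h b" "z = h c" unfolding D(2) by blast
  show "x \<oplus>\<^bsub>M\<^esub> y \<oplus>\<^bsub>M\<^esub> z = x \<oplus>\<^bsub>M\<^esub> (y \<oplus>\<^bsub>M\<^esub> z)" using ab S by (simp add: D add.assoc)
qed

lemma presents_finsum:
  assumes h: "presents R sc P h M" and A: "finite A" and f: "\<And>a. a \<in> A \<Longrightarrow> f a \<in> P"
  shows "(\<Oplus>\<^bsub>M\<^esub>a\<in>A. h (f a)) = h (sum f A) \<and> sum f A \<in> P"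
  using A f
proof (induction A)
  interpret M: abelian_group M using h by (rule presents_abelian_group)
  note D = presentsD[OF h] and S = stableD[OF presentsD(1)[OF h]]
  case empty
  then show ?case using S by (simp add: D)
next
  interpret M: abelian_group M using h by (rule presents_abelian_group)
  note D = presentsD[OF h] and S = stableD[OF presentsD(1)[OF h]]
  case (insert a A)
  then have "(\<Oplus>\<^bsub>M\<^esub>a\<in>insert a A. h (f a)) = h (f a) \<oplus>\<^bsub>M\<^esub> (\<Oplus>\<^bsub>M\<^esub>a\<in>A. h (f a))"
    by (intro M.finsum_insert) (auto simp: D)
  then show ?case using insert S by (simp add: D)
qed

lemma presents_uminus:
  assumes "presents R sc P h M" "x \<in> P"
  shows "inv\<^bsub>add_monoid M\<^esub> (h x) = h (- x)"
proof -
  interpret M: abelian_group M using assms(1) by (rule presents_abelian_group)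
  note D = presentsD[OF assms(1)] and S = stableD[OF presentsD(1)[OF assms(1)]]
  have "h (- x) \<oplus>\<^bsub>M\<^esub> h x = \<zero>\<^bsub>M\<^esub>" using assms(2) S by (simp add: D)
  then show ?thesis
    using M.add.inv_equality[of "h (- x)" "h x"] assms(2) S by (simp add: D a_inv_def)
qed

lemma presents_submodule:
  assumes h: "presents R sc P h M" and Q: "stable R sc Q" "Q \<subseteq> P"
  shows "submodule (h ` Q) R M"
proof -
  note D = presentsD[OF h] and S = stableD[OF presentsD(1)[OF h]] and SQ = stableD[OF Q(1)]
  have in_P: "x \<in> Q \<Longrightarrow> x \<in> P" for x using Q(2) by blast
  have "subgroup (h ` Q) (add_monoid M)"
  proof (rule subgroup.intro)
    show "h ` Q \<subseteq> carrier (add_monoid M)" using Q(2) by (auto simp: D)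
    show "x \<otimes>\<^bsub>add_monoid M\<^esub> y \<in> h ` Q" if "x \<in> h ` Q" "y \<in> h ` Q" for x y
      using that SQ in_P by (auto simp: D)
    show "\<one>\<^bsub>add_monoid M\<^esub> \<in> h ` Q" using SQ by (auto simp: D)
    show "inv\<^bsub>add_monoid M\<^esub> x \<in> h ` Q" if "x \<in> h ` Q" for x
      using that SQ in_P by (auto simp: presents_uminus[OF h])
  qed
  then show ?thesis
    by (rule submodule.intro) (use SQ in_P in \<open>auto simp: submodule_axioms_def D\<close>)
qed

text \<open>
  The preimage of a submodule is stable, so if \<open>Q\<close> is generated by \<open>G\<close>, its image is generated
  by the image of \<open>G\<close>.
\<close>

lemma presents_gen_submodule:
  assumes h: "presents R sc P h M" and Q: "stable R sc Q" "Q \<subseteq> P" "G \<subseteq> Q"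
    and gen: "\<And>T. stable R sc T \<Longrightarrow> G \<subseteq> T \<Longrightarrow> Q \<subseteq> T"
  shows "gen_submodule R M (h ` G) = h ` Q"
proof
  show "gen_submodule R M (h ` G) \<subseteq> h ` Q"
    unfolding gen_submodule_def using presents_submodule[OF h Q(1,2)] Q(3) by blast
  show "h ` Q \<subseteq> gen_submodule R M (h ` G)"
    unfolding gen_submodule_def
  proof (rule Inter_greatest)
    fix N assume "N \<in> {N. submodule N R M \<and> h ` G \<subseteq> N}"
    then have N: "submodule N R M" "h ` G \<subseteq> N" by auto
    interpret N: submodule N R M by fact
    note D = presentsD[OF h] and S = stableD[OF presentsD(1)[OF h]]
    have "stable R sc {x \<in> P. h x \<in> N}"
      unfolding stable_def
    proof (intro conjI ballI)
      show "0 \<in> {x \<in> P. h x \<in> N}" using N.one_closed S by (simp add: D)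
      show "x + y \<in> {x \<in> P. h x \<in> N}" if "x \<in> {x \<in> P. h x \<in> N}" "y \<in> {x \<in> P. h x \<in> N}" for x y
      proof -
        have "h x \<oplus>\<^bsub>M\<^esub> h y \<in> N" using N.m_closed[of "h x" "h y"] that by simp
        then show ?thesis using that S by (simp add: D)
      qed
      show "- x \<in> {x \<in> P. h x \<in> N}" if "x \<in> {x \<in> P. h x \<in> N}" for x
      proof -
        have "inv\<^bsub>add_monoid M\<^esub> (h x) \<in> N" using that by (intro N.m_inv_closed) simp
        then show ?thesis using that S presents_uminus[OF h] by simp
      qed
      show "sc r x \<in> {x \<in> P. h x \<in> N}" if "r \<in> carrier R" "x \<in> {x \<in> P. h x \<in> N}" for r x
      proof -
        have "r \<odot>\<^bsub>M\<^esub> h x \<in> N" using that by (intro N.smult_closed) simp_all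
        then show ?thesis using that S by (simp add: D)
      qed
    qed
    from gen[OF this] show "h ` Q \<subseteq> N" using Q N by blast
  qed
qed

lemma presents_set_add:
  assumes h: "presents R sc P h M" and "X \<subseteq> P" "Y \<subseteq> P"
  shows "h ` X <+>\<^bsub>M\<^esub> h ` Y = h ` {x + y | x y. x \<in> X \<and> y \<in> Y}"
proof -
  have "h ` X <+>\<^bsub>M\<^esub> h ` Y = (\<Union>x\<in>X. \<Union>y\<in>Y. {h x \<oplus>\<^bsub>M\<^esub> h y})"
    by (simp add: set_add_def')
  also have "\<dots> = (\<Union>x\<in>X. \<Union>y\<in>Y. {h (x + y)})"
    using assms(2,3) presentsD(4)[OF h] by (intro SUP_cong refl) (auto dest: subsetD)
  also have "\<dots> = h ` {x + y | x y. x \<in> X \<and> y \<in> Y}" by blast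
  finally show ?thesis .
qed

lemma presents_coset:
  assumes h: "presents R sc P h M" and "Q \<subseteq> P" "x \<in> P"
  shows "h ` Q +>\<^bsub>M\<^esub> h x = h ` {q + x | q. q \<in> Q}"
proof -
  have "h ` Q +>\<^bsub>M\<^esub> h x = (\<Union>q\<in>Q. {h q \<oplus>\<^bsub>M\<^esub> h x})"
    by (simp add: a_r_coset_def')
  also have "\<dots> = (\<Union>q\<in>Q. {h (q + x)})"
    using assms(2,3) presentsD(4)[OF h] by (intro SUP_cong refl) (auto dest: subsetD)
  also have "\<dots> = h ` {q + x | q. q \<in> Q}" by blast
  finally show ?thesis .
qed

text \<open>
  Cosets in the image are images of cosets: \<open>h ` Q +> h x = h ` (Q + x)\<close>. As \<open>Q\<close> contains the kernel of
  \<open>h\<close>, these images are equal exactly if the cosets of \<open>Q\<close> are.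
\<close>

lemma presents_quotient:
  assumes h: "presents R sc P h M" and Q: "stable R sc Q" "Q \<subseteq> P"
    and ker: "\<And>x y. x \<in> P \<Longrightarrow> y \<in> P \<Longrightarrow> h x = h y \<Longrightarrow> x - y \<in> Q"
  shows "presents R sc P (\<lambda>x. h ` Q +>\<^bsub>M\<^esub> h x) (quotient_module M (h ` Q))"
    and "x \<in> P \<Longrightarrow> y \<in> P \<Longrightarrow> h ` Q +>\<^bsub>M\<^esub> h x = h ` Q +>\<^bsub>M\<^esub> h y \<longleftrightarrow> x - y \<in> Q"
proof -
  note D = presentsD[OF h] and S = stableD[OF presentsD(1)[OF h]] and SQ = stableD[OF Q(1)]
  note cs = presents_coset[OF h Q(2)]
  have in_P: "x \<in> Q \<Longrightarrow> x \<in> P" for x using Q(2) by blast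
  have eqI: "{q + x | q. q \<in> Q} = {q + y | q. q \<in> Q}" if "x - y \<in> Q" for x y
  proof -
    have "\<exists>q'. q + x = q' + y \<and> q' \<in> Q" if "q \<in> Q" for q
      using SQ(2)[OF that \<open>x - y \<in> Q\<close>] by (intro exI[of _ "q + (x - y)"]) (simp add: algebra_simps)
    moreover have "\<exists>q'. q + y = q' + x \<and> q' \<in> Q" if "q \<in> Q" for q
      using SQ(5)[OF that \<open>x - y \<in> Q\<close>] by (intro exI[of _ "q - (x - y)"]) (simp add: algebra_simps)
    ultimately show ?thesis by blast
  qed
  show eq: "h ` Q +>\<^bsub>M\<^esub> h x = h ` Q +>\<^bsub>M\<^esub> h y \<longleftrightarrow> x - y \<in> Q" if xy: "x \<in> P" "y \<in> P" for x y
  proof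
    assume "x - y \<in> Q"
    then show "h ` Q +>\<^bsub>M\<^esub> h x = h ` Q +>\<^bsub>M\<^esub> h y"
      unfolding cs[OF xy(1)] cs[OF xy(2)] by (simp only: eqI)
  next
    assume "h ` Q +>\<^bsub>M\<^esub> h x = h ` Q +>\<^bsub>M\<^esub> h y"
    then have "h ` {q + x | q. q \<in> Q} = h ` {q + y | q. q \<in> Q}"
      unfolding cs[OF xy(1)] cs[OF xy(2)] .
    moreover have "h x \<in> h ` {q + x | q. q \<in> Q}"
    proof (rule imageI)
      have "0 + x \<in> {q + x | q. q \<in> Q}" using SQ(1) by blast
      then show "x \<in> {q + x | q. q \<in> Q}" by simp
    qed
    ultimately have "h x \<in> h ` {q + y | q. q \<in> Q}" by (simp only:)
    then obtain q where q: "q \<in> Q" "h x = h (q + y)" by blast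
    from ker[OF xy(1) S(2)[OF in_P[OF q(1)] xy(2)] q(2)] have "x - (q + y) \<in> Q" .
    from SQ(2)[OF this q(1)] show "x - y \<in> Q" by simp
  qed
  show "presents R sc P (\<lambda>x. h ` Q +>\<^bsub>M\<^esub> h x) (quotient_module M (h ` Q))"
    unfolding presents_def
  proof (intro conjI ballI)
    show "stable R sc P" by (rule D(1))
    show "sc r (x + y) = sc r x + sc r y" if "r \<in> carrier R" "x \<in> P" "y \<in> P" for r x y
      using that by (rule D(6))
    show "carrier (quotient_module M (h ` Q)) = (\<lambda>x. h ` Q +>\<^bsub>M\<^esub> h x) ` P"
      by (auto simp: quotient_module_def A_RCOSETS_def' D a_r_coset_def')
    show "\<zero>\<^bsub>quotient_module M (h ` Q)\<^esub> = h ` Q +>\<^bsub>M\<^esub> h 0"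
      unfolding cs[OF S(1)] by (simp add: quotient_module_def)
    show "(h ` Q +>\<^bsub>M\<^esub> h x) \<oplus>\<^bsub>quotient_module M (h ` Q)\<^esub> (h ` Q +>\<^bsub>M\<^esub> h y) = h ` Q +>\<^bsub>M\<^esub> h (x + y)"
      if xy: "x \<in> P" "y \<in> P" for x y
    proof -
      have sub: "{q + x | q. q \<in> Q} \<subseteq> P" "{q + y | q. q \<in> Q} \<subseteq> P" using xy S in_P by auto
      have "{a + b | a b. a \<in> {q + x | q. q \<in> Q} \<and> b \<in> {q + y | q. q \<in> Q}} = {q + (x + y) | q. q \<in> Q}"
      proof (intro Set.set_eqI iffI)
        fix z assume "z \<in> {a + b | a b. a \<in> {q + x | q. q \<in> Q} \<and> b \<in> {q + y | q. q \<in> Q}}"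
        then obtain q q' where q: "q \<in> Q" "q' \<in> Q" "z = (q + x) + (q' + y)" by blast
        then have "z = (q + q') + (x + y)" by (simp add: algebra_simps)
        then show "z \<in> {q + (x + y) | q. q \<in> Q}" using SQ(2)[OF q(1,2)] by blast
      next
        fix z assume "z \<in> {q + (x + y) | q. q \<in> Q}"
        then obtain q where q: "q \<in> Q" "z = q + (x + y)" by blast
        then have "z = (q + x) + (0 + y)" by (simp add: algebra_simps)
        then show "z \<in> {a + b | a b. a \<in> {q + x | q. q \<in> Q} \<and> b \<in> {q + y | q. q \<in> Q}}"
          using q(1) SQ(1) by blast
      qed
      then show ?thesis
        unfolding cs[OF xy(1)] cs[OF xy(2)] cs[OF S(2)[OF xy]]
        by (simp only: quotient_module_def ring.simps presents_set_add[OF h sub])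
    qed
    show "r \<odot>\<^bsub>quotient_module M (h ` Q)\<^esub> (h ` Q +>\<^bsub>M\<^esub> h x) = h ` Q +>\<^bsub>M\<^esub> h (sc r x)"
      if rx: "r \<in> carrier R" "x \<in> P" for r x
    proof -
      have "h ` Q +>\<^bsub>M\<^esub> (r \<odot>\<^bsub>M\<^esub> z) = h ` Q +>\<^bsub>M\<^esub> h (sc r x)" if zin: "z \<in> h ` {q + x | q. q \<in> Q}" for z
      proof -
        obtain q where q: "q \<in> Q" "z = h (q + x)" using zin by blast
        have qP: "q \<in> P" "q + x \<in> P" using q in_P rx S by auto
        have "r \<odot>\<^bsub>M\<^esub> z = h (sc r q + sc r x)" using q qP rx D by simp
        moreover have "(sc r q + sc r x) - sc r x \<in> Q" using SQ(4) q(1) rx by simp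
        ultimately show ?thesis using eq[of "sc r q + sc r x" "sc r x"] qP rx S by simp
      qed
      moreover have "h ` {q + x | q. q \<in> Q} \<noteq> {}" using SQ(1) by blast
      ultimately have "(\<Union>z\<in>h ` {q + x | q. q \<in> Q}. h ` Q +>\<^bsub>M\<^esub> (r \<odot>\<^bsub>M\<^esub> z)) = h ` Q +>\<^bsub>M\<^esub> h (sc r x)"
        by (simp only: UN_constant cong: SUP_cong) simp
      then show ?thesis
        unfolding cs[OF rx(2), symmetric] by (simp only: quotient_module_def module.simps)
    qed
  qed
qed

text \<open>
  The parameter \<open>y\<close> need not be a family indexed by \<open>I\<close>: any type with component maps \<open>ev i\<close> will do,
  and the components only have to be surjective after applying the \<open>h i\<close>. This lets grids
  parametrize direct sums over rows, over positions and over filtration degrees alike.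
\<close>

lemma presents_direct_sum:
  fixes ev :: "'i \<Rightarrow> 'y::ab_group_add \<Rightarrow> 'x::ab_group_add"
  assumes h: "\<And>i. i \<in> I \<Longrightarrow> presents R sc (P i) (h i) (M i)"
    and S': "stable R sc' P'"
    and sc'_add: "\<And>r y z. r \<in> carrier R \<Longrightarrow> y \<in> P' \<Longrightarrow> z \<in> P' \<Longrightarrow> sc' r (y + z) = sc' r y + sc' r z"
    and ev: "\<And>i y. i \<in> I \<Longrightarrow> y \<in> P' \<Longrightarrow> ev i y \<in> P i"
    and ev_0: "\<And>i. i \<in> I \<Longrightarrow> ev i 0 = 0"
    and ev_add: "\<And>i y z. i \<in> I \<Longrightarrow> y \<in> P' \<Longrightarrow> z \<in> P' \<Longrightarrow> ev i (y + z) = ev i y + ev i z"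
    and ev_sc: "\<And>i y r. i \<in> I \<Longrightarrow> y \<in> P' \<Longrightarrow> r \<in> carrier R \<Longrightarrow> ev i (sc' r y) = sc r (ev i y)"
    and fin: "\<And>y. y \<in> P' \<Longrightarrow> finite {i \<in> I. ev i y \<noteq> 0}"
    and surj: "\<And>f. (\<And>i. i \<in> I \<Longrightarrow> f i \<in> P i) \<Longrightarrow> finite {i \<in> I. f i \<noteq> 0} \<Longrightarrow>
        \<exists>y\<in>P'. \<forall>i\<in>I. h i (ev i y) = h i (f i)"
  shows "presents R sc' P' (\<lambda>y. \<lambda>i\<in>I. h i (ev i y)) (direct_sum I M)"
  unfolding presents_def
proof (intro conjI ballI)
  show "stable R sc' P'" by (rule S')
  show "sc' r (x + y) = sc' r x + sc' r y" if "r \<in> carrier R" "x \<in> P'" "y \<in> P'" for r x y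
    using that by (rule sc'_add)
  note D = presentsD[OF h]
  show "carrier (direct_sum I M) = (\<lambda>y. \<lambda>i\<in>I. h i (ev i y)) ` P'"
  proof (intro Set.set_eqI iffI)
    fix z assume "z \<in> carrier (direct_sum I M)"
    then have z: "z \<in> (\<Pi>\<^sub>E i\<in>I. carrier (M i))" "finite {i \<in> I. z i \<noteq> \<zero>\<^bsub>M i\<^esub>}"
      by (auto simp: direct_sum_def)
    have "\<exists>x\<in>P i. h i x = z i" if "i \<in> I" for i
      using PiE_mem[OF z(1) that] D(2)[OF that] by auto
    then obtain f0 where f0: "\<And>i. i \<in> I \<Longrightarrow> f0 i \<in> P i \<and> h i (f0 i) = z i" by metis
    define f where "f i = (if z i = \<zero>\<^bsub>M i\<^esub> then 0 else f0 i)" for i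
    have f: "f i \<in> P i" "h i (f i) = z i" if "i \<in> I" for i
      using f0[OF that] D(3)[OF that] stableD(1)[OF D(1)[OF that]] by (auto simp: f_def)
    have "finite {i \<in> I. f i \<noteq> 0}"
      by (rule finite_subset[OF _ z(2)]) (auto simp: f_def)
    then obtain y where y: "y \<in> P'" "\<forall>i\<in>I. h i (ev i y) = h i (f i)" using surj f by blast
    have "z = (\<lambda>i\<in>I. h i (ev i y))"
      using z(1) y f by (intro ext) (auto simp: restrict_def PiE_def extensional_def)
    then show "z \<in> (\<lambda>y. \<lambda>i\<in>I. h i (ev i y)) ` P'" using y by blast
  next
    fix z assume "z \<in> (\<lambda>y. \<lambda>i\<in>I. h i (ev i y)) ` P'"
    then obtain y where y: "y \<in> P'" "z = (\<lambda>i\<in>I. h i (ev i y))" by blast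
    have "{i \<in> I. z i \<noteq> \<zero>\<^bsub>M i\<^esub>} \<subseteq> {i \<in> I. ev i y \<noteq> 0}" using y D(3) by auto
    then have "finite {i \<in> I. z i \<noteq> \<zero>\<^bsub>M i\<^esub>}" using fin[OF y(1)] by (rule finite_subset)
    then show "z \<in> carrier (direct_sum I M)"
      using y ev D(2) by (auto simp: direct_sum_def)
  qed
  show "\<zero>\<^bsub>direct_sum I M\<^esub> = (\<lambda>i\<in>I. h i (ev i 0))"
    using D(3) by (auto simp: direct_sum_def ev_0 restrict_def)
  show "(\<lambda>i\<in>I. h i (ev i x)) \<oplus>\<^bsub>direct_sum I M\<^esub> (\<lambda>i\<in>I. h i (ev i y)) = (\<lambda>i\<in>I. h i (ev i (x + y)))"
    if "x \<in> P'" "y \<in> P'" for x y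
    using that D(4) ev by (auto simp: direct_sum_def ev_add restrict_def)
  show "r \<odot>\<^bsub>direct_sum I M\<^esub> (\<lambda>i\<in>I. h i (ev i x)) = (\<lambda>i\<in>I. h i (ev i (sc' r x)))"
    if "r \<in> carrier R" "x \<in> P'" for r x
    using that D(5) ev by (auto simp: direct_sum_def ev_sc restrict_def)
qed

lemma presents_carrier:
  assumes h: "presents R sc P h M" and "stable R sc Q" "Q \<subseteq> P"
  shows "presents R sc Q h (M\<lparr>carrier := h ` Q\<rparr>)"
proof -
  have "x \<in> Q \<Longrightarrow> x \<in> P" for x using assms(3) by blast
  then show ?thesis using assms(2) presentsD[OF h] unfolding presents_def by simp
qed

text \<open>
  Both modules are quotients of \<open>P\<close> by the same subgroup.
\<close>

lemma presents_same_kernel_iso: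
  assumes h: "presents R sc P h M" and k: "presents R sc P k N"
    and eq: "\<And>x y. x \<in> P \<Longrightarrow> y \<in> P \<Longrightarrow> h x = h y \<longleftrightarrow> k x = k y"
  shows "\<exists>\<phi>\<in>module_isos R M N. \<forall>x\<in>P. \<phi> (h x) = k x"
proof -
  note Dh = presentsD[OF h] and Dk = presentsD[OF k] and S = stableD[OF presentsD(1)[OF h]]
  define \<phi> where "\<phi> m = k (SOME x. x \<in> P \<and> h x = m)" for m
  have \<phi>: "\<phi> (h x) = k x" if "x \<in> P" for x
  proof -
    have "(SOME y. y \<in> P \<and> h y = h x) \<in> P \<and> h (SOME y. y \<in> P \<and> h y = h x) = h x"
      by (rule someI[of _ x]) (use that in simp)
    then show ?thesis unfolding \<phi>_def using eq that by blast
  qed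
  have "bij_betw \<phi> (carrier M) (carrier N)"
    unfolding bij_betw_def Dh(2) Dk(2)
  proof
    show "inj_on \<phi> (h ` P)" by (rule inj_onI) (use \<phi> eq in auto)
    show "\<phi> ` h ` P = k ` P" using \<phi> by (force simp: image_def)
  qed
  moreover have "\<phi> (x \<oplus>\<^bsub>M\<^esub> y) = \<phi> x \<oplus>\<^bsub>N\<^esub> \<phi> y" if "x \<in> carrier M" "y \<in> carrier M" for x y
    using that \<phi> S by (auto simp: Dh(2,4) Dk(4))
  moreover have "\<phi> (r \<odot>\<^bsub>M\<^esub> x) = r \<odot>\<^bsub>N\<^esub> \<phi> x" if "r \<in> carrier R" "x \<in> carrier M" for r x
    using that \<phi> S by (auto simp: Dh(2,5) Dk(5))
  ultimately have "\<phi> \<in> module_isos R M N" unfolding module_isos_def by blast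
  then show ?thesis using \<phi> by blast
qed

section \<open>The complex in terms of grids\<close>

definition rscal :: "rat poly \<Rightarrow> (nat \<Rightarrow> rat poly) \<Rightarrow> nat \<Rightarrow> rat poly" where
  "rscal c r j = c * r j"

context prime_number
begin

lemma carrier_ku: "carrier (ku p) = zpoly"
  by (simp add: ku_def zpoly_def zloc_def)

lemma ku_simps [simp]:
  "x \<otimes>\<^bsub>ku p\<^esub> y = x * y" "\<one>\<^bsub>ku p\<^esub> = 1" "x \<oplus>\<^bsub>ku p\<^esub> y = x + y" "\<zero>\<^bsub>ku p\<^esub> = 0"
  by (simp_all add: ku_def)

lemma stable_iff_zpoly:
  "stable (ku p) sc P \<longleftrightarrow> 0 \<in> P \<and> (\<forall>x\<in>P. \<forall>y\<in>P. x + y \<in> P) \<and> (\<forall>x\<in>P. - x \<in> P) \<and>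
     (\<forall>r\<in>zpoly. \<forall>x\<in>P. sc r x \<in> P)"
  by (simp add: stable_def carrier_ku)

lemma presents_regular: "presents (ku p) (*) zpoly (\<lambda>x. x) (regular_module (ku p))"
  unfolding presents_def stable_iff_zpoly
  by (auto simp: carrier_ku regular_module_def distrib_left)

lemma cring_ku: "cring (ku p)"
proof (rule cringI)
  show "abelian_group (ku p)"
  proof (rule abelian_groupI)
    fix x assume "x \<in> carrier (ku p)"
    then show "\<exists>y\<in>carrier (ku p). y \<oplus>\<^bsub>ku p\<^esub> x = \<zero>\<^bsub>ku p\<^esub>"
      by (intro bexI[of _ "- x"]) (auto simp: carrier_ku)
  qed (auto simp: carrier_ku)
  show "comm_monoid (ku p)"
    by (rule comm_monoidI) (auto simp: carrier_ku mult_ac)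
qed (simp add: distrib_right)

lemma genideal_ku:
  assumes J: "stable (ku p) (*) J" "J \<subseteq> zpoly" "S \<subseteq> J"
    and gen: "\<And>T. stable (ku p) (*) T \<Longrightarrow> S \<subseteq> T \<Longrightarrow> J \<subseteq> T"
  shows "Idl\<^bsub>ku p\<^esub> S = J"
proof
  interpret R: cring "ku p" by (rule cring_ku)
  have "subgroup J (add_monoid (ku p))"
  proof (rule subgroup.intro)
    fix x assume x: "x \<in> J"
    have "inv\<^bsub>add_monoid (ku p)\<^esub> x = - x"
      using R.add.inv_equality[of "- x" x] x J(2) by (auto simp: carrier_ku a_inv_def)
    then show "inv\<^bsub>add_monoid (ku p)\<^esub> x \<in> J" using J(1) x by (simp add: stable_iff_zpoly)
  qed (use J in \<open>auto simp: stable_iff_zpoly carrier_ku\<close>)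
  then have "ideal J (ku p)"
  proof (intro idealI R.ring_axioms)
    fix a x assume ax: "a \<in> J" "x \<in> carrier (ku p)"
    then have "x * a \<in> J" using J(1) by (simp add: stable_iff_zpoly carrier_ku)
    then show "x \<otimes>\<^bsub>ku p\<^esub> a \<in> J" "a \<otimes>\<^bsub>ku p\<^esub> x \<in> J" by (simp_all add: mult.commute)
  qed
  then show "Idl\<^bsub>ku p\<^esub> S \<subseteq> J" unfolding genideal_def using J(3) by blast
  show "J \<subseteq> Idl\<^bsub>ku p\<^esub> S"
    unfolding genideal_def
  proof (rule Inter_greatest)
    fix I assume "I \<in> {I. ideal I (ku p) \<and> S \<subseteq> I}"
    then have I: "ideal I (ku p)" "S \<subseteq> I" by auto
    interpret I: ideal I "ku p" by fact
    have "stable (ku p) (*) I"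
      unfolding stable_iff_zpoly
    proof (intro conjI ballI)
      show "0 \<in> I" using I.zero_closed by simp
      show "x + y \<in> I" if "x \<in> I" "y \<in> I" for x y using I.a_closed[OF that] by simp
      show mult: "r * x \<in> I" if "r \<in> zpoly" "x \<in> I" for r x
        using I.I_l_closed[of x r] that by (simp add: carrier_ku)
      show "- x \<in> I" if "x \<in> I" for x
        using mult[of "- 1" x] that zpoly_uminus[OF zpoly_1] by simp
    qed
    then show "J \<subseteq> I" using gen I(2) by blast
  qed
qed

definition rows :: "(nat \<Rightarrow> rat poly) set" where
  "rows = {r. (\<forall>j. r j \<in> zpoly) \<and> finite {j. r j \<noteq> 0}}"

lemma finite_support_add:
  fixes f g :: "'i \<Rightarrow> 'b::monoid_add"
  shows "finite {i. f i \<noteq> 0} \<Longrightarrow> finite {i. g i \<noteq> 0} \<Longrightarrow> finite {i. f i + g i \<noteq> 0}"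
  by (rule finite_subset[of _ "{i. f i \<noteq> 0} \<union> {i. g i \<noteq> 0}"]) auto

lemma stable_rows: "stable (ku p) rscal rows"
  unfolding stable_iff_zpoly
proof (intro conjI ballI)
  show "0 \<in> rows" by (simp add: rows_def)
  show "x + y \<in> rows" if "x \<in> rows" "y \<in> rows" for x y
    using that by (auto simp: rows_def intro: finite_support_add)
  show "- x \<in> rows" if "x \<in> rows" for x
    using that by (auto simp: rows_def)
  show "rscal r x \<in> rows" if "r \<in> zpoly" "x \<in> rows" for r x
  proof -
    have "finite {j. r * x j \<noteq> 0}"
      by (rule finite_subset[of _ "{j. x j \<noteq> 0}"]) (use that in \<open>auto simp: rows_def\<close>)
    then show ?thesis using that by (auto simp: rows_def rscal_def)
  qed
qed

lemma rscal_add: "rscal c (r + s) = rscal c r + rscal c s"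
  by (simp add: rscal_def fun_eq_iff distrib_left)

lemma finite_shifted: "finite {j. P j} \<Longrightarrow> finite {i \<in> {1::nat..}. P (i - 1)}"
proof -
  assume "finite {j. P j}"
  moreover have "{i \<in> {1..}. P (i - 1)} \<subseteq> Suc ` {j. P j}"
    by (rule subsetI, rule_tac x = "x - 1" in image_eqI) auto
  ultimately show ?thesis using finite_subset by blast
qed

lemma finite_unshifted: "finite {i \<in> {1::nat..}. P i} \<Longrightarrow> finite {j. P (Suc j)}"
proof -
  assume "finite {i \<in> {1::nat..}. P i}"
  moreover have "{j. P (Suc j)} \<subseteq> (\<lambda>i. i - 1) ` {i \<in> {1..}. P i}"
    by (rule subsetI, rule_tac x = "Suc x" in image_eqI) auto
  ultimately show ?thesis using finite_subset by blast
qed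

text \<open>
  The element \<open>\<Sum>\<^sub>j r(j) e\<^sub>j\<^sub>+\<^sub>1\<close> of the free module.
\<close>

definition rowf :: "(nat \<Rightarrow> rat poly) \<Rightarrow> nat \<Rightarrow> rat poly" where
  "rowf r = (\<lambda>i\<in>{1..}. r (i - 1))"

lemma presents_ku_free: "presents (ku p) rscal rows rowf (ku_free p)"
proof -
  have "presents (ku p) rscal rows (\<lambda>y. \<lambda>i\<in>{1..}. (\<lambda>x. x) ((\<lambda>i y. y (i - 1)) i y)) (ku_free p)"
  proof (rule presents_direct_sum[OF presents_regular stable_rows])
    show "\<exists>y\<in>rows. \<forall>i\<in>{1..}. y (i - 1) = f i"
      if f: "\<And>i. i \<in> {1..} \<Longrightarrow> f i \<in> zpoly" "finite {i \<in> {1..}. f i \<noteq> 0}" for f :: "nat \<Rightarrow> rat poly"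
      using f finite_unshifted[OF f(2)]
      by (intro bexI[of _ "\<lambda>j. f (Suc j)"]) (auto simp: rows_def)
    show "finite {i \<in> {1..}. y (i - 1) \<noteq> 0}" if "y \<in> rows" for y
      using that finite_shifted[of "\<lambda>j. y j \<noteq> 0"] by (simp add: rows_def)
  qed (auto simp: rscal_add, auto simp: rows_def rscal_def)
  then show ?thesis by (simp add: rowf_def[abs_def])
qed

lemma rowf_inj: "rowf r = rowf s \<Longrightarrow> r = s"
proof
  fix j assume "rowf r = rowf s"
  then have "rowf r (Suc j) = rowf s (Suc j)" by simp
  then show "r j = s j" by (simp add: rowf_def)
qed

text \<open>
  The generator \<open>e\<^sub>j\<close>, and zero for \<open>j = 0\<close>, as \<^const>\<open>free_gen\<close> requires.
\<close>

definition row_gen :: "nat \<Rightarrow> nat \<Rightarrow> rat poly" where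
  "row_gen j l = (if Suc l = j then 1 else 0)"

lemma row_gen_rows: "row_gen j \<in> rows"
proof -
  have "{l. row_gen j l \<noteq> 0} \<subseteq> {j - 1}" by (auto simp: row_gen_def)
  then have "finite {l. row_gen j l \<noteq> 0}" using finite_subset by blast
  then show ?thesis by (auto simp: rows_def row_gen_def)
qed

lemma free_gen_eq: "free_gen p j = rowf (row_gen j)"
proof (cases "j \<ge> 1")
  case True
  then show ?thesis
    by (auto simp: free_gen_def summand_def rowf_def row_gen_def regular_module_def restrict_def)
next
  case False
  then show ?thesis
    by (auto simp: free_gen_def rowf_def row_gen_def direct_sum_def regular_module_def restrict_def)
qed

lemma a_coeff_monom: "a_coeff p k = monom (A_fps $ k) k"
proof -
  have "ku_v ^ k = monom 1 k" by (simp add: monom_power)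
  then show ?thesis
    by (simp add: a_coeff_def A_fps_def of_nat_poly smult_monom)
qed

lemma a_coeff_zpoly [simp, intro]: "a_coeff p k \<in> zpoly"
  unfolding a_coeff_monom using A_fps_zfps by (auto simp: zfps_def)

lemma A_fps_beyond: "k \<ge> p\<^sup>2 \<Longrightarrow> A_fps $ k = 0"
  by (simp add: A_fps_def)

text \<open>
  The multiple \<open>A(Y) r\<close>; applied to \<open>row_gen j\<close> it is the \<open>j\<close>-th defining relation.
\<close>

definition row_relation :: "(nat \<Rightarrow> rat poly) \<Rightarrow> nat \<Rightarrow> rat poly" where
  "row_relation r j = (\<Sum>k\<in>{0..p\<^sup>2 - 1}. a_coeff p k * r (j + k))"

lemma A_fps_range: "k \<notin> {0..p\<^sup>2 - 1} \<Longrightarrow> a_coeff p k = 0"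
  unfolding a_coeff_monom using A_fps_beyond p_gt_1 by (auto simp: not_le)

lemma act_AY_row:
  assumes "g \<in> grids"
  shows "act AY g i = row_relation (g i)"
proof
  fix j
  obtain n where "g \<in> below n" using assms grids_below by blast
  then have b: "bounded_grid n g" by (rule below_bounded)
  define N where "N = n + p\<^sup>2 + 1"
  have bN: "bounded_grid N g" using b by (rule bounded_grid_mono) (simp add: N_def)
  have "act AY g i j = (\<Sum>a<N. \<Sum>b<N. (if a = 0 then a_coeff p b * g i (j + b) else 0))"
    unfolding act_eq[OF bN]
    by (intro sum.cong refl) (auto simp: AY_def embY_def embV_def a_coeff_monom)
  also have "\<dots> = (\<Sum>b<N. \<Sum>a<N. (if a = 0 then a_coeff p b * g i (j + b) else 0))" by (rule sum.swap)
  also have "\<dots> = (\<Sum>b<N. a_coeff p b * g i (j + b))"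
    by (intro sum.cong refl) (simp add: N_def)
  also have "\<dots> = (\<Sum>b\<in>{0..p\<^sup>2 - 1}. a_coeff p b * g i (j + b))"
    by (rule sum.mono_neutral_right) (use A_fps_range in \<open>auto simp: N_def\<close>)
  finally show "act AY g i j = row_relation (g i) j" by (simp add: row_relation_def)
qed

lemma act_AX_col:
  assumes "g \<in> grids"
  shows "act AX g i j = (\<Sum>k\<in>{0..p\<^sup>2 - 1}. a_coeff p k * g (i + k) j)"
proof -
  obtain n where "g \<in> below n" using assms grids_below by blast
  then have b: "bounded_grid n g" by (rule below_bounded)
  define N where "N = n + p\<^sup>2 + 1"
  have bN: "bounded_grid N g" using b by (rule bounded_grid_mono) (simp add: N_def)
  have "act AX g i j = (\<Sum>a<N. \<Sum>b<N. (if b = 0 then a_coeff p a * g (i + a) j else 0))"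
    unfolding act_eq[OF bN]
    by (intro sum.cong refl) (auto simp: AX_def embX_def embV_def a_coeff_monom)
  also have "\<dots> = (\<Sum>a<N. a_coeff p a * g (i + a) j)"
    by (intro sum.cong refl) (simp add: N_def)
  also have "\<dots> = (\<Sum>a\<in>{0..p\<^sup>2 - 1}. a_coeff p a * g (i + a) j)"
    by (rule sum.mono_neutral_right) (use A_fps_range in \<open>auto simp: N_def\<close>)
  finally show ?thesis .
qed

lemma row_relation_add: "row_relation (r + s) = row_relation r + row_relation s"
  by (simp add: row_relation_def fun_eq_iff distrib_left sum.distrib)

lemma row_relation_uminus: "row_relation (- r) = - row_relation r"
  by (simp add: row_relation_def fun_eq_iff sum_negf)

lemma row_relation_rscal: "row_relation (rscal c r) = rscal c (row_relation r)"
  by (simp add: row_relation_def rscal_def fun_eq_iff sum_distrib_left mult.left_commute)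

lemma row_relation_rows:
  assumes "r \<in> rows"
  shows "row_relation r \<in> rows"
proof -
  have "{j. row_relation r j \<noteq> 0} \<subseteq> (\<Union>k\<in>{0..p\<^sup>2 - 1}. (\<lambda>l. l - k) ` {l. r l \<noteq> 0})"
  proof
    fix j assume "j \<in> {j. row_relation r j \<noteq> 0}"
    then obtain k where "k \<in> {0..p\<^sup>2 - 1}" "a_coeff p k * r (j + k) \<noteq> 0"
      unfolding row_relation_def by (auto elim: sum.not_neutral_contains_not_neutral)
    then show "j \<in> (\<Union>k\<in>{0..p\<^sup>2 - 1}. (\<lambda>l. l - k) ` {l. r l \<noteq> 0})"
      by (intro UN_I[of k] image_eqI[of _ _ "j + k"]) auto
  qed
  then have "finite {j. row_relation r j \<noteq> 0}"
    by (rule finite_subset) (use assms in \<open>auto simp: rows_def\<close>)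
  then show ?thesis using assms unfolding rows_def row_relation_def[abs_def]
    by (auto intro!: zpoly_sum zpoly_mult)
qed

definition relation_rows :: "(nat \<Rightarrow> rat poly) set" where
  "relation_rows = row_relation ` rows"

lemma stable_relation_rows: "stable (ku p) rscal relation_rows" "relation_rows \<subseteq> rows"
proof -
  note S = stableD[OF stable_rows, unfolded carrier_ku]
  show "relation_rows \<subseteq> rows" using row_relation_rows by (auto simp: relation_rows_def)
  have "row_relation 0 = 0" by (simp add: row_relation_def fun_eq_iff)
  then have "0 \<in> relation_rows" unfolding relation_rows_def using S(1) by (metis imageI)
  then show "stable (ku p) rscal relation_rows"
    unfolding stable_iff_zpoly relation_rows_def
    using S by (auto simp flip: row_relation_add row_relation_uminus row_relation_rscal)
qed

lemma rows_span:
  assumes T: "stable (ku p) rscal T" and gen: "\<And>j. F (row_gen (Suc j)) \<in> T"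
    and F: "\<And>r s. F (r + s) = F r + F s" "\<And>c r. F (rscal c r) = rscal c (F r)"
  shows "r \<in> rows \<Longrightarrow> F r \<in> T"
proof -
  note S = stableD[OF T, unfolded carrier_ku]
  have F0: "F 0 = 0" using F(1)[of 0 0] by simp
  have "finite A \<Longrightarrow> r \<in> rows \<Longrightarrow> {j. r j \<noteq> 0} \<subseteq> A \<Longrightarrow> F r \<in> T" for A r
  proof (induction A arbitrary: r rule: finite_induct)
    case empty
    then have "r = 0" by (auto simp: fun_eq_iff)
    then show ?case using S(1) by (simp only: F0)
  next
    case (insert a A)
    define s where "s = r(a := 0)"
    have r: "r = s + rscal (r a) (row_gen (Suc a))"
      by (auto simp: s_def fun_eq_iff rscal_def row_gen_def)
    have "s \<in> rows"
    proof -
      have "{j. s j \<noteq> 0} \<subseteq> {j. r j \<noteq> 0}" by (auto simp: s_def)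
      then have "finite {j. s j \<noteq> 0}" using insert.prems(1) finite_subset by (auto simp: rows_def)
      then show ?thesis using insert.prems(1) by (auto simp: rows_def s_def)
    qed
    moreover have "{j. s j \<noteq> 0} \<subseteq> A" using insert.prems(2) by (auto simp: s_def)
    ultimately have "F s \<in> T" by (intro insert.IH)
    moreover have "rscal (r a) (F (row_gen (Suc a))) \<in> T"
      using insert.prems(1) gen S by (auto simp: rows_def)
    ultimately show ?case using S(2) F r by metis
  qed
  then show "r \<in> rows \<Longrightarrow> F r \<in> T" by (auto simp: rows_def)
qed

lemma sum_fun_apply: "sum f A x = (\<Sum>a\<in>A. f a x)"
  by (induction A rule: infinite_finite_induct) auto

text \<open>
  Lowering the index of \<open>e\<^sub>j\<close> is shifting its coefficient function, so the defining relations are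
  the multiples \<open>A(Y) e\<^sub>j\<close>, and they span \<open>A(Y)\<close> times the free module.
\<close>

lemma ku_relations_eq: "ku_relations p = rowf ` relation_rows"
proof -
  have gens: "(\<Oplus>\<^bsub>ku_free p\<^esub>k\<in>{0..p\<^sup>2 - 1}. a_coeff p k \<odot>\<^bsub>ku_free p\<^esub> free_gen p (j - k))
      = rowf (row_relation (row_gen j))" for j
  proof -
    have "a_coeff p k \<odot>\<^bsub>ku_free p\<^esub> free_gen p (j - k) = rowf (rscal (a_coeff p k) (row_gen (j - k)))" for k
      unfolding free_gen_eq using presentsD(5)[OF presents_ku_free] row_gen_rows by (simp add: carrier_ku)
    then have "(\<Oplus>\<^bsub>ku_free p\<^esub>k\<in>{0..p\<^sup>2 - 1}. a_coeff p k \<odot>\<^bsub>ku_free p\<^esub> free_gen p (j - k)) =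
       (\<Oplus>\<^bsub>ku_free p\<^esub>k\<in>{0..p\<^sup>2 - 1}. rowf (rscal (a_coeff p k) (row_gen (j - k))))"
      by (simp only:)
    also have "\<dots> = rowf (\<Sum>k\<in>{0..p\<^sup>2 - 1}. rscal (a_coeff p k) (row_gen (j - k)))"
      by (rule conjunct1[OF presents_finsum[OF presents_ku_free]])
        (use stableD(4)[OF stable_rows] row_gen_rows in \<open>auto simp: carrier_ku\<close>)
    also have "(\<Sum>k\<in>{0..p\<^sup>2 - 1}. rscal (a_coeff p k) (row_gen (j - k))) = row_relation (row_gen j)"
    proof
      fix l
      have "row_gen (j - k) l = row_gen j (l + k)" for k by (auto simp: row_gen_def)
      then show "(\<Sum>k\<in>{0..p\<^sup>2 - 1}. rscal (a_coeff p k) (row_gen (j - k))) l = row_relation (row_gen j) l"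
        by (simp add: row_relation_def rscal_def sum_fun_apply)
    qed
    finally show ?thesis .
  qed
  have "ku_relations p = gen_submodule (ku p) (ku_free p) (rowf ` {row_relation (row_gen j) | j. j \<ge> 1})"
    unfolding ku_relations_def gens by (rule arg_cong[of _ _ "gen_submodule _ _"]) blast
  also have "\<dots> = rowf ` relation_rows"
  proof (rule presents_gen_submodule[OF presents_ku_free stable_relation_rows])
    show "{row_relation (row_gen j) | j. j \<ge> 1} \<subseteq> relation_rows"
      using row_gen_rows by (auto simp: relation_rows_def)
    show "relation_rows \<subseteq> T" if T: "stable (ku p) rscal T" "{row_relation (row_gen j) | j. j \<ge> 1} \<subseteq> T" for T
    proof -
      have "row_relation (row_gen (Suc j)) \<in> T" for j using T(2) by (auto intro!: exI[of _ "Suc j"])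
      then show ?thesis
        using rows_span[OF T(1), of row_relation] row_relation_add row_relation_rscal
        by (auto simp: relation_rows_def)
    qed
  qed
  finally show ?thesis .
qed

definition cls :: "(nat \<Rightarrow> rat poly) \<Rightarrow> (nat \<Rightarrow> rat poly) set" where
  "cls r = ku_relations p +>\<^bsub>ku_free p\<^esub> rowf r"

lemma presents_ku_Z: "presents (ku p) rscal rows cls (ku_Z p)"
  and cls_eq: "r \<in> rows \<Longrightarrow> s \<in> rows \<Longrightarrow> cls r = cls s \<longleftrightarrow> r - s \<in> relation_rows"
proof -
  have ker: "r - s \<in> relation_rows" if "rowf r = rowf s" for r s
    using rowf_inj[OF that] stableD(1)[OF stable_relation_rows(1)] by simp
  note q = presents_quotient[OF presents_ku_free stable_relation_rows ker]
  show "presents (ku p) rscal rows cls (ku_Z p)"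
    using q(1) by (simp add: cls_def[abs_def] ku_Z_def ku_relations_eq)
  show "r \<in> rows \<Longrightarrow> s \<in> rows \<Longrightarrow> cls r = cls s \<longleftrightarrow> r - s \<in> relation_rows"
    using q(2) by (simp add: cls_def ku_relations_eq)
qed

lemma e_gen_eq: "e_gen p j = cls (row_gen j)"
  by (simp add: e_gen_def cls_def free_gen_eq)

lemma diff_diff_self: "a - (a - b) = (b :: 'a::ab_group_add)"
  by simp

lemma zero_plus_set: "{x + y | x y. x \<in> {0} \<and> y \<in> B} = (B :: 'a::ab_group_add set)"
  by auto

lemma grids_iff: "g \<in> grids \<longleftrightarrow> (\<forall>i j. g i j \<in> zpoly) \<and> finite {(i, j). g i j \<noteq> 0}"
proof
  assume "g \<in> grids"
  then obtain n where n: "g \<in> below n" using grids_below by blast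
  then have "{(i, j). g i j \<noteq> 0} \<subseteq> {..<n} \<times> {..<n}"
    using below_bounded[OF n] by (auto simp: bounded_grid_def not_less[symmetric])
  then have "finite {(i, j). g i j \<noteq> 0}" by (rule finite_subset) simp
  then show "(\<forall>i j. g i j \<in> zpoly) \<and> finite {(i, j). g i j \<noteq> 0}" using n below_zpoly by blast
next
  assume h: "(\<forall>i j. g i j \<in> zpoly) \<and> finite {(i, j). g i j \<noteq> 0}"
  define S where "S = (\<lambda>(i, j). wt i j) ` {(i, j). g i j \<noteq> 0}"
  have "finite S" using h by (simp add: S_def)
  then have "g \<in> below (Suc (Max (insert 0 S)))"
    using h by (auto simp: below_def S_def less_Suc_eq_le intro!: Max_ge)
  then show "g \<in> grids" by (rule gridsI)
qed

lemma act_zero: "act s 0 = 0"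
  by (simp add: act_def fun_eq_iff)

lemma below_0_eq: "below 0 = {0}"
  using below_0_iff by blast

lemma kernel_zero: "0 \<in> kernel"
  using kernel_AY[OF grids_0] unfolding act_zero .

lemma stable_grids: "stable (ku p) scal grids"
  unfolding stable_iff_zpoly by auto

lemma scal_add: "scal c (g + h) = scal c g + scal c h"
  by (simp add: scal_def fun_eq_iff distrib_left)

lemma grids_row: "g \<in> grids \<Longrightarrow> g i \<in> rows"
proof -
  assume g: "g \<in> grids"
  have "{j. g i j \<noteq> 0} \<subseteq> snd ` {(i, j). g i j \<noteq> 0}" by (auto simp: image_iff)
  then have "finite {j. g i j \<noteq> 0}" by (rule finite_subset) (use g in \<open>simp add: grids_iff\<close>)
  then show ?thesis using g by (auto simp: rows_def grids_iff)
qed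

lemma grids_of_rows:
  assumes "\<And>i. g i \<in> rows" "finite {i. g i \<noteq> 0}"
  shows "g \<in> grids"
proof -
  have "{(i, j). g i j \<noteq> 0} \<subseteq> Sigma {i. g i \<noteq> 0} (\<lambda>i. {j. g i j \<noteq> 0})" by (auto simp: fun_eq_iff)
  moreover have "finite (Sigma {i. g i \<noteq> 0} (\<lambda>i. {j. g i j \<noteq> 0}))"
    using assms by (intro finite_SigmaI) (auto simp: rows_def)
  ultimately have "finite {(i, j). g i j \<noteq> 0}" by (rule finite_subset)
  then show ?thesis using assms(1) by (auto simp: grids_iff rows_def)
qed

lemma grids_finite_rows: "g \<in> grids \<Longrightarrow> finite {i. g i \<noteq> 0}"
proof -
  assume g: "g \<in> grids"
  have "{i. g i \<noteq> 0} \<subseteq> fst ` {(i, j). g i j \<noteq> 0}" by (force simp: fun_eq_iff image_iff)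
  then show ?thesis by (rule finite_subset) (use g in \<open>simp add: grids_iff\<close>)
qed

text \<open>
  The element of \<open>F \<otimes> ku\<^sub>*(\<int>\<^bsub>p\<^sup>2\<^esub>)\<close> whose component at \<open>\<alpha>\<^sub>i\<^sub>+\<^sub>1\<close> is the class of the row \<open>g i\<close>.
\<close>

definition tens :: "grid \<Rightarrow> nat \<Rightarrow> (nat \<Rightarrow> rat poly) set" where
  "tens g = (\<lambda>i\<in>{1..}. cls (g (i - 1)))"

lemma presents_tens: "presents (ku p) scal grids tens (F_tensor_ku p)"
proof -
  have "presents (ku p) scal grids (\<lambda>y. \<lambda>i\<in>{1..}. cls ((\<lambda>i y. y (i - 1)) i y)) (direct_sum {1..} (\<lambda>_. ku_Z p))"
  proof (rule presents_direct_sum[OF presents_ku_Z stable_grids])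
    show "\<exists>y\<in>grids. \<forall>i\<in>{1..}. cls (y (i - 1)) = cls (f i)"
      if f: "\<And>i. i \<in> {1..} \<Longrightarrow> f i \<in> rows" "finite {i \<in> {1..}. f i \<noteq> 0}" for f :: grid
    proof (intro bexI ballI)
      show "cls (f (Suc (i - 1))) = cls (f i)" if "i \<in> {1..}" for i using that by simp
      show "(\<lambda>i. f (Suc i)) \<in> grids"
        using f(1) finite_unshifted[OF f(2)] by (intro grids_of_rows) auto
    qed
    show "finite {i \<in> {1..}. y (i - 1) \<noteq> 0}" if "y \<in> grids" for y
      using finite_shifted[OF grids_finite_rows[OF that]] .
  qed (auto simp: scal_add grids_row, auto simp: scal_def rscal_def)
  then show ?thesis by (simp add: tens_def[abs_def] F_tensor_ku_def)
qed

text \<open>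
  Rows are equal modulo relations exactly if they differ by multiples \<open>A(Y) t\<^sub>i\<close>; choosing \<open>t\<^sub>i = 0\<close>
  for zero rows makes the \<open>t\<^sub>i\<close> a grid.
\<close>

lemma tens_eq:
  assumes g: "g \<in> grids" "h \<in> grids"
  shows "tens g = tens h \<longleftrightarrow> (\<exists>t\<in>grids. g - h = act AY t)"
proof -
  have rows: "g i \<in> rows" "h i \<in> rows" for i using g by (auto intro: grids_row)
  have "tens g = tens h \<longleftrightarrow> (\<forall>i. cls (g i) = cls (h i))"
  proof
    assume e: "tens g = tens h"
    show "\<forall>i. cls (g i) = cls (h i)"
    proof
      fix i
      have "tens g (Suc i) = tens h (Suc i)" using e by simp
      then show "cls (g i) = cls (h i)" by (simp add: tens_def)
    qed
  qed (simp add: tens_def)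
  also have "\<dots> \<longleftrightarrow> (\<forall>i. (g - h) i \<in> relation_rows)" using rows by (simp add: cls_eq)
  also have "\<dots> \<longleftrightarrow> (\<exists>t\<in>grids. g - h = act AY t)"
  proof
    assume "\<forall>i. (g - h) i \<in> relation_rows"
    then have "\<forall>i. \<exists>r. r \<in> rows \<and> (g - h) i = row_relation r" by (auto simp: relation_rows_def)
    then obtain t0 where t0: "\<And>i. t0 i \<in> rows" "\<And>i. (g - h) i = row_relation (t0 i)" by metis
    define t where "t i = (if (g - h) i = 0 then 0 else t0 i)" for i
    have r0: "row_relation 0 = 0" by (simp add: row_relation_def fun_eq_iff)
    have tr: "(g - h) i = row_relation (t i)" for i
      using t0(2) r0 by (auto simp: t_def simp del: fun_diff_def)
    have "finite {i. t i \<noteq> 0}"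
      by (rule finite_subset[OF _ grids_finite_rows[OF grids_diff[OF g]]]) (auto simp: t_def)
    then have tg: "t \<in> grids"
      using t0(1) stableD(1)[OF stable_rows] by (intro grids_of_rows) (auto simp: t_def)
    have "g - h = act AY t" by (rule ext) (simp only: act_AY_row[OF tg] tr)
    then show "\<exists>t\<in>grids. g - h = act AY t" using tg by blast
  next
    assume "\<exists>t\<in>grids. g - h = act AY t"
    then obtain t where t: "t \<in> grids" "g - h = act AY t" by blast
    show "\<forall>i. (g - h) i \<in> relation_rows"
      unfolding t(2) act_AY_row[OF t(1)] relation_rows_def using grids_row[OF t(1)] by blast
  qed
  finally show ?thesis .
qed

text \<open>
  The generator \<open>[i,j]\<close> with the original indices starting at \<open>1\<close>.
\<close>

definition cell :: "nat \<Rightarrow> nat \<Rightarrow> grid" where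
  "cell i j a b = (if Suc a = i \<and> Suc b = j then 1 else 0)"

lemma cell_grids: "cell i j \<in> grids"
proof -
  have "{(a, b). cell i j a b \<noteq> 0} \<subseteq> {(i - 1, j - 1)}" by (auto simp: cell_def)
  then have "finite {(a, b). cell i j a b \<noteq> 0}" using finite_subset by blast
  then show ?thesis by (auto simp: grids_iff cell_def)
qed

lemma bracket_eq:
  assumes "i \<ge> 1" "c \<in> zpoly"
  shows "bracket p c i j = tens (scal c (cell i j))"
proof -
  have 1: "c \<odot>\<^bsub>ku_Z p\<^esub> e_gen p j = cls (rscal c (row_gen j))"
    unfolding e_gen_eq using presentsD(5)[OF presents_ku_Z] row_gen_rows assms(2) by (simp add: carrier_ku)
  have 2: "\<zero>\<^bsub>ku_Z p\<^esub> = cls 0" by (rule presentsD(3)[OF presents_ku_Z])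
  have 3: "scal c (cell i j) (k - 1) = (if k = i then rscal c (row_gen j) else 0)" if "k \<ge> 1" for k
    using that assms(1) by (auto simp: scal_def cell_def rscal_def row_gen_def fun_eq_iff)
  show ?thesis
  proof (rule ext)
    fix k
    have "bracket p c i j = summand {1..} (\<lambda>_. ku_Z p) i (cls (rscal c (row_gen j)))"
      using assms(1) by (simp add: bracket_def 1)
    then show "bracket p c i j k = tens (scal c (cell i j)) k"
      using 3[of k] by (simp add: summand_def tens_def 2)
  qed
qed

lemma boundary_eq:
  assumes "g \<in> grids"
  shows "boundary p (tens g) = tens (act AX g)"
proof -
  have "(\<Oplus>\<^bsub>ku_Z p\<^esub>k\<in>{0..p\<^sup>2 - 1}. a_coeff p k \<odot>\<^bsub>ku_Z p\<^esub> tens g (i + k)) = cls (act AX g (i - 1))"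
    if i: "i \<ge> 1" for i
  proof -
    have "a_coeff p k \<odot>\<^bsub>ku_Z p\<^esub> tens g (i + k) = cls (rscal (a_coeff p k) (g (i - 1 + k)))" for k
      using presentsD(5)[OF presents_ku_Z, of "a_coeff p k" "g (i - 1 + k)"] grids_row[OF assms] i
      by (simp add: carrier_ku tens_def)
    then have "(\<Oplus>\<^bsub>ku_Z p\<^esub>k\<in>{0..p\<^sup>2 - 1}. a_coeff p k \<odot>\<^bsub>ku_Z p\<^esub> tens g (i + k)) =
       (\<Oplus>\<^bsub>ku_Z p\<^esub>k\<in>{0..p\<^sup>2 - 1}. cls (rscal (a_coeff p k) (g (i - 1 + k))))" by (simp only:)
    also have "\<dots> = cls (\<Sum>k\<in>{0..p\<^sup>2 - 1}. rscal (a_coeff p k) (g (i - 1 + k)))"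
      by (rule conjunct1[OF presents_finsum[OF presents_ku_Z]])
        (use stableD(4)[OF stable_rows] grids_row[OF assms] in \<open>auto simp: carrier_ku\<close>)
    also have "(\<Sum>k\<in>{0..p\<^sup>2 - 1}. rscal (a_coeff p k) (g (i - 1 + k))) = act AX g (i - 1)"
      by (rule ext) (simp only: act_AX_col[OF assms] sum_fun_apply rscal_def)
    finally show ?thesis .
  qed
  then show ?thesis unfolding boundary_def tens_def[of "act AX g"] by (intro restrict_ext) simp
qed

lemma grids_span:
  assumes T: "stable (ku p) scal T" and gen: "\<And>i j. I i j \<Longrightarrow> F (cell (Suc i) (Suc j)) \<in> T"
    and F: "\<And>r s. F (r + s) = F r + F s" "\<And>c r. F (scal c r) = scal c (F r)"
    and g: "g \<in> grids" "\<And>i j. g i j \<noteq> 0 \<Longrightarrow> I i j"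
  shows "F g \<in> T"
proof -
  note S = stableD[OF T, unfolded carrier_ku]
  have F0: "F 0 = 0" using F(1)[of 0 0] by simp
  have "finite A \<Longrightarrow> g \<in> grids \<Longrightarrow> (\<forall>i j. g i j \<noteq> 0 \<longrightarrow> I i j) \<Longrightarrow> {(i, j). g i j \<noteq> 0} \<subseteq> A \<Longrightarrow> F g \<in> T" for A g
  proof (induction A arbitrary: g rule: finite_induct)
    case empty
    then have "g = 0" by (auto simp: fun_eq_iff)
    then show ?case using S(1) by (simp only: F0)
  next
    case (insert x A)
    obtain a b where x: "x = (a, b)" by (cases x)
    define s where "s i j = (if i = a \<and> j = b then 0 else g i j)" for i j
    have r: "g = s + scal (g a b) (cell (Suc a) (Suc b))"
      by (auto simp: s_def fun_eq_iff scal_def cell_def)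
    have "finite {(i, j). s i j \<noteq> 0}"
      by (rule finite_subset[of _ "{(i, j). g i j \<noteq> 0}"])
        (use insert.prems(1) in \<open>auto simp: s_def grids_iff\<close>)
    then have "s \<in> grids" using insert.prems(1) by (auto simp: grids_iff s_def)
    moreover have "\<forall>i j. s i j \<noteq> 0 \<longrightarrow> I i j" using insert.prems(2) by (auto simp: s_def)
    moreover have "{(i, j). s i j \<noteq> 0} \<subseteq> A" using insert.prems(3) by (auto simp: s_def x split: if_splits)
    ultimately have s: "F s \<in> T" by (intro insert.IH)
    have "scal (g a b) (F (cell (Suc a) (Suc b))) \<in> T"
    proof (cases "g a b = 0")
      case True
      then have "scal (g a b) (F (cell (Suc a) (Suc b))) = 0" by (simp add: scal_def fun_eq_iff)
      then show ?thesis using S(1) by (simp only:)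
    next
      case False
      then show ?thesis using insert.prems(1,2) gen S by (auto simp: grids_iff)
    qed
    then show ?case using S(2)[OF s] F r by metis
  qed
  then show ?thesis using g by (auto simp: grids_iff)
qed

text \<open>
  Filtration at most \<open>s\<close> is weight less than \<open>level s\<close>; \<open>wt 1 1\<close> accounts for the shift of indices.
\<close>

definition level :: "int \<Rightarrow> nat" where
  "level s = nat (s - int (wt 1 1) + 1)"

lemma filtration_wt: "filtration p (Suc i) (Suc j) = int (wt i j + wt 1 1)"
  by (simp add: filtration_def wt_def algebra_simps)

lemma level_pred: "level (s - 1) = level s - 1"
  by (simp add: level_def)

lemma filtration_le_level: "filtration p (Suc i) (Suc j) \<le> s \<longleftrightarrow> wt i j < level s"
  unfolding filtration_wt level_def by linarith

lemma filtration_eq_level: "filtration p (Suc i) (Suc j) = s \<longleftrightarrow> Suc (wt i j) = level s"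
  unfolding filtration_wt level_def by linarith

lemma stable_below: "stable (ku p) scal (below m)"
  unfolding stable_iff_zpoly by auto

lemma below_grids: "below m \<subseteq> grids"
  by auto

lemma kunneth_filtration_eq:
  assumes "n = 0 \<or> n = 1"
  shows "kunneth_filtration p n s = tens ` below (level s)"
proof -
  have "{bracket p 1 i j | i j. i \<ge> 1 \<and> j \<ge> 1 \<and> filtration p i j \<le> s} =
      tens ` {cell (Suc i) (Suc j) | i j. wt i j < level s}"
  proof -
    have "{bracket p 1 i j | i j. i \<ge> 1 \<and> j \<ge> 1 \<and> filtration p i j \<le> s} =
        {bracket p 1 (Suc i) (Suc j) | i j. filtration p (Suc i) (Suc j) \<le> s}"
      by (intro Collect_cong) (metis Suc_le_D le_add1 plus_1_eq_Suc One_nat_def)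
    also have "\<dots> = {tens (cell (Suc i) (Suc j)) | i j. wt i j < level s}"
    proof -
      have "scal 1 g = g" for g by (simp add: scal_def fun_eq_iff)
      then show ?thesis unfolding filtration_le_level by (simp add: bracket_eq)
    qed
    finally show ?thesis by blast
  qed
  moreover have "gen_submodule (ku p) (F_tensor_ku p) (tens ` {cell (Suc i) (Suc j) | i j. wt i j < level s})
     = tens ` below (level s)"
  proof (rule presents_gen_submodule[OF presents_tens stable_below below_grids])
    show "{cell (Suc i) (Suc j) | i j. wt i j < level s} \<subseteq> below (level s)"
      by (auto simp: below_def cell_def split: if_splits)
    show "below (level s) \<subseteq> T"
      if T: "stable (ku p) scal T" "{cell (Suc i) (Suc j) | i j. wt i j < level s} \<subseteq> T" for T
    proof
      fix g assume g: "g \<in> below (level s)"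
      show "g \<in> T"
        by (rule grids_span[OF T(1), of "\<lambda>i j. wt i j < level s" "\<lambda>g. g"])
          (use g T(2) in \<open>auto simp: below_def intro: gridsI[of _ "level s"]\<close>)
    qed
  qed
  ultimately show ?thesis using assms by (simp add: kunneth_filtration_def)
qed

section \<open>The infinity page\<close>

text \<open>
  The grids below \<open>m\<close> whose coefficients at the top weight \<open>m - 1\<close> lie in \<open>J\<close>.
\<close>

definition lead_in :: "nat \<Rightarrow> (nat \<Rightarrow> nat \<Rightarrow> rat poly set) \<Rightarrow> grid set" where
  "lead_in m J = {g \<in> below m. \<forall>i j. Suc (wt i j) = m \<longrightarrow> g i j \<in> J i j}"

definition kernel_ideal :: "nat \<Rightarrow> nat \<Rightarrow> rat poly set" where
  "kernel_ideal i j = {of_nat (kernel_multiple i j) * c | c. c \<in> zpoly}"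

definition psq_ideal :: "rat poly set" where
  "psq_ideal = {of_nat p ^ 2 * c | c. c \<in> zpoly}"

lemma tens_set_add:
  "X \<subseteq> grids \<Longrightarrow> Y \<subseteq> grids \<Longrightarrow> tens ` X <+>\<^bsub>F_tensor_ku p\<^esub> tens ` Y = tens ` {x + y | x y. x \<in> X \<and> y \<in> Y}"
  by (rule presents_set_add[OF presents_tens])

lemma F_zero: "\<zero>\<^bsub>F_tensor_ku p\<^esub> = tens 0"
  by (rule presentsD(3)[OF presents_tens])

abbreviation "Cku \<equiv> F_tensor_ku p"
abbreviation "dku \<equiv> kunneth_d p"
abbreviation "Fku \<equiv> kunneth_filtration p"

lemma Z_infinity_0: "Z_infinity Cku dku Fku 0 s = tens ` below (level s)"
proof -
  have "approx_cycles dku Fku r 0 s = tens ` below (level s)" for r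
    by (auto simp: approx_cycles_def kunneth_d_def kunneth_filtration_eq)
      (simp add: kunneth_filtration_def)
  then have "Z_infinity Cku dku Fku 0 s = tens ` below (level s) <+>\<^bsub>Cku\<^esub> tens ` below (level s - 1)"
    by (simp add: Z_infinity_def kunneth_filtration_eq level_pred)
  also have "\<dots> = tens ` {x + y | x y. x \<in> below (level s) \<and> y \<in> below (level s - 1)}"
    by (rule tens_set_add[OF below_grids below_grids])
  also have "{x + y | x y. x \<in> below (level s) \<and> y \<in> below (level s - 1)} = below (level s)"
  proof (intro Set.set_eqI iffI)
    fix z assume "z \<in> {x + y | x y. x \<in> below (level s) \<and> y \<in> below (level s - 1)}"
    then obtain x y where "z = x + y" "x \<in> below (level s)" "y \<in> below (level s - 1)" by blast
    then show "z \<in> below (level s)" using below_mono[of y "level s - 1" "level s"] by auto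
  next
    fix z assume "z \<in> below (level s)"
    moreover have "z = z + 0" by simp
    ultimately show "z \<in> {x + y | x y. x \<in> below (level s) \<and> y \<in> below (level s - 1)}"
      using zero_below by blast
  qed
  finally show ?thesis .
qed

lemma lead_in_kernel:
  "lead_in m kernel_ideal = {k + h | k h. k \<in> kernel \<inter> below m \<and> h \<in> below (m - 1)}"
proof (cases m)
  case 0
  have "{k + h | k h. k \<in> kernel \<inter> below 0 \<and> h \<in> below 0} = {0}"
    unfolding below_0_eq using kernel_zero by force
  moreover have "lead_in 0 kernel_ideal = {0}" by (auto simp: lead_in_def below_0_iff)
  ultimately show ?thesis using 0 by simp
next
  case (Suc n)
  show ?thesis
  proof (intro Set.set_eqI iffI)
    fix g assume "g \<in> lead_in m kernel_ideal"
    then have g: "g \<in> below (Suc n)" "\<And>i j. wt i j = n \<Longrightarrow> \<exists>c\<in>zpoly. g i j = of_nat (kernel_multiple i j) * c"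
      by (auto simp: lead_in_def kernel_ideal_def Suc)
    obtain k where k: "k \<in> kernel" "g - k \<in> below n"
      using kernel_leading_terms_realized[OF g] by blast
    have "g - (g - k) \<in> below (Suc n)"
      using g(1) below_mono[OF k(2) le_SucI[OF le_refl]] by (rule below_diff)
    moreover have "g - (g - k) = k" by (rule diff_diff_self)
    ultimately have "k \<in> below (Suc n)" by (simp only:)
    moreover have "g = k + (g - k)" by simp
    moreover have "k \<in> kernel \<inter> below m" "g - k \<in> below (m - 1)"
      using k Suc \<open>k \<in> below (Suc n)\<close> by simp_all
    ultimately show "g \<in> {k + h | k h. k \<in> kernel \<inter> below m \<and> h \<in> below (m - 1)}"
      by blast
  next
    fix g assume "g \<in> {k + h | k h. k \<in> kernel \<inter> below m \<and> h \<in> below (m - 1)}"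
    then obtain k h where kh: "g = k + h" "k \<in> kernel" "k \<in> below (Suc n)" "h \<in> below n"
      using Suc by auto
    have "g \<in> below (Suc n)" using kh below_mono[OF kh(4), of "Suc n"] by auto
    moreover have "g i j \<in> kernel_ideal i j" if "wt i j = n" for i j
    proof -
      have "h i j = 0" by (rule below_zero[OF kh(4)]) (simp add: that)
      then show ?thesis using kernel_leading_terms[OF kh(2,3) that] kh(1) by (auto simp: kernel_ideal_def)
    qed
    ultimately show "g \<in> lead_in m kernel_ideal" by (auto simp: lead_in_def Suc)
  qed
qed

lemma tens_0_mem: "tens 0 \<in> tens ` below m"
  using zero_below by (rule imageI)

text \<open>
  The filtration vanishes in negative degrees, so an \<open>r\<close>-approximate cycle is a cycle as soon as \<open>r\<close>
  is large.
\<close>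

lemma Z_infinity_1: "Z_infinity Cku dku Fku 1 s = tens ` lead_in (level s) kernel_ideal"
proof -
  have step: "approx_cycles dku Fku r 1 s = tens ` {g \<in> below (level s). tens (act AX g) \<in> tens ` below (level (s - int r))}" for r
    by (auto simp: approx_cycles_def kunneth_d_def kunneth_filtration_eq boundary_eq gridsI)
  have Z: "Z_infinity Cku dku Fku 1 s = (\<Inter>r. tens ` {k + h | k h. k \<in> {g \<in> below (level s).
      tens (act AX g) \<in> tens ` below (level (s - int r))} \<and> h \<in> below (level s - 1)})"
    unfolding Z_infinity_def step using tens_set_add below_grids
    by (intro INF_cong refl, subst tens_set_add[symmetric])
      (auto simp: kunneth_filtration_eq level_pred intro: gridsI)
  have kernel_tens: "tens (act AX g) = tens 0 \<longleftrightarrow> g \<in> kernel" if "g \<in> grids" for g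
    using tens_eq[of "act AX g" 0] that by (auto simp: kernel_def)
  have "(\<Inter>r. tens ` {k + h | k h. k \<in> {g \<in> below (level s).
      tens (act AX g) \<in> tens ` below (level (s - int r))} \<and> h \<in> below (level s - 1)}) =
     tens ` {k + h | k h. k \<in> kernel \<inter> below (level s) \<and> h \<in> below (level s - 1)}" (is "(\<Inter>r. ?A r) = ?B")
  proof
    \<comment> \<open>For \<open>r > \<bar>s\<bar>\<close> the target lies in negative filtration, which is zero.\<close>
    have "level (s - int (nat \<bar>s\<bar> + 1)) = 0" unfolding level_def by linarith
    moreover have "tens ` below 0 = {tens 0}" unfolding below_0_eq by (simp only: image_insert image_empty)
    then have "{g \<in> below (level s). tens (act AX g) \<in> tens ` below 0} = kernel \<inter> below (level s)"
      using kernel_tens by (auto simp: gridsI)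
    ultimately have AB: "?A (nat \<bar>s\<bar> + 1) = ?B" by (simp only:)
    have "(\<Inter>r. ?A r) \<subseteq> ?A (nat \<bar>s\<bar> + 1)" by (rule INT_lower) simp
    then show "(\<Inter>r. ?A r) \<subseteq> ?B" unfolding AB .
    show "?B \<subseteq> (\<Inter>r. ?A r)"
    proof (rule INT_greatest, rule image_mono)
      fix r
      have "tens (act AX k) \<in> tens ` below (level (s - int r))" if "k \<in> kernel \<inter> below (level s)" for k
      proof -
        have "k \<in> grids" using that by (auto intro: gridsI)
        then have "tens (act AX k) = tens 0" using kernel_tens that by blast
        then show ?thesis using tens_0_mem by (simp only:)
      qed
      then show "{k + h | k h. k \<in> kernel \<inter> below (level s) \<and> h \<in> below (level s - 1)} \<subseteq>
         {k + h | k h. k \<in> {g \<in> below (level s). tens (act AX g) \<in> tens ` below (level (s - int r))} \<and>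
            h \<in> below (level s - 1)}" by blast
    qed
  qed
  then show ?thesis unfolding Z lead_in_kernel .
qed

lemma lead_in_image:
  "lead_in m (\<lambda>_ _. image_ideal) =
     {g \<in> below m. \<exists>f\<in>grids. \<exists>t\<in>grids. g - (act AX f + act AY t) \<in> below (m - 1)}"
proof (cases m)
  case 0
  have "0 - (act AX 0 + act AY 0) \<in> below 0" by (simp only: act_zero) simp
  then have "\<exists>f\<in>grids. \<exists>t\<in>grids. 0 - (act AX f + act AY t) \<in> below 0" using grids_0 by blast
  then have "{g \<in> below 0. \<exists>f\<in>grids. \<exists>t\<in>grids. g - (act AX f + act AY t) \<in> below 0} = {0}"
    unfolding below_0_eq by blast
  moreover have "lead_in 0 (\<lambda>_ _. image_ideal) = {0}" by (auto simp: lead_in_def below_0_iff)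
  ultimately show ?thesis using 0 by simp
next
  case (Suc n)
  show ?thesis
  proof (intro Set.set_eqI iffI)
    fix g assume "g \<in> lead_in m (\<lambda>_ _. image_ideal)"
    then show "g \<in> {g \<in> below m. \<exists>f\<in>grids. \<exists>t\<in>grids. g - (act AX f + act AY t) \<in> below (m - 1)}"
      using image_leading_terms_realized[of g n] by (auto simp: lead_in_def Suc)
  next
    fix g assume "g \<in> {g \<in> below m. \<exists>f\<in>grids. \<exists>t\<in>grids. g - (act AX f + act AY t) \<in> below (m - 1)}"
    then obtain f t where g: "g \<in> below (Suc n)" "f \<in> grids" "t \<in> grids"
        "g - (act AX f + act AY t) \<in> below n" using Suc by auto
    have "g - (g - (act AX f + act AY t)) \<in> below (Suc n)"
      using g(1) below_mono[OF g(4) le_SucI[OF le_refl]] by (rule below_diff)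
    moreover have "g - (g - (act AX f + act AY t)) = act AX f + act AY t"
      by (rule diff_diff_self)
    ultimately have b: "act AX f + act AY t \<in> below (Suc n)" by (simp only:)
    have "g i j \<in> image_ideal" if "wt i j = n" for i j
    proof -
      have "(g - (act AX f + act AY t)) i j = 0" by (rule below_zero[OF g(4)]) (simp add: that)
      then show ?thesis using image_leading_terms[OF g(2,3) b that] by simp
    qed
    then show "g \<in> lead_in m (\<lambda>_ _. image_ideal)" using g by (auto simp: lead_in_def Suc)
  qed
qed

text \<open>
  The filtration is exhaustive, so every boundary that lies in filtration \<open>s\<close> is the boundary of an
  approximate cycle for some \<open>r\<close>.
\<close>

lemma B_infinity_0: "B_infinity Cku dku Fku 0 s = tens ` lead_in (level s) (\<lambda>_ _. image_ideal)"
proof -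
  have step: "dku (0 + 1) ` approx_cycles dku Fku r (0 + 1) (s + int r) =
     tens ` act AX ` {f \<in> below (level (s + int r)). tens (act AX f) \<in> tens ` below (level s)}" for r
  proof -
    have "approx_cycles dku Fku r (0 + 1) (s + int r) =
       tens ` {f \<in> below (level (s + int r)). tens (act AX f) \<in> tens ` below (level s)}"
      by (auto simp: approx_cycles_def kunneth_d_def kunneth_filtration_eq boundary_eq gridsI)
    moreover have "dku (0 + 1) (tens f) = tens (act AX f)" if "f \<in> below N" for f N
      using that by (simp add: kunneth_d_def boundary_eq gridsI)
    ultimately show ?thesis by (simp only: image_image) (rule image_cong, auto)
  qed
  have B: "B_infinity Cku dku Fku 0 s = (\<Union>r. tens ` {y + h | y h. y \<in> act AX ` {f \<in> below (level (s + int r)).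
      tens (act AX f) \<in> tens ` below (level s)} \<and> h \<in> below (level s - 1)})"
    unfolding B_infinity_def step
    by (intro SUP_cong refl, subst tens_set_add[symmetric])
      (auto simp: kunneth_filtration_eq level_pred intro: gridsI)
  show ?thesis unfolding B lead_in_image
  proof (intro Set.set_eqI iffI)
    fix z assume "z \<in> (\<Union>r. tens ` {y + h | y h. y \<in> act AX ` {f \<in> below (level (s + int r)).
      tens (act AX f) \<in> tens ` below (level s)} \<and> h \<in> below (level s - 1)})"
    then obtain r f h where f: "f \<in> below (level (s + int r))" "tens (act AX f) \<in> tens ` below (level s)"
       "h \<in> below (level s - 1)" "z = tens (act AX f + h)" by blast
    obtain y where y: "y \<in> below (level s)" "tens (act AX f) = tens y" using f(2) by blast
    have gr: "f \<in> grids" "y \<in> grids" "h \<in> grids" using f y by auto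
    obtain t where t: "t \<in> grids" "act AX f - y = act AY t"
      using tens_eq[of "act AX f" y] y(2) gr by auto
    have hb: "h \<in> below (level s)" using f(3) by (rule below_mono) simp
    have e: "act AX f + h - (y + h) = act AY t" using t(2) by simp
    have "z = tens (y + h)"
      unfolding f(4) using tens_eq[of "act AX f + h" "y + h"] gr e t(1) by auto
    moreover have "(y + h) - (act AX f + act AY (- t)) = h"
      unfolding act_uminus[OF t(1)] t(2)[symmetric] by simp
    then have "\<exists>f\<in>grids. \<exists>t\<in>grids. (y + h) - (act AX f + act AY t) \<in> below (level s - 1)"
      using gr t f(3) grids_uminus by metis
    ultimately show "z \<in> tens ` {g \<in> below (level s). \<exists>f\<in>grids. \<exists>t\<in>grids. g - (act AX f + act AY t) \<in> below (level s - 1)}"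
      using below_add[OF y(1) hb] by blast
  next
    fix z assume "z \<in> tens ` {g \<in> below (level s). \<exists>f\<in>grids. \<exists>t\<in>grids. g - (act AX f + act AY t) \<in> below (level s - 1)}"
    then obtain g f t where g: "z = tens g" "g \<in> below (level s)" "f \<in> grids" "t \<in> grids"
       "g - (act AX f + act AY t) \<in> below (level s - 1)" by blast
    define h where "h = g - (act AX f + act AY t)"
    have h: "h \<in> below (level s - 1)" unfolding h_def by (rule g(5))
    have hb: "h \<in> below (level s)" using h by (rule below_mono) simp
    have gr: "g \<in> grids" "h \<in> grids" using g hb by auto
    obtain N where N: "f \<in> below N" using g(3) grids_below by blast
    \<comment> \<open>Large enough for \<open>f\<close> to have filtration at most \<open>s + r\<close>.\<close>
    define r where "r = N + nat \<bar>s\<bar> + wt 1 1"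
    have "N \<le> level (s + int r)" by (simp add: level_def r_def)
    then have fb: "f \<in> below (level (s + int r))" using N below_mono by blast
    have e: "g - (act AX f + h) = act AY t" unfolding h_def by simp
    have z: "z = tens (act AX f + h)" unfolding g(1) using tens_eq[of g "act AX f + h"] gr g e by auto
    have e2: "act AX f - (g - h) = act AY (- t)" unfolding h_def act_uminus[OF g(4)] by simp
    have "tens (act AX f) = tens (g - h)"
      using tens_eq[of "act AX f" "g - h"] gr g e2 grids_uminus[OF g(4)] by auto
    moreover have "g - h \<in> below (level s)" using g(2) hb by (rule below_diff)
    ultimately have "tens (act AX f) \<in> tens ` below (level s)" by blast
    then show "z \<in> (\<Union>r. tens ` {y + h | y h. y \<in> act AX ` {f \<in> below (level (s + int r)).
      tens (act AX f) \<in> tens ` below (level s)} \<and> h \<in> below (level s - 1)})"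
      using z fb h by blast
  qed
qed

text \<open>
  Leading coefficients in \<open>(p\<^sup>2)\<close> can be removed by a relation; hence \<open>tens\<close> takes the same values on
  both sets, although the sets differ. The left-hand form contains the kernel of \<open>tens\<close>.
\<close>

lemma lead_in_psq:
  "tens ` lead_in m (\<lambda>_ _. psq_ideal) = tens ` below (m - 1)"
proof (cases m)
  case 0
  then show ?thesis by (simp add: lead_in_def)
next
  case (Suc n)
  show ?thesis
  proof (intro Set.set_eqI iffI)
    fix z assume "z \<in> tens ` lead_in m (\<lambda>_ _. psq_ideal)"
    then obtain g where g: "z = tens g" "g \<in> below (Suc n)" "\<And>i j. wt i j = n \<Longrightarrow> g i j \<in> psq_ideal"
      by (auto simp: lead_in_def Suc)
    have "\<forall>i j. \<exists>c. wt i j = n \<longrightarrow> c \<in> zpoly \<and> g i j = of_nat p ^ 2 * c"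
      using g(3) by (auto simp: psq_ideal_def)
    then obtain c where c: "\<And>i j. wt i j = n \<Longrightarrow> c i j \<in> zpoly \<and> g i j = of_nat p ^ 2 * c i j" by metis
    define t where "t i j = (if wt i j = n then c i j else 0)" for i j
    have t: "t \<in> below (Suc n)" using c by (auto simp: t_def intro!: belowI)
    have "g - act AY t \<in> below n"
      using g(2) t c AY_below[OF t] by (intro below_Suc_diff act_below0) (auto simp: t_def)
    moreover have "tens g = tens (g - act AY t)"
      using tens_eq[of g "g - act AY t"] g(2) t by (auto intro: gridsI)
    ultimately show "z \<in> tens ` below (m - 1)" using g(1) Suc by auto
  next
    fix z assume "z \<in> tens ` below (m - 1)"
    then obtain g where g: "z = tens g" "g \<in> below n" using Suc by auto
    have "g i j \<in> psq_ideal" if "Suc (wt i j) = m" for i j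
    proof -
      have "g i j = of_nat p ^ 2 * 0" using g(2) that Suc by (simp add: below_zero)
      then show ?thesis unfolding psq_ideal_def using zpoly_0 by blast
    qed
    then have "g \<in> lead_in m (\<lambda>_ _. psq_ideal)"
      using below_mono[OF g(2), of m] Suc by (simp add: lead_in_def)
    then show "z \<in> tens ` lead_in m (\<lambda>_ _. psq_ideal)" using g(1) by blast
  qed
qed

lemma B_infinity_1: "B_infinity Cku dku Fku 1 s = tens ` lead_in (level s) (\<lambda>_ _. psq_ideal)"
proof -
  have step: "dku (1 + 1) ` approx_cycles dku Fku r (1 + 1) (s + int r) = tens ` {0}" for r
  proof -
    have "approx_cycles dku Fku r (1 + 1) (s + int r) = {tens 0}"
    proof -
      have a: "Fku (1 + 1) (s + int r) = {tens 0}" by (simp add: kunneth_filtration_def F_zero)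
      have b: "dku (1 + 1) x = tens 0" for x by (simp add: kunneth_d_def F_zero)
      have c: "tens 0 \<in> Fku (1 + 1 - 1) t" for t
        using tens_0_mem by (simp only: kunneth_filtration_eq add_diff_cancel simp_thms)
      show ?thesis unfolding approx_cycles_def a b using c by blast
    qed
    moreover have "dku (1 + 1) (tens 0) = tens 0" by (simp add: kunneth_d_def F_zero)
    ultimately show ?thesis by (simp only: image_insert image_empty)
  qed
  have "tens ` {0} <+>\<^bsub>Cku\<^esub> Fku 1 (s - 1) = tens ` {x + y | x y. x \<in> {0} \<and> y \<in> below (level s - 1)}"
    unfolding kunneth_filtration_eq[of 1, simplified] level_pred
    by (rule tens_set_add[OF _ below_grids]) (simp only: insert_subset empty_subsetI grids_0 simp_thms)
  also have "{x + y | x y. x \<in> {0} \<and> y \<in> below (level s - 1)} = below (level s - 1)"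
    by (rule zero_plus_set)
  finally have e: "tens ` {0} <+>\<^bsub>Cku\<^esub> Fku 1 (s - 1) = tens ` below (level s - 1)" .
  show ?thesis
    unfolding B_infinity_def step e lead_in_psq by (simp only: UN_constant UNIV_not_empty if_False)
qed

definition entrywise :: "(nat \<Rightarrow> nat \<Rightarrow> rat poly set) \<Rightarrow> grid set" where
  "entrywise J = {g \<in> grids. \<forall>i j. g i j \<in> J i j}"

lemma stable_entrywise:
  assumes "\<And>i j. stable (ku p) (*) (J i j)"
  shows "stable (ku p) scal (entrywise J)"
  using stable_grids assms unfolding stable_iff_zpoly entrywise_def by (auto simp: scal_def)

lemma stable_lead_in:
  assumes "\<And>i j. stable (ku p) (*) (J i j)"
  shows "stable (ku p) scal (lead_in m J)"
  using stable_below[of m] assms unfolding stable_iff_zpoly lead_in_def by (auto simp: scal_def)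

text \<open>
  The component of \<open>g\<close> in filtration degree \<open>s\<close>.
\<close>

definition part :: "int \<Rightarrow> grid \<Rightarrow> grid" where
  "part s g i j = (if filtration p (Suc i) (Suc j) = s then g i j else 0)"

text \<open>
  Both degrees of the infinity page have this form. For the cokernel \<open>J\<close> is everything and \<open>I\<close> the
  ideal of leading terms of boundaries; for the kernel \<open>J\<close> consists of the leading terms of
  cycles and \<open>I\<close> is \<open>(p\<^sup>2)\<close>.
\<close>

definition E_page :: "(nat \<Rightarrow> nat \<Rightarrow> rat poly set) \<Rightarrow> (nat \<Rightarrow> nat \<Rightarrow> rat poly set) \<Rightarrow> int
    \<Rightarrow> (rat poly, (nat \<Rightarrow> (nat \<Rightarrow> rat poly) set) set) module" where
  "E_page J I s = quotient_module (Cku\<lparr>carrier := tens ` lead_in (level s) J\<rparr>) (tens ` lead_in (level s) I)"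

definition E_class :: "(nat \<Rightarrow> nat \<Rightarrow> rat poly set) \<Rightarrow> int \<Rightarrow> grid \<Rightarrow> (nat \<Rightarrow> (nat \<Rightarrow> rat poly) set) set" where
  "E_class I s x = tens ` lead_in (level s) I +>\<^bsub>Cku\<^esub> tens x"

lemma presents_E_page:
  assumes J: "\<And>i j. stable (ku p) (*) (J i j)" and I: "\<And>i j. stable (ku p) (*) (I i j)"
    and IJ: "\<And>i j. I i j \<subseteq> J i j" and psq: "\<And>i j. psq_ideal \<subseteq> I i j"
  shows "presents (ku p) scal (lead_in (level s) J) (E_class I s) (E_page J I s)"
    and "x \<in> lead_in (level s) J \<Longrightarrow> y \<in> lead_in (level s) J \<Longrightarrow>
        E_class I s x = E_class I s y \<longleftrightarrow> x - y \<in> lead_in (level s) I"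
proof -
  have sub: "lead_in (level s) J \<subseteq> grids" by (auto simp: lead_in_def)
  have sub2: "lead_in (level s) I \<subseteq> lead_in (level s) J" using IJ unfolding lead_in_def by blast
  note P = presents_carrier[OF presents_tens stable_lead_in[of J, OF J] sub]
  have ker: "x - y \<in> lead_in (level s) I"
    if xy: "x \<in> lead_in (level s) J" "y \<in> lead_in (level s) J" and e: "tens x = tens y" for x y
  proof -
    have xb: "x \<in> below (level s)" "y \<in> below (level s)" using xy by (auto simp: lead_in_def)
    obtain t where t: "t \<in> grids" "x - y = act AY t" using tens_eq e sub xy by blast
    have b: "act AY t \<in> below (level s)" unfolding t(2)[symmetric] using xb by (rule below_diff)
    have tb: "t \<in> below (level s)" using t(1) b by (rule AY_reflects_below)
    have "act AY t i j \<in> I i j" if "Suc (wt i j) = level s" for i j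
    proof -
      have "act AY t i j = of_nat p ^ 2 * t i j" using AY_below[of t "wt i j"] tb that by simp
      moreover have "t i j \<in> zpoly" using tb by (rule below_zpoly)
      ultimately show ?thesis using psq[of i j] by (auto simp: psq_ideal_def)
    qed
    then show ?thesis unfolding t(2) lead_in_def using b by blast
  qed
  note Q = presents_quotient[OF P stable_lead_in[of I, OF I] sub2 ker]
  have cs: "tens ` lead_in (level s) I +>\<^bsub>Cku\<lparr>carrier := tens ` lead_in (level s) J\<rparr>\<^esub> tens x = E_class I s x" for x
    by (simp add: E_class_def a_r_coset_def')
  show "presents (ku p) scal (lead_in (level s) J) (E_class I s) (E_page J I s)"
    using Q(1) unfolding cs E_page_def .
  show "x \<in> lead_in (level s) J \<Longrightarrow> y \<in> lead_in (level s) J \<Longrightarrow>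
        E_class I s x = E_class I s y \<longleftrightarrow> x - y \<in> lead_in (level s) I"
    using Q(2) unfolding cs .
qed

lemma part_lead_in:
  assumes g: "g \<in> grids" and top: "\<And>i j. filtration p (Suc i) (Suc j) = s \<Longrightarrow> g i j \<in> J i j"
  shows "part s g \<in> lead_in (level s) J"
proof -
  have "part s g \<in> below (level s)"
  proof (rule belowI)
    show "part s g i j \<in> zpoly" for i j using g by (auto simp: part_def grids_iff)
    show "part s g i j = 0" if "level s \<le> wt i j" for i j
      using that filtration_eq_level[of i j s] by (simp add: part_def)
  qed
  moreover have "part s g i j \<in> J i j" if "Suc (wt i j) = level s" for i j
    using that top filtration_eq_level[of i j s] by (simp add: part_def)
  ultimately show ?thesis by (simp add: lead_in_def)
qed

definition total_class :: "(nat \<Rightarrow> nat \<Rightarrow> rat poly set) \<Rightarrow> grid \<Rightarrow> int \<Rightarrow> (nat \<Rightarrow> (nat \<Rightarrow> rat poly) set) set" where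
  "total_class I g = (\<lambda>s\<in>UNIV. E_class I s (part s g))"

text \<open>
  A class of filtration \<open>s\<close> is determined by its leading terms, so the components of a single grid,
  sorted by filtration, represent all classes of the total page at once.
\<close>

lemma presents_total:
  assumes J: "\<And>i j. stable (ku p) (*) (J i j)" and I: "\<And>i j. stable (ku p) (*) (I i j)"
    and IJ: "\<And>i j. I i j \<subseteq> J i j" and psq: "\<And>i j. psq_ideal \<subseteq> I i j"
  shows "presents (ku p) scal (entrywise J) (total_class I) (direct_sum UNIV (E_page J I))"
    and "g \<in> entrywise J \<Longrightarrow> h \<in> entrywise J \<Longrightarrow>
       total_class I g = total_class I h \<longleftrightarrow> (\<forall>i j. g i j - h i j \<in> I i j)"
proof -
  note page = presents_E_page[of J I, OF J I IJ psq]
  have zero_I: "0 \<in> I i j" for i j using I by (simp add: stable_iff_zpoly)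
  have part_in: "part s g \<in> lead_in (level s) J" if "g \<in> entrywise J" for g s
    using that by (intro part_lead_in) (auto simp: entrywise_def)
  have "presents (ku p) scal (entrywise J) (\<lambda>y. \<lambda>s\<in>UNIV. E_class I s (part s y)) (direct_sum UNIV (E_page J I))"
  proof (rule presents_direct_sum[OF page(1) stable_entrywise[of J, OF J]])
    show "finite {s \<in> UNIV. part s y \<noteq> 0}" if y: "y \<in> entrywise J" for y
    proof -
      have "{s \<in> UNIV. part s y \<noteq> 0} \<subseteq> (\<lambda>(i, j). filtration p (Suc i) (Suc j)) ` {(i, j). y i j \<noteq> 0}"
      proof
        fix s assume "s \<in> {s \<in> UNIV. part s y \<noteq> 0}"
        then obtain i j where "part s y i j \<noteq> 0" by (auto simp: fun_eq_iff)
        then have "y i j \<noteq> 0" "filtration p (Suc i) (Suc j) = s" by (auto simp: part_def split: if_splits)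
        then show "s \<in> (\<lambda>(i, j). filtration p (Suc i) (Suc j)) ` {(i, j). y i j \<noteq> 0}" by force
      qed
      then show ?thesis by (rule finite_subset) (use y in \<open>simp add: entrywise_def grids_iff\<close>)
    qed
    show "\<exists>y\<in>entrywise J. \<forall>s\<in>UNIV. E_class I s (part s y) = E_class I s (f s)"
      if f: "\<And>s. s \<in> UNIV \<Longrightarrow> f s \<in> lead_in (level s) J" "finite {s \<in> UNIV. f s \<noteq> 0}" for f
    proof -
      define y where "y i j = f (filtration p (Suc i) (Suc j)) i j" for i j
      have fg: "f s \<in> grids" for s using f(1)[of s] by (auto simp: lead_in_def)
      have "{(i, j). y i j \<noteq> 0} \<subseteq> (\<Union>s\<in>{s \<in> UNIV. f s \<noteq> 0}. {(i, j). f s i j \<noteq> 0})"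
        by (force simp: y_def)
      then have "finite {(i, j). y i j \<noteq> 0}"
        by (rule finite_subset) (use f(2) fg in \<open>auto simp: grids_iff\<close>)
      then have yg: "y \<in> grids" using fg by (auto simp: grids_iff y_def)
      have yJ: "y \<in> entrywise J"
        unfolding entrywise_def
      proof (intro CollectI conjI allI yg)
        fix i j
        have "Suc (wt i j) = level (filtration p (Suc i) (Suc j))"
          by (rule iffD1[OF filtration_eq_level refl])
        then show "y i j \<in> J i j"
          unfolding y_def using f(1)[of "filtration p (Suc i) (Suc j)"] by (simp add: lead_in_def)
      qed
      have "part s y - f s \<in> lead_in (level s) I" for s
      proof -
        have "part s y - f s \<in> below (level s)"
          using part_in[OF yJ] f(1)[of s] by (intro below_diff) (auto simp: lead_in_def)
        moreover have "(part s y - f s) i j \<in> I i j" if "Suc (wt i j) = level s" for i j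
          using that filtration_eq_level[of i j s] zero_I by (simp add: part_def y_def)
        ultimately show ?thesis by (simp add: lead_in_def)
      qed
      then show ?thesis using page(2) part_in[OF yJ] f(1) yJ by (intro bexI[of _ y]) auto
    qed
  qed (use part_in in \<open>auto simp: scal_add\<close>, auto simp: part_def scal_def fun_eq_iff)
  then show "presents (ku p) scal (entrywise J) (total_class I) (direct_sum UNIV (E_page J I))"
    by (simp add: total_class_def[abs_def])
  show "total_class I g = total_class I h \<longleftrightarrow> (\<forall>i j. g i j - h i j \<in> I i j)"
    if gh: "g \<in> entrywise J" "h \<in> entrywise J"
  proof -
    have "total_class I g = total_class I h \<longleftrightarrow> (\<forall>s. E_class I s (part s g) = E_class I s (part s h))"
      by (auto simp: total_class_def fun_eq_iff)
    also have "\<dots> \<longleftrightarrow> (\<forall>s. part s g - part s h \<in> lead_in (level s) I)"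
      using page(2) part_in gh by simp
    also have "\<dots> \<longleftrightarrow> (\<forall>i j. g i j - h i j \<in> I i j)"
    proof
      assume a: "\<forall>s. part s g - part s h \<in> lead_in (level s) I"
      show "\<forall>i j. g i j - h i j \<in> I i j"
      proof (intro allI)
        fix i j
        define s where "s = filtration p (Suc i) (Suc j)"
        have "Suc (wt i j) = level s" using filtration_eq_level[of i j s] s_def by simp
        then have "(part s g - part s h) i j \<in> I i j" using a by (simp add: lead_in_def)
        then show "g i j - h i j \<in> I i j" by (simp add: part_def s_def)
      qed
    next
      assume a: "\<forall>i j. g i j - h i j \<in> I i j"
      show "\<forall>s. part s g - part s h \<in> lead_in (level s) I"
      proof
        fix s
        have "part s g \<in> below (level s)" "part s h \<in> below (level s)"
          using part_in[OF gh(1), of s] part_in[OF gh(2), of s] by (auto simp: lead_in_def)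
        then have "part s g - part s h \<in> below (level s)" by (rule below_diff)
        moreover have "(part s g - part s h) i j \<in> I i j" for i j
          using a zero_I by (simp add: part_def)
        ultimately show "part s g - part s h \<in> lead_in (level s) I" by (simp add: lead_in_def)
      qed
    qed
    finally show ?thesis .
  qed
qed

section \<open>The ideals of leading coefficients\<close>

lemma stable_multiples:
  assumes "q \<in> zpoly"
  shows "stable (ku p) (*) {q * c | c. c \<in> zpoly}"
  unfolding stable_iff_zpoly
proof (intro conjI ballI)
  show "0 \<in> {q * c | c. c \<in> zpoly}" using zpoly_0 by force
  show "x + y \<in> {q * c | c. c \<in> zpoly}" if "x \<in> {q * c | c. c \<in> zpoly}" "y \<in> {q * c | c. c \<in> zpoly}" for x y
    using that by (auto simp flip: distrib_left)
  show "- x \<in> {q * c | c. c \<in> zpoly}" if "x \<in> {q * c | c. c \<in> zpoly}" for x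
    using that by (auto simp flip: mult_minus_right)
  show "r * x \<in> {q * c | c. c \<in> zpoly}" if "r \<in> zpoly" "x \<in> {q * c | c. c \<in> zpoly}" for r x
    using that by (auto simp: mult.left_commute[of r])
qed

lemma stable_kernel_ideal: "stable (ku p) (*) (kernel_ideal i j)"
  unfolding kernel_ideal_def by (rule stable_multiples) simp

lemma stable_psq_ideal: "stable (ku p) (*) psq_ideal"
  unfolding psq_ideal_def by (rule stable_multiples) auto

lemma stable_zpoly: "stable (ku p) (*) zpoly"
  by (rule presentsD(1)[OF presents_regular])

lemma image_idealI:
  "a \<in> zpoly \<Longrightarrow> b \<in> zpoly \<Longrightarrow> c \<in> zpoly \<Longrightarrow>
     of_nat p ^ 2 * a + of_nat p * vpow (p - 1) * b + vpow ((p - 1) * (p + 2)) * c \<in> image_ideal"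
  unfolding image_ideal_def by blast

lemma stable_image_ideal: "stable (ku p) (*) image_ideal"
  unfolding stable_iff_zpoly
proof (intro conjI ballI)
  show "0 \<in> image_ideal" using image_idealI[of 0 0 0] by simp
next
  fix x y assume "x \<in> image_ideal" "y \<in> image_ideal"
  then obtain a b c a' b' c' where z: "a \<in> zpoly" "b \<in> zpoly" "c \<in> zpoly" "a' \<in> zpoly" "b' \<in> zpoly" "c' \<in> zpoly"
    "x = of_nat p ^ 2 * a + of_nat p * vpow (p - 1) * b + vpow ((p - 1) * (p + 2)) * c"
    "y = of_nat p ^ 2 * a' + of_nat p * vpow (p - 1) * b' + vpow ((p - 1) * (p + 2)) * c'"
    unfolding image_ideal_def by blast
  have "x + y = of_nat p ^ 2 * (a + a') + of_nat p * vpow (p - 1) * (b + b') + vpow ((p - 1) * (p + 2)) * (c + c')"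
    unfolding z(7,8) by (simp only: algebra_simps)
  then show "x + y \<in> image_ideal" using z by (simp only: image_idealI zpoly_add)
next
  fix x assume "x \<in> image_ideal"
  then obtain a b c where z: "a \<in> zpoly" "b \<in> zpoly" "c \<in> zpoly"
    "x = of_nat p ^ 2 * a + of_nat p * vpow (p - 1) * b + vpow ((p - 1) * (p + 2)) * c"
    unfolding image_ideal_def by blast
  have "- x = of_nat p ^ 2 * (- a) + of_nat p * vpow (p - 1) * (- b) + vpow ((p - 1) * (p + 2)) * (- c)"
    unfolding z(4) by simp
  then show "- x \<in> image_ideal" using z by (simp only: image_idealI zpoly_uminus)
next
  fix r x assume r: "r \<in> zpoly" "x \<in> image_ideal"
  then obtain a b c where z: "a \<in> zpoly" "b \<in> zpoly" "c \<in> zpoly"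
    "x = of_nat p ^ 2 * a + of_nat p * vpow (p - 1) * b + vpow ((p - 1) * (p + 2)) * c"
    unfolding image_ideal_def by blast
  have "r * x = of_nat p ^ 2 * (r * a) + of_nat p * vpow (p - 1) * (r * b) + vpow ((p - 1) * (p + 2)) * (r * c)"
    unfolding z(4) by (simp only: algebra_simps)
  then show "r * x \<in> image_ideal" using z r by (simp only: image_idealI zpoly_mult)
qed

lemma psq_subset_image: "psq_ideal \<subseteq> image_ideal"
proof
  fix x assume "x \<in> psq_ideal"
  then obtain c where "c \<in> zpoly" "x = of_nat p ^ 2 * c" unfolding psq_ideal_def by blast
  then show "x \<in> image_ideal" using image_idealI[of c 0 0] by simp
qed

lemma image_subset_zpoly: "image_ideal \<subseteq> zpoly"
  unfolding image_ideal_def by (auto intro!: zpoly_add zpoly_mult zpoly_power zpoly_monom)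

lemma psq_subset_kernel: "psq_ideal \<subseteq> kernel_ideal i j"
proof
  fix x assume "x \<in> psq_ideal"
  then obtain c where c: "c \<in> zpoly" "x = of_nat p ^ 2 * c" unfolding psq_ideal_def by blast
  have "kernel_multiple i j dvd p ^ 2" by (auto simp: kernel_multiple_def power2_eq_square)
  then obtain q where "p ^ 2 = kernel_multiple i j * q" by (rule dvdE)
  then have "(of_nat p ^ 2 :: rat poly) = of_nat (kernel_multiple i j) * of_nat q"
    by (metis of_nat_mult of_nat_power)
  then have "x = of_nat (kernel_multiple i j) * (of_nat q * c)" using c by (simp add: mult.assoc)
  then show "x \<in> kernel_ideal i j" unfolding kernel_ideal_def using c by blast
qed

lemma Idl_E0: "Idl\<^bsub>ku p\<^esub> E0_ideal_gens p = image_ideal"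
proof -
  have e: "E0_ideal_gens p = {of_nat p ^ 2, of_nat p * vpow (p - 1), vpow ((p - 1) * (p + 2))}"
  proof -
    have "g1 p + g2 p = (p - 1) * (p + 2)"
    proof -
      obtain k where "p = Suc k" using p_gt_1 by (cases p) auto
      then show ?thesis by (simp add: Defs.g1_def Defs.g2_def power2_eq_square)
    qed
    then show ?thesis
      by (simp add: E0_ideal_gens_def monom_power Defs.g1_def)
  qed
  show ?thesis
  proof (rule genideal_ku[OF stable_image_ideal image_subset_zpoly])
    show "E0_ideal_gens p \<subseteq> image_ideal"
      unfolding e using image_idealI[of 1 0 0] image_idealI[of 0 1 0] image_idealI[of 0 0 1] by simp
    show "image_ideal \<subseteq> T" if T: "stable (ku p) (*) T" "E0_ideal_gens p \<subseteq> T" for T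
    proof
      fix x assume "x \<in> image_ideal"
      then obtain a b c where z: "a \<in> zpoly" "b \<in> zpoly" "c \<in> zpoly"
        "x = of_nat p ^ 2 * a + of_nat p * vpow (p - 1) * b + vpow ((p - 1) * (p + 2)) * c"
        unfolding image_ideal_def by blast
      note S = stableD[OF T(1), unfolded carrier_ku]
      have "x = a * (of_nat p ^ 2) + b * (of_nat p * vpow (p - 1)) + c * vpow ((p - 1) * (p + 2))"
        unfolding z(4) by (simp only: mult_ac)
      moreover have "of_nat p ^ 2 \<in> T" "of_nat p * vpow (p - 1) \<in> T" "vpow ((p - 1) * (p + 2)) \<in> T"
        using T(2) unfolding e by blast+
      ultimately show "x \<in> T" using z(1-3) by (simp only: S(2,4))
    qed
  qed
qed

lemma Idl_E1: "Idl\<^bsub>ku p\<^esub> E1_ideal_gens p = psq_ideal"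
proof (rule genideal_ku[OF stable_psq_ideal])
  show "psq_ideal \<subseteq> zpoly" unfolding psq_ideal_def by auto
  show "E1_ideal_gens p \<subseteq> psq_ideal"
    unfolding E1_ideal_gens_def psq_ideal_def using zpoly_1 by force
  show "psq_ideal \<subseteq> T" if T: "stable (ku p) (*) T" "E1_ideal_gens p \<subseteq> T" for T
  proof
    fix x assume "x \<in> psq_ideal"
    then obtain c where "c \<in> zpoly" "x = c * of_nat p ^ 2" unfolding psq_ideal_def by (auto simp: mult.commute)
    then show "x \<in> T"
      using stableD(4)[OF T(1), unfolded carrier_ku, of c "of_nat p ^ 2"] T(2)
      by (simp add: E1_ideal_gens_def)
  qed
qed

section \<open>The direct sums of cyclic modules and the isomorphisms\<close>

definition cyclic_class :: "rat poly set \<Rightarrow> grid \<Rightarrow> nat \<times> nat \<Rightarrow> rat poly set" where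
  "cyclic_class J g = (\<lambda>x\<in>{1..} \<times> {1..}. J +>\<^bsub>ku p\<^esub> g (fst x - 1) (snd x - 1))"

lemma presents_cyclic:
  assumes S: "Idl\<^bsub>ku p\<^esub> S = J" and J: "stable (ku p) (*) J" "J \<subseteq> zpoly"
  shows "presents (ku p) (*) zpoly (\<lambda>c. J +>\<^bsub>ku p\<^esub> c) (cyclic_module (ku p) S)"
    and "x \<in> zpoly \<Longrightarrow> y \<in> zpoly \<Longrightarrow> J +>\<^bsub>ku p\<^esub> x = J +>\<^bsub>ku p\<^esub> y \<longleftrightarrow> x - y \<in> J"
proof -
  have ker: "x - y \<in> J" if "x = y" for x y using J that by (simp add: stable_iff_zpoly)
  note Q = presents_quotient[OF presents_regular J ker, simplified]
  have cs: "J +>\<^bsub>regular_module (ku p)\<^esub> x = J +>\<^bsub>ku p\<^esub> x" for x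
    by (simp add: a_r_coset_def' regular_module_def)
  show "presents (ku p) (*) zpoly (\<lambda>c. J +>\<^bsub>ku p\<^esub> c) (cyclic_module (ku p) S)"
    using Q(1) unfolding cs cyclic_module_def S .
  show "x \<in> zpoly \<Longrightarrow> y \<in> zpoly \<Longrightarrow> J +>\<^bsub>ku p\<^esub> x = J +>\<^bsub>ku p\<^esub> y \<longleftrightarrow> x - y \<in> J"
    using Q(2) unfolding cs .
qed

lemma presents_cyclic_sum:
  assumes S: "Idl\<^bsub>ku p\<^esub> S = J" and J: "stable (ku p) (*) J" "J \<subseteq> zpoly"
  shows "presents (ku p) scal grids (cyclic_class J) (cyclic_sum p S)"
    and "g \<in> grids \<Longrightarrow> h \<in> grids \<Longrightarrow> cyclic_class J g = cyclic_class J h \<longleftrightarrow> (\<forall>i j. g i j - h i j \<in> J)"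
proof -
  note cyc = presents_cyclic[OF S J]
  let ?I = "{1..} \<times> {1..} :: (nat \<times> nat) set"
  have "presents (ku p) scal grids
      (\<lambda>g. \<lambda>x\<in>?I. J +>\<^bsub>ku p\<^esub> ((\<lambda>x g. g (fst x - 1) (snd x - 1)) x g)) (direct_sum ?I (\<lambda>_. cyclic_module (ku p) S))"
  proof (rule presents_direct_sum[OF cyc(1) stable_grids])
    show "finite {x \<in> ?I. y (fst x - 1) (snd x - 1) \<noteq> 0}" if "y \<in> grids" for y :: grid
    proof -
      have "{x \<in> ?I. y (fst x - 1) (snd x - 1) \<noteq> 0} \<subseteq> (\<lambda>(i, j). (Suc i, Suc j)) ` {(i, j). y i j \<noteq> 0}"
      proof
        fix x assume x: "x \<in> {x \<in> ?I. y (fst x - 1) (snd x - 1) \<noteq> 0}"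
        then have "x = (\<lambda>(i, j). (Suc i, Suc j)) (fst x - 1, snd x - 1)" by auto
        then show "x \<in> (\<lambda>(i, j). (Suc i, Suc j)) ` {(i, j). y i j \<noteq> 0}"
          by (rule image_eqI) (use x in simp)
      qed
      then show ?thesis by (rule finite_subset) (use that in \<open>simp add: grids_iff\<close>)
    qed
    show "\<exists>y\<in>grids. \<forall>x\<in>?I. J +>\<^bsub>ku p\<^esub> y (fst x - 1) (snd x - 1) = J +>\<^bsub>ku p\<^esub> f x"
      if f: "\<And>x. x \<in> ?I \<Longrightarrow> f x \<in> zpoly" "finite {x \<in> ?I. f x \<noteq> 0}" for f
    proof (intro bexI ballI)
      show "J +>\<^bsub>ku p\<^esub> f (Suc (fst x - 1), Suc (snd x - 1)) = J +>\<^bsub>ku p\<^esub> f x" if "x \<in> ?I" for x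
      proof -
        have "(Suc (fst x - 1), Suc (snd x - 1)) = x" using that by auto
        then show ?thesis by simp
      qed
      have "{(i, j). f (Suc i, Suc j) \<noteq> 0} \<subseteq> (\<lambda>(i, j). (i - 1, j - 1)) ` {x \<in> ?I. f x \<noteq> 0}"
      proof
        fix x assume x: "x \<in> {(i, j). f (Suc i, Suc j) \<noteq> 0}"
        show "x \<in> (\<lambda>(i, j). (i - 1, j - 1)) ` {x \<in> ?I. f x \<noteq> 0}"
          by (rule image_eqI[of _ _ "(Suc (fst x), Suc (snd x))"]) (use x in auto)
      qed
      then have "finite {(i, j). f (Suc i, Suc j) \<noteq> 0}"
        by (rule finite_subset) (use f(2) in simp)
      then show "(\<lambda>i j. f (Suc i, Suc j)) \<in> grids" using f(1) by (simp add: grids_iff)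
    qed
  qed (auto simp: scal_add, auto simp: grids_iff scal_def)
  then show "presents (ku p) scal grids (cyclic_class J) (cyclic_sum p S)"
    by (simp add: cyclic_class_def[abs_def] cyclic_sum_def)
  show "cyclic_class J g = cyclic_class J h \<longleftrightarrow> (\<forall>i j. g i j - h i j \<in> J)" if gh: "g \<in> grids" "h \<in> grids"
  proof -
    have "cyclic_class J g = cyclic_class J h \<longleftrightarrow> (\<forall>i j. J +>\<^bsub>ku p\<^esub> g i j = J +>\<^bsub>ku p\<^esub> h i j)"
    proof
      assume e: "cyclic_class J g = cyclic_class J h"
      show "\<forall>i j. J +>\<^bsub>ku p\<^esub> g i j = J +>\<^bsub>ku p\<^esub> h i j"
      proof (intro allI)
        fix i j
        have "cyclic_class J g (Suc i, Suc j) = cyclic_class J h (Suc i, Suc j)" using e by simp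
        then show "J +>\<^bsub>ku p\<^esub> g i j = J +>\<^bsub>ku p\<^esub> h i j" by (simp add: cyclic_class_def)
      qed
    qed (simp add: cyclic_class_def)
    then show ?thesis using cyc(2) gh by (simp add: grids_iff)
  qed
qed

lemma cyclic_gen_eq:
  assumes S: "Idl\<^bsub>ku p\<^esub> S = J" and J: "stable (ku p) (*) J" "J \<subseteq> zpoly"
    and ij: "i \<ge> 1" "j \<ge> 1"
  shows "cyclic_gen p S c i j = cyclic_class J (scal c (cell i j))"
proof (rule ext)
  fix x
  have zero: "\<zero>\<^bsub>cyclic_module (ku p) S\<^esub> = J +>\<^bsub>ku p\<^esub> 0"
    by (rule presentsD(3)[OF presents_cyclic(1)[OF S J]])
  have "scal c (cell i j) (fst x - 1) (snd x - 1) = (if x = (i, j) then c else 0)" if "x \<in> {1..} \<times> {1..}"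
    using that ij by (cases x) (auto simp: scal_def cell_def)
  then show "cyclic_gen p S c i j x = cyclic_class J (scal c (cell i j)) x"
    by (simp add: cyclic_gen_def summand_def cyclic_class_def S zero)
qed

lemma lead_in_zpoly: "lead_in m (\<lambda>_ _. zpoly) = below m"
  by (auto simp: lead_in_def below_zpoly)

lemma kunneth_E_infinity_0:
  "kunneth_E_infinity p 0 = direct_sum UNIV (E_page (\<lambda>_ _. zpoly) (\<lambda>_ _. image_ideal))"
  unfolding kunneth_E_infinity_def total_E_infinity_def E_infinity_def[abs_def] E_page_def[abs_def]
    Z_infinity_0 B_infinity_0 lead_in_zpoly ..

lemma kunneth_E_infinity_1:
  "kunneth_E_infinity p 1 = direct_sum UNIV (E_page kernel_ideal (\<lambda>_ _. psq_ideal))"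
  unfolding kunneth_E_infinity_def total_E_infinity_def E_infinity_def[abs_def] E_page_def[abs_def]
    Z_infinity_1 B_infinity_1 ..

lemma summand_E_page:
  assumes J: "\<And>i j. stable (ku p) (*) (J i j)" and I: "\<And>i j. stable (ku p) (*) (I i j)"
    and IJ: "\<And>i j. I i j \<subseteq> J i j" and psq: "\<And>i j. psq_ideal \<subseteq> I i j"
    and ij: "i \<ge> 1" "j \<ge> 1"
  shows "summand UNIV (E_page J I) (filtration p i j) (E_class I (filtration p i j) (scal c (cell i j)))
     = total_class I (scal c (cell i j))"
proof (rule ext)
  fix k
  have "\<zero>\<^bsub>E_page J I k\<^esub> = E_class I k 0"
    by (rule presentsD(3)[OF presents_E_page(1)[of J I, OF J I IJ psq]])
  moreover have "part k (scal c (cell i j)) = (if k = filtration p i j then scal c (cell i j) else 0)"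
    using ij by (auto simp: part_def scal_def cell_def fun_eq_iff)
  ultimately show "summand UNIV (E_page J I) (filtration p i j) (E_class I (filtration p i j) (scal c (cell i j))) k
     = total_class I (scal c (cell i j)) k"
    by (simp add: summand_def total_class_def)
qed

lemma kunneth_class_0:
  assumes "i \<ge> 1" "j \<ge> 1" "c \<in> zpoly"
  shows "kunneth_class p 0 c i j = total_class (\<lambda>_ _. image_ideal) (scal c (cell i j))"
proof -
  have "kunneth_class p 0 c i j = summand UNIV (E_page (\<lambda>_ _. zpoly) (\<lambda>_ _. image_ideal)) (filtration p i j)
     (E_class (\<lambda>_ _. image_ideal) (filtration p i j) (scal c (cell i j)))"
    unfolding kunneth_class_def E_infinity_class_def E_infinity_def[abs_def] E_page_def[abs_def] E_class_def
      Z_infinity_0 B_infinity_0 lead_in_zpoly bracket_eq[OF assms(1,3)] ..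
  then show ?thesis
    using summand_E_page[of "\<lambda>_ _. zpoly" "\<lambda>_ _. image_ideal" i j c] assms stable_zpoly stable_image_ideal
      image_subset_zpoly psq_subset_image by simp
qed

lemma kunneth_class_1:
  assumes "i \<ge> 1" "j \<ge> 1" "c \<in> zpoly"
  shows "kunneth_class p 1 c i j = total_class (\<lambda>_ _. psq_ideal) (scal c (cell i j))"
proof -
  have "kunneth_class p 1 c i j = summand UNIV (E_page kernel_ideal (\<lambda>_ _. psq_ideal)) (filtration p i j)
     (E_class (\<lambda>_ _. psq_ideal) (filtration p i j) (scal c (cell i j)))"
    unfolding kunneth_class_def E_infinity_class_def E_infinity_def[abs_def] E_page_def[abs_def] E_class_def
      Z_infinity_1 B_infinity_1 bracket_eq[OF assms(1,3)] ..
  then show ?thesis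
    using summand_E_page[of kernel_ideal "\<lambda>_ _. psq_ideal" i j c] assms stable_kernel_ideal stable_psq_ideal
      psq_subset_kernel by simp
qed

lemma entrywise_zpoly: "entrywise (\<lambda>_ _. zpoly) = grids"
  by (auto simp: entrywise_def grids_iff)

lemma cell_scal_grids: "c \<in> zpoly \<Longrightarrow> scal c (cell i j) \<in> grids"
  using cell_grids by blast

lemma psq_ideal_zpoly: "psq_ideal \<subseteq> zpoly"
  unfolding psq_ideal_def by auto

lemma presents_E0: "presents (ku p) scal grids (cyclic_class image_ideal) (E0 p)"
  unfolding E0_def by (rule presents_cyclic_sum(1)[OF Idl_E0 stable_image_ideal image_subset_zpoly])

text \<open>
  The multiples of \<open>q\<close> supported on \<open>I\<close>, a set of positions with the original indices.
\<close>

definition scaled_on :: "nat \<Rightarrow> (nat \<times> nat) set \<Rightarrow> grid set" where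
  "scaled_on q I = {scal (of_nat q) g | g. g \<in> grids \<and> (\<forall>a b. g a b \<noteq> 0 \<longrightarrow> (Suc a, Suc b) \<in> I)}"

lemma scaled_on_grids: "scaled_on q I \<subseteq> grids"
  unfolding scaled_on_def by auto

abbreviation "Mcyc \<equiv> cyclic_sum p (E1_ideal_gens p)"

lemmas presents_Mcyc = presents_cyclic_sum[OF Idl_E1 stable_psq_ideal psq_ideal_zpoly]

lemma E1_sum_eq:
  assumes I: "I \<subseteq> {1..} \<times> {1..}"
  shows "E1_sum p I (of_nat q) = cyclic_class psq_ideal ` scaled_on q I"
proof -
  let ?G = "{scal (of_nat q) (cell i j) | i j. (i, j) \<in> I}"
  have "{cyclic_gen p (E1_ideal_gens p) (of_nat q) i j | i j. (i, j) \<in> I} =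
      {cyclic_class psq_ideal (scal (of_nat q) (cell i j)) | i j. (i, j) \<in> I}"
  proof (intro Collect_cong iff_exI)
    fix x i j
    have "cyclic_gen p (E1_ideal_gens p) (of_nat q) i j = cyclic_class psq_ideal (scal (of_nat q) (cell i j))"
      if "(i, j) \<in> I"
      by (rule cyclic_gen_eq[OF Idl_E1 stable_psq_ideal psq_ideal_zpoly]) (use I that in auto)
    then show "(x = cyclic_gen p (E1_ideal_gens p) (of_nat q) i j \<and> (i, j) \<in> I) =
       (x = cyclic_class psq_ideal (scal (of_nat q) (cell i j)) \<and> (i, j) \<in> I)" by auto
  qed
  also have "\<dots> = cyclic_class psq_ideal ` ?G" by blast
  finally have G: "{cyclic_gen p (E1_ideal_gens p) (of_nat q) i j | i j. (i, j) \<in> I} = cyclic_class psq_ideal ` ?G" .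
  have st: "stable (ku p) scal (scaled_on q I)"
    unfolding stable_iff_zpoly
  proof (intro conjI ballI)
    have "scal (of_nat q) 0 = 0" by (simp add: scal_def fun_eq_iff)
    then show "0 \<in> scaled_on q I" unfolding scaled_on_def using grids_0 by force
  next
    fix x y assume "x \<in> scaled_on q I" "y \<in> scaled_on q I"
    then obtain g h where gh: "x = scal (of_nat q) g" "y = scal (of_nat q) h" "g \<in> grids" "h \<in> grids"
      "\<And>a b. g a b \<noteq> 0 \<Longrightarrow> (Suc a, Suc b) \<in> I" "\<And>a b. h a b \<noteq> 0 \<Longrightarrow> (Suc a, Suc b) \<in> I"
      unfolding scaled_on_def by blast
    have "(Suc a, Suc b) \<in> I" if "(g + h) a b \<noteq> 0" for a b
      using that gh(5,6)[of a b] by fastforce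
    then show "x + y \<in> scaled_on q I"
      unfolding scaled_on_def gh(1,2) scal_add[symmetric] using gh by blast
  next
    fix x assume "x \<in> scaled_on q I"
    then obtain g where g: "x = scal (of_nat q) g" "g \<in> grids" "\<And>a b. g a b \<noteq> 0 \<Longrightarrow> (Suc a, Suc b) \<in> I"
      unfolding scaled_on_def by blast
    have "- x = scal (of_nat q) (- g)" by (simp add: g(1) scal_def fun_eq_iff)
    moreover have "(Suc a, Suc b) \<in> I" if "(- g) a b \<noteq> 0" for a b using that g(3)[of a b] by simp
    ultimately show "- x \<in> scaled_on q I" unfolding scaled_on_def using g(2) by blast
  next
    fix r x assume r: "r \<in> zpoly" and "x \<in> scaled_on q I"
    then obtain g where g: "x = scal (of_nat q) g" "g \<in> grids" "\<And>a b. g a b \<noteq> 0 \<Longrightarrow> (Suc a, Suc b) \<in> I"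
      unfolding scaled_on_def by blast
    have "scal r x = scal (of_nat q) (scal r g)" by (simp add: g(1) scal_def fun_eq_iff mult.left_commute)
    moreover have "(Suc a, Suc b) \<in> I" if "scal r g a b \<noteq> 0" for a b
      using that g(3)[of a b] by (simp add: scal_def)
    ultimately show "scal r x \<in> scaled_on q I" unfolding scaled_on_def using g(2) r by blast
  qed
  show ?thesis
    unfolding E1_sum_def G
  proof (rule presents_gen_submodule[OF presents_Mcyc(1) st scaled_on_grids])
    show "?G \<subseteq> scaled_on q I"
    proof
      fix x assume "x \<in> ?G"
      then obtain i j where x: "x = scal (of_nat q) (cell i j)" "(i, j) \<in> I" by blast
      have "(Suc a, Suc b) \<in> I" if "cell i j a b \<noteq> 0" for a b
        using that x(2) by (auto simp: cell_def split: if_splits)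
      then show "x \<in> scaled_on q I" unfolding scaled_on_def using x(1) cell_grids by blast
    qed
    show "scaled_on q I \<subseteq> T" if T: "stable (ku p) scal T" "?G \<subseteq> T" for T
    proof
      fix x assume "x \<in> scaled_on q I"
      then obtain g where g: "x = scal (of_nat q) g" "g \<in> grids" "\<And>a b. g a b \<noteq> 0 \<Longrightarrow> (Suc a, Suc b) \<in> I"
        unfolding scaled_on_def by blast
      show "x \<in> T" unfolding g(1)
      proof (rule grids_span[OF T(1), of "\<lambda>a b. (Suc a, Suc b) \<in> I" "scal (of_nat q)"])
        show "scal (of_nat q) (cell (Suc i) (Suc j)) \<in> T" if "(Suc i, Suc j) \<in> I" for i j
          using T(2) that by blast
        show "scal (of_nat q) (scal c h) = scal c (scal (of_nat q) h)" for c h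
          by (simp add: scal_def fun_eq_iff mult.left_commute)
      qed (use g scal_add in auto)
    qed
  qed
qed

text \<open>
  In terms of \<open>kernel_multiple\<close> the index ranges say: everything for \<open>j \<le> g\<^sub>1\<close>, otherwise multiples of \<open>p\<close>
  if \<open>i \<le> g\<^sub>1\<close> or \<open>j \<le> g\<^sub>2\<close>. The second and third family together cover the latter positions, and at
  all remaining positions the coefficient is zero modulo \<open>p\<^sup>2\<close>.
\<close>

lemma E1_eq: "E1 p = Mcyc\<lparr>carrier := cyclic_class psq_ideal ` entrywise kernel_ideal\<rparr>"
proof -
  let ?I1 = "{(i, j). i \<ge> 1 \<and> g1 p \<ge> j \<and> j \<ge> 1}"
  let ?I2 = "{(i, j). i \<ge> g1 p \<and> j \<ge> 1 \<and> j \<le> g2 p}"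
  let ?I3 = "{(i, j). 1 \<le> i \<and> i \<le> g1 p \<and> g1 p \<le> j}"
  have gs: "g1 p = p - 1" "g2 p = p\<^sup>2 - 1" "g1 p \<ge> 1"
    using p_gt_1 by (auto simp: Defs.g1_def Defs.g2_def)
  have sub: "?I1 \<subseteq> {1..} \<times> {1..}" "?I2 \<subseteq> {1..} \<times> {1..}" "?I3 \<subseteq> {1..} \<times> {1..}"
    using gs(3) by auto
  have e: "E1_sum p ?I1 1 = cyclic_class psq_ideal ` scaled_on 1 ?I1"
    "E1_sum p ?I2 (of_nat p) = cyclic_class psq_ideal ` scaled_on p ?I2"
    "E1_sum p ?I3 (of_nat p) = cyclic_class psq_ideal ` scaled_on p ?I3"
    using E1_sum_eq[OF sub(1), of 1] E1_sum_eq[OF sub(2), of p] E1_sum_eq[OF sub(3), of p]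
    by (simp_all only: of_nat_1)
  define S where "S = {x + y | x y. x \<in> {x + y | x y. x \<in> scaled_on 1 ?I1 \<and> y \<in> scaled_on p ?I2} \<and> y \<in> scaled_on p ?I3}"
  have "cyclic_class psq_ideal ` scaled_on 1 ?I1 <+>\<^bsub>Mcyc\<^esub> cyclic_class psq_ideal ` scaled_on p ?I2
      <+>\<^bsub>Mcyc\<^esub> cyclic_class psq_ideal ` scaled_on p ?I3 = cyclic_class psq_ideal ` S"
  proof -
    have "{x + y | x y. x \<in> scaled_on 1 ?I1 \<and> y \<in> scaled_on p ?I2} \<subseteq> grids"
      using scaled_on_grids by blast
    then show ?thesis
      unfolding S_def presents_set_add[OF presents_Mcyc(1) scaled_on_grids scaled_on_grids]
      by (rule presents_set_add[OF presents_Mcyc(1) _ scaled_on_grids])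
  qed
  moreover have "cyclic_class psq_ideal ` S = cyclic_class psq_ideal ` entrywise kernel_ideal"
  proof
    have "S \<subseteq> entrywise kernel_ideal"
    proof
      fix x assume "x \<in> S"
      then obtain g h k where x: "x = scal (of_nat 1) g + scal (of_nat p) h + scal (of_nat p) k"
         "g \<in> grids" "h \<in> grids" "k \<in> grids"
        and g: "\<And>a b. g a b \<noteq> 0 \<Longrightarrow> (Suc a, Suc b) \<in> ?I1" and h: "\<And>a b. h a b \<noteq> 0 \<Longrightarrow> (Suc a, Suc b) \<in> ?I2"
        and k: "\<And>a b. k a b \<noteq> 0 \<Longrightarrow> (Suc a, Suc b) \<in> ?I3"
        unfolding S_def scaled_on_def by blast
      have "x \<in> grids" unfolding x(1) using x by (intro grids_add grids_scal) auto
      moreover have "x a b \<in> kernel_ideal a b" for a b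
      proof -
        have z: "g a b \<in> zpoly" "h a b \<in> zpoly" "k a b \<in> zpoly" using x by (auto simp: grids_iff)
        have xab: "x a b = g a b + of_nat p * (h a b + k a b)" by (simp add: x(1) scal_def algebra_simps)
        consider "b < p - 1" | "\<not> b < p - 1" "a < p - 1 \<or> b < p\<^sup>2 - 1"
          | "\<not> b < p - 1" "\<not> (a < p - 1 \<or> b < p\<^sup>2 - 1)" by blast
        then show ?thesis
        proof cases
          case 1
          have "x a b \<in> zpoly" unfolding xab using z by auto
          then show ?thesis using 1 by (simp add: kernel_ideal_def kernel_multiple_def)
        next
          case 2
          have "g a b = 0" using g[of a b] 2(1) gs by auto
          then have "x a b = of_nat (kernel_multiple a b) * (h a b + k a b)"
            using 2 xab by (simp add: kernel_multiple_def)
          then show ?thesis unfolding kernel_ideal_def using z by blast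
        next
          case 3
          have "g a b = 0" "h a b = 0" "k a b = 0" using g[of a b] h[of a b] k[of a b] 3 gs by auto
          then have "x a b = of_nat (kernel_multiple a b) * 0" using xab by simp
          then show ?thesis unfolding kernel_ideal_def using zpoly_0 by blast
        qed
      qed
      ultimately show "x \<in> entrywise kernel_ideal" by (simp add: entrywise_def)
    qed
    then show "cyclic_class psq_ideal ` S \<subseteq> cyclic_class psq_ideal ` entrywise kernel_ideal" by (rule image_mono)
    show "cyclic_class psq_ideal ` entrywise kernel_ideal \<subseteq> cyclic_class psq_ideal ` S"
    proof
      fix z assume "z \<in> cyclic_class psq_ideal ` entrywise kernel_ideal"
      then obtain x where x: "z = cyclic_class psq_ideal x" "x \<in> grids" "\<And>a b. x a b \<in> kernel_ideal a b"
        by (auto simp: entrywise_def)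
      have "\<forall>a b. \<exists>c. c \<in> zpoly \<and> x a b = of_nat (kernel_multiple a b) * c"
        using x(3) by (auto simp: kernel_ideal_def)
      then obtain c where c: "\<And>a b. c a b \<in> zpoly" "\<And>a b. x a b = of_nat (kernel_multiple a b) * c a b" by metis
      have km: "kernel_multiple a b \<noteq> 0" for a b using p_gt_1 by (auto simp: kernel_multiple_def)
      have cg: "(\<lambda>a b. if R a b then c a b else 0) \<in> grids" for R
      proof -
        have "{(a, b). (if R a b then c a b else 0) \<noteq> 0} \<subseteq> {(a, b). x a b \<noteq> 0}"
          using c(2) km by auto
        then have "finite {(a, b). (if R a b then c a b else 0) \<noteq> 0}"
          by (rule finite_subset) (use x(2) in \<open>simp add: grids_iff\<close>)
        then show ?thesis using c(1) by (simp add: grids_iff)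
      qed
      \<comment> \<open>One grid for each family; a position that occurs in two families is assigned to one of them.\<close>
      define g where "g a b = (if b < p - 1 then c a b else 0)" for a b :: nat
      define h where "h a b = (if \<not> b < p - 1 \<and> \<not> a < p - 1 \<and> b < p\<^sup>2 - 1 then c a b else 0)" for a b
      define k where "k a b = (if \<not> b < p - 1 \<and> a < p - 1 then c a b else 0)" for a b
      have gr: "g \<in> grids" "h \<in> grids" "k \<in> grids"
        unfolding g_def[abs_def] h_def[abs_def] k_def[abs_def] by (rule cg)+
      define y where "y = scal (of_nat 1) g + scal (of_nat p) h + scal (of_nat p) k"
      have on: "(Suc a, Suc b) \<in> ?I1" if "g a b \<noteq> 0" for a b
        using that gs by (auto simp: g_def split: if_splits)
      have on2: "(Suc a, Suc b) \<in> ?I2" if "h a b \<noteq> 0" for a b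
        using that gs by (auto simp: h_def split: if_splits)
      have on3: "(Suc a, Suc b) \<in> ?I3" if "k a b \<noteq> 0" for a b
        using that gs by (auto simp: k_def split: if_splits)
      have "scal (of_nat 1) g \<in> scaled_on 1 ?I1" unfolding scaled_on_def using gr(1) on by blast
      moreover have "scal (of_nat p) h \<in> scaled_on p ?I2" unfolding scaled_on_def using gr(2) on2 by blast
      moreover have "scal (of_nat p) k \<in> scaled_on p ?I3" unfolding scaled_on_def using gr(3) on3 by blast
      ultimately have yS: "y \<in> S" unfolding S_def y_def by blast
      have yg: "y \<in> grids" unfolding y_def using gr by (intro grids_add grids_scal) auto
      have "x a b - y a b \<in> psq_ideal" for a b
      proof -
        have yab: "y a b = g a b + of_nat p * h a b + of_nat p * k a b" by (simp add: y_def scal_def)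
        consider "b < p - 1" | "\<not> b < p - 1" "a < p - 1 \<or> b < p\<^sup>2 - 1"
          | "\<not> b < p - 1" "\<not> (a < p - 1 \<or> b < p\<^sup>2 - 1)" by blast
        then show ?thesis
        proof cases
          case 3
          then have "x a b - y a b = of_nat p ^ 2 * c a b"
            unfolding c(2) yab by (simp add: kernel_multiple_def g_def h_def k_def)
          then show ?thesis unfolding psq_ideal_def using c(1) by blast
        qed (use stable_psq_ideal in \<open>auto simp: c(2) yab kernel_multiple_def g_def h_def k_def stable_iff_zpoly\<close>)
      qed
      then have "z = cyclic_class psq_ideal y" unfolding x(1) using presents_Mcyc(2)[OF x(2) yg] by blast
      then show "z \<in> cyclic_class psq_ideal ` S" using yS by blast
    qed
  qed
  ultimately show ?thesis unfolding E1_def Let_def e by simp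
qed

lemma entrywise_grids: "entrywise J \<subseteq> grids"
  by (auto simp: entrywise_def)

lemma presents_E1: "presents (ku p) scal (entrywise kernel_ideal) (cyclic_class psq_ideal) (E1 p)"
proof -
  have "stable (ku p) scal (entrywise kernel_ideal)"
    by (rule stable_entrywise[of kernel_ideal, OF stable_kernel_ideal])
  from presents_carrier[OF presents_Mcyc(1) this entrywise_grids] show ?thesis
    unfolding E1_eq .
qed

lemma degree_0_iso:
  "\<exists>\<phi> \<in> module_isos (ku p) (E0 p) (kunneth_E_infinity p 0).
     \<forall>i\<ge>1. \<forall>j\<ge>1. \<forall>c\<in>carrier (ku p).
       \<phi> (cyclic_gen p (E0_ideal_gens p) c i j) = kunneth_class p 0 c i j"
proof -
  note total = presents_total[where J = "\<lambda>_ _. zpoly" and I = "\<lambda>_ _. image_ideal",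
      OF stable_zpoly stable_image_ideal image_subset_zpoly psq_subset_image]
  have P: "presents (ku p) scal grids (total_class (\<lambda>_ _. image_ideal)) (kunneth_E_infinity p 0)"
    using total(1) unfolding entrywise_zpoly kunneth_E_infinity_0 .
  have same: "cyclic_class image_ideal x = cyclic_class image_ideal y \<longleftrightarrow>
      total_class (\<lambda>_ _. image_ideal) x = total_class (\<lambda>_ _. image_ideal) y"
    if "x \<in> grids" "y \<in> grids" for x y
    unfolding presents_cyclic_sum(2)[OF Idl_E0 stable_image_ideal image_subset_zpoly that]
      total(2)[unfolded entrywise_zpoly, OF that] ..
  have "\<exists>\<phi>\<in>module_isos (ku p) (E0 p) (kunneth_E_infinity p 0). \<forall>x\<in>grids.
      \<phi> (cyclic_class image_ideal x) = total_class (\<lambda>_ _. image_ideal) x"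
    by (rule presents_same_kernel_iso[OF presents_E0 P]) (rule same)
  then obtain \<phi> where \<phi>: "\<phi> \<in> module_isos (ku p) (E0 p) (kunneth_E_infinity p 0)"
     "\<forall>x\<in>grids. \<phi> (cyclic_class image_ideal x) = total_class (\<lambda>_ _. image_ideal) x"
    by blast
  show ?thesis
  proof (intro bexI[OF _ \<phi>(1)] allI impI ballI)
    fix i j :: nat and c assume ij: "i \<ge> 1" "j \<ge> 1" and c: "c \<in> carrier (ku p)"
    show "\<phi> (cyclic_gen p (E0_ideal_gens p) c i j) = kunneth_class p 0 c i j"
      using \<phi>(2) cell_scal_grids[of c i j] c kunneth_class_0[OF ij]
        cyclic_gen_eq[OF Idl_E0 stable_image_ideal image_subset_zpoly ij] by (simp add: carrier_ku)
  qed
qed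

text \<open>
  An element \<open>c[i,j]\<close> of \<open>E\<^sub>1\<close> is represented by a grid that has leading terms of cycles as entries; this
  grid differs from \<open>c[i,j]\<close> by multiples of \<open>p\<^sup>2\<close>, so \<open>c[i,j]\<close> itself is such a grid.
\<close>

lemma degree_1_iso:
  "\<exists>\<psi> \<in> module_isos (ku p) (E1 p) (kunneth_E_infinity p 1).
     \<forall>i\<ge>1. \<forall>j\<ge>1. \<forall>c\<in>carrier (ku p).
       cyclic_gen p (E1_ideal_gens p) c i j \<in> carrier (E1 p) \<longrightarrow>
       \<psi> (cyclic_gen p (E1_ideal_gens p) c i j) = kunneth_class p 1 c i j"
proof -
  note total = presents_total[where J = kernel_ideal and I = "\<lambda>_ _. psq_ideal",
      OF stable_kernel_ideal stable_psq_ideal psq_subset_kernel subset_refl]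
  have P: "presents (ku p) scal (entrywise kernel_ideal) (total_class (\<lambda>_ _. psq_ideal))
      (kunneth_E_infinity p 1)"
    using total(1) unfolding kunneth_E_infinity_1 .
  have same: "cyclic_class psq_ideal x = cyclic_class psq_ideal y \<longleftrightarrow>
      total_class (\<lambda>_ _. psq_ideal) x = total_class (\<lambda>_ _. psq_ideal) y"
    if "x \<in> entrywise kernel_ideal" "y \<in> entrywise kernel_ideal" for x y
    unfolding total(2)[OF that]
    by (rule presents_Mcyc(2)) (use that entrywise_grids in blast)+
  have "\<exists>\<psi>\<in>module_isos (ku p) (E1 p) (kunneth_E_infinity p 1). \<forall>x\<in>entrywise kernel_ideal.
      \<psi> (cyclic_class psq_ideal x) = total_class (\<lambda>_ _. psq_ideal) x"
    by (rule presents_same_kernel_iso[OF presents_E1 P]) (rule same)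
  then obtain \<psi> where \<psi>: "\<psi> \<in> module_isos (ku p) (E1 p) (kunneth_E_infinity p 1)"
     "\<forall>x\<in>entrywise kernel_ideal. \<psi> (cyclic_class psq_ideal x) = total_class (\<lambda>_ _. psq_ideal) x"
    by blast
  show ?thesis
  proof (intro bexI[OF _ \<psi>(1)] allI impI ballI)
    fix i j :: nat and c assume ij: "i \<ge> 1" "j \<ge> 1" and c: "c \<in> carrier (ku p)"
      and mem: "cyclic_gen p (E1_ideal_gens p) c i j \<in> carrier (E1 p)"
    have gen: "cyclic_gen p (E1_ideal_gens p) c i j = cyclic_class psq_ideal (scal c (cell i j))"
      by (rule cyclic_gen_eq[OF Idl_E1 stable_psq_ideal psq_ideal_zpoly ij])
    have cz: "c \<in> zpoly" using c by (simp add: carrier_ku)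
    have cg: "scal c (cell i j) \<in> grids" using cz by (rule cell_scal_grids)
    obtain x where x: "x \<in> entrywise kernel_ideal" "cyclic_class psq_ideal (scal c (cell i j)) = cyclic_class psq_ideal x"
      using mem unfolding gen presentsD(2)[OF presents_E1] by blast
    have diff: "scal c (cell i j) a b - x a b \<in> psq_ideal" for a b
      using presents_Mcyc(2)[OF cg, of x] x entrywise_grids by blast
    have "scal c (cell i j) a b \<in> kernel_ideal a b" for a b
    proof -
      have "scal c (cell i j) a b - x a b \<in> kernel_ideal a b" using diff psq_subset_kernel by blast
      moreover have "x a b \<in> kernel_ideal a b" using x(1) by (simp add: entrywise_def)
      ultimately have "(scal c (cell i j) a b - x a b) + x a b \<in> kernel_ideal a b"
        using stable_kernel_ideal[of a b] unfolding stable_iff_zpoly by blast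
      then show ?thesis by simp
    qed
    then have "scal c (cell i j) \<in> entrywise kernel_ideal" using cg by (simp add: entrywise_def)
    then show "\<psi> (cyclic_gen p (E1_ideal_gens p) c i j) = kunneth_class p 1 c i j"
      using \<psi>(2) unfolding gen kunneth_class_1[OF ij cz] by blast
  qed
qed

end

theorem theorem7p3:
  fixes p :: nat
  assumes "prime p"
  shows "(\<exists>\<phi> \<in> module_isos (ku p) (E0 p) (kunneth_E_infinity p 0).
            \<forall>i\<ge>1. \<forall>j\<ge>1. \<forall>c\<in>carrier (ku p).
              \<phi> (cyclic_gen p (E0_ideal_gens p) c i j) = kunneth_class p 0 c i j)
       \<and> (\<exists>\<psi> \<in> module_isos (ku p) (E1 p) (kunneth_E_infinity p 1).
            \<forall>i\<ge>1. \<forall>j\<ge>1. \<forall>c\<in>carrier (ku p).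
              cyclic_gen p (E1_ideal_gens p) c i j \<in> carrier (E1 p) \<longrightarrow>
              \<psi> (cyclic_gen p (E1_ideal_gens p) c i j) = kunneth_class p 1 c i j)"
proof -
  interpret prime_number p by standard (rule assms)
  show ?thesis using degree_0_iso degree_1_iso by (rule conjI)
qed

end
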